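(* Let $\psi \in L^2(\mathbb{R})$ be a wavelet, and let $m : [-\pi,\pi] \to \{0,1,2,\dots\}$ be its associated multiplicity function, i.e. the multiplicity function of the core representation of $\mathbb{Z}$ by integer translations on the core space $V_0$ of $\psi$. Then, for almost every $\xi \in [-\pi,\pi]$, $$m(\xi) = D_\psi(\xi), \qquad \text{where } D_\psi(\xi) = \sum_{j=1}^{\infty} \sum_{k \in \mathbb{Z}} |\hat{\psi}(2^j(\xi + 2\pi k))|^2 .$$
   Context: A function $\psi \in L^2(\mathbb{R})$ is a wavelet if $\{2^{j/2}\psi(2^j x + n) : j,n \in \mathbb{Z}\}$ is an orthonormal basis of $L^2(\mathbb{R})$. Define unitary operators on $L^2(\mathbb{R})$ by $Df(x) = \sqrt{2}\, f(2x)$ and $Tf(x) = f(x+1)$. The core space of a wavelet $\psi$ is $V_0 = \overline{\mathrm{span}}\{D^n T^l \psi : n < 0,\ l \in \mathbb{Z}\}$. It is invariant under $T$ and $T^{-1}$, and the unitary representation $l \mapsto T^l|_{V_0}$ of $\mathbb{Z}$ is called the core representation. It is known that the spectral measure class of the core representation is absolutely continuous with respect to Lebesgue measure on $[-\pi,\pi]$. Its multiplicity function $m$ is the function (unique up to null sets), with values in $\{0,1,2,\dots,\infty\}$, such that $T|_{V_0}$ is unitarily equivalent to multiplication by $e^{i\xi}$ on $\bigoplus_{n \ge 1} L^2(\{\xi \in [-\pi,\pi] : m(\xi) \ge n\})$. The Fourier transform in $D_\psi$ is normalized by $\hat{f}(\xi) = \int_{\mathbb{R}} f(x) e^{-ix\xi}\,dx$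 (extended to $L^2(\mathbb{R})$). Functions are identified when equal almost everywhere. *)

theory Defs
  imports "HOL-Analysis.Analysis"
begin

text \<open>Elements of \<open>L\<^sup>2(M)\<close> are represented by functions; identification of functions that agree
  almost everywhere is expressed by \<open>AE\<close> wherever it matters.\<close>

definition L2 :: "'a measure \<Rightarrow> ('a \<Rightarrow> complex) set" where
  "L2 M = {f \<in> borel_measurable M. integrable M (\<lambda>x. (cmod (f x))\<^sup>2)}"

definition L2_inner :: "'a measure \<Rightarrow> ('a \<Rightarrow> complex) \<Rightarrow> ('a \<Rightarrow> complex) \<Rightarrow> complex" where
  "L2_inner M f g = (LINT x|M. f x * cnj (g x))"

definition L2_norm :: "'a measure \<Rightarrow> ('a \<Rightarrow> complex) \<Rightarrow> real" where
  "L2_norm M f = sqrt (LINT x|M. (cmod (f x))\<^sup>2)"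

definition L2_closed_span :: "'a measure \<Rightarrow> ('a \<Rightarrow> complex) set \<Rightarrow> ('a \<Rightarrow> complex) set" where
  "L2_closed_span M S = {f \<in> L2 M. \<forall>\<epsilon>>0. \<exists>B c. finite B \<and> B \<subseteq> S \<and>
     L2_norm M (\<lambda>x. f x - (\<Sum>b\<in>B. c b * b x)) < \<epsilon>}"

definition L2_orthonormal_basis :: "'a measure \<Rightarrow> ('i \<Rightarrow> 'a \<Rightarrow> complex) \<Rightarrow> bool" where
  "L2_orthonormal_basis M e \<longleftrightarrow>
     (\<forall>i. e i \<in> L2 M) \<and>
     (\<forall>i j. L2_inner M (e i) (e j) = (if i = j then 1 else 0)) \<and>
     L2_closed_span M (range e) = L2 M"

definition wavelet :: "(real \<Rightarrow> complex) \<Rightarrow> bool" where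
  "wavelet \<psi> \<longleftrightarrow> \<psi> \<in> L2 lebesgue \<and>
     L2_orthonormal_basis lebesgue
       (\<lambda>(j :: int, n :: int) x. of_real (2 powr (of_int j / 2)) * \<psi> (2 powi j * x + of_int n))"

definition dilation :: "(real \<Rightarrow> complex) \<Rightarrow> real \<Rightarrow> complex" where
  "dilation f = (\<lambda>x. of_real (sqrt 2) * f (2 * x))"

definition translation :: "(real \<Rightarrow> complex) \<Rightarrow> real \<Rightarrow> complex" where
  "translation f = (\<lambda>x. f (x + 1))"

text \<open>Integer powers of a bijection. Both operators above are bijections of the whole function
  space \<open>real \<Rightarrow> complex\<close>, so \<open>inv\<close> is their genuine inverse.\<close>

definition int_iterate :: "('a \<Rightarrow> 'a) \<Rightarrow> int \<Rightarrow> 'a \<Rightarrow> 'a" where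
  "int_iterate F n = (if 0 \<le> n then F ^^ nat n else inv F ^^ nat (- n))"

definition core_space :: "(real \<Rightarrow> complex) \<Rightarrow> (real \<Rightarrow> complex) set" where
  "core_space \<psi> = L2_closed_span lebesgue
     {int_iterate dilation n (int_iterate translation l \<psi>) | n l. n < 0}"

text \<open>The Hilbert space direct sum of the spaces \<open>L\<^sup>2(M n)\<close>.\<close>

definition L2_sum :: "(nat \<Rightarrow> 'a measure) \<Rightarrow> (nat \<Rightarrow> 'a \<Rightarrow> complex) set" where
  "L2_sum M = {g. (\<forall>n. g n \<in> L2 (M n)) \<and> summable (\<lambda>n. (L2_norm (M n) (g n))\<^sup>2)}"

definition L2_sum_inner ::
    "(nat \<Rightarrow> 'a measure) \<Rightarrow> (nat \<Rightarrow> 'a \<Rightarrow> complex) \<Rightarrow> (nat \<Rightarrow> 'a \<Rightarrow> complex) \<Rightarrow> complex" where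
  "L2_sum_inner M g h = (\<Sum>n. L2_inner (M n) (g n) (h n))"

definition L2_sum_eq ::
    "(nat \<Rightarrow> 'a measure) \<Rightarrow> (nat \<Rightarrow> 'a \<Rightarrow> complex) \<Rightarrow> (nat \<Rightarrow> 'a \<Rightarrow> complex) \<Rightarrow> bool" where
  "L2_sum_eq M g h \<longleftrightarrow> (\<forall>n. AE x in M n. g n x = h n x)"

text \<open>\<open>U\<close> acts on representatives; preservation of the inner product makes it respect
  equality almost everywhere.\<close>

definition L2_unitary :: "'a measure \<Rightarrow> ('a \<Rightarrow> complex) set \<Rightarrow> (nat \<Rightarrow> 'b measure) \<Rightarrow>
    (('a \<Rightarrow> complex) \<Rightarrow> nat \<Rightarrow> 'b \<Rightarrow> complex) \<Rightarrow> bool" where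
  "L2_unitary M V N U \<longleftrightarrow>
     (\<forall>f\<in>V. U f \<in> L2_sum N) \<and>
     (\<forall>f\<in>V. \<forall>g\<in>V. \<forall>a b.
        L2_sum_eq N (U (\<lambda>x. a * f x + b * g x)) (\<lambda>n x. a * U f n x + b * U g n x)) \<and>
     (\<forall>f\<in>V. \<forall>g\<in>V. L2_sum_inner N (U f) (U g) = L2_inner M f g) \<and>
     (\<forall>h\<in>L2_sum N. \<exists>f\<in>V. L2_sum_eq N (U f) h)"

text \<open>The summand with index \<open>n\<close> belongs to the level set \<open>m \<ge> n + 1\<close>, so that \<open>n = 0, 1, 2, \<dots>\<close>
  runs through the levels \<open>1, 2, 3, \<dots>\<close>. Values of \<open>m\<close> outside \<open>[-\<pi>, \<pi>]\<close> are irrelevant.\<close>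

definition level_measure :: "(real \<Rightarrow> enat) \<Rightarrow> nat \<Rightarrow> real measure" where
  "level_measure m n = lebesgue_on {\<xi> \<in> {-pi..pi}. enat (Suc n) \<le> m \<xi>}"

definition core_multiplicity :: "(real \<Rightarrow> complex) \<Rightarrow> (real \<Rightarrow> enat) \<Rightarrow> bool" where
  "core_multiplicity \<psi> m \<longleftrightarrow>
     m \<in> lebesgue_on {-pi..pi} \<rightarrow>\<^sub>M count_space UNIV \<and>
     (\<exists>U. L2_unitary lebesgue (core_space \<psi>) (level_measure m) U \<and>
        (\<forall>f\<in>core_space \<psi>.
           L2_sum_eq (level_measure m) (U (translation f)) (\<lambda>n \<xi>. cis \<xi> * U f n \<xi>)))"

definition fourier_integral :: "(real \<Rightarrow> complex) \<Rightarrow> real \<Rightarrow> complex" where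
  "fourier_integral f \<xi> = (LINT x|lebesgue. f x * exp (- \<i> * of_real (x * \<xi>)))"

text \<open>The extension by continuity of the Fourier integral from \<open>L\<^sup>1 \<inter> L\<^sup>2\<close> to \<open>L\<^sup>2\<close>,
  determined up to a null set.\<close>

definition fourier_L2 :: "(real \<Rightarrow> complex) \<Rightarrow> real \<Rightarrow> complex" where
  "fourier_L2 f = (SOME F. F \<in> L2 lebesgue \<and>
     (\<forall>s. (\<forall>n::nat. s n \<in> L2 lebesgue \<and> integrable lebesgue (s n)) \<and>
           (\<lambda>n. L2_norm lebesgue (\<lambda>x. s n x - f x)) \<longlonglongrightarrow> 0 \<longrightarrow>
           (\<lambda>n. L2_norm lebesgue (\<lambda>\<xi>. fourier_integral (s n) \<xi> - F \<xi>)) \<longlonglongrightarrow> 0))"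

definition wavelet_dimension :: "(real \<Rightarrow> complex) \<Rightarrow> real \<Rightarrow> ennreal" where
  "wavelet_dimension \<psi> \<xi> = (\<Sum>\<^sub>\<infinity>j\<in>{1::nat..}. \<Sum>\<^sub>\<infinity>k\<in>(UNIV :: int set).
     ennreal ((cmod (fourier_L2 \<psi> (2 ^ j * (\<xi> + 2 * pi * of_int k))))\<^sup>2))"

end

theory Submission
  imports Defs
begin

text \<open>
  Write \<open>V\<^sub>0\<close> for the core space and \<open>E\<^sub>n\<close> for the level set \<open>m \<ge> n + 1\<close>. A unitary equivalence of
  the core representation with multiplication by \<open>e\<^sup>i\<^sup>\<xi>\<close> on the sum of the \<open>L\<^sup>2(E\<^sub>n)\<close> singles out vectors
  \<open>v\<^sub>n\<close> in \<open>V\<^sub>0\<close>, the preimages of the constants \<open>1 / sqrt (2 \<pi>)\<close> on \<open>E\<^sub>n\<close>. By Parseval's identity on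
  \<open>[-\<pi>, \<pi>]\<close> their integer translates form a Parseval frame of \<open>V\<^sub>0\<close>, and \<open>2 \<pi> \<langle>T\<^sup>l v\<^sub>n, v\<^sub>n\<rangle>\<close> is the integral of
  \<open>e\<^sup>i\<^sup>l\<^sup>\<xi>\<close> over \<open>E\<^sub>n\<close> (\<open>core_generators\<close>). By Plancherel the second property says that the
  \<open>2 \<pi>\<close>-periodization of the squared modulus of the transform of \<open>v\<^sub>n\<close> has the Fourier coefficients of
  the indicator of \<open>E\<^sub>n\<close>, hence equals it (\<open>periodized_power_density\<close>). Summing over \<open>n\<close> counts the
  level sets that contain \<open>\<xi>\<close>, so \<open>m\<close> is the periodization of the sum over \<open>n\<close> of \<open>|\<F> v\<^sub>n|\<^sup>2\<close>.

  The dimension function is the periodization of the sum over \<open>p \<ge> 1\<close> of \<open>|\<F> \<psi> (2\<^sup>p \<xi>)|\<^sup>2\<close>. So it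
  remains to see that these two sums agree almost everywhere before periodization
  (\<open>spectral_identity\<close>). Both describe the projection \<open>P\<close> to \<open>V\<^sub>0\<close>: the square of the norm of \<open>P f\<close> is
  the sum of the squared frame coefficients of \<open>f\<close>, and also the sum of its squared coefficients
  with respect to the wavelets of scale \<open>-p\<close>, \<open>p \<ge> 1\<close>, which are an orthonormal basis of \<open>V\<^sub>0\<close>
  (\<open>core_frame_identity\<close>). Take for \<open>f\<close> the function whose transform is the indicator of a set \<open>A\<close>. If
  \<open>A\<close> lies in an interval of length \<open>2 \<pi>\<close>, the frame side is, up to the factor \<open>2 \<pi>\<close>, the integral over \<open>A\<close>
  of the first sum. The wavelets of scale \<open>-p\<close> have frequency step \<open>2\<^sup>p\<close>, so with the same
  factor their part is the integral over \<open>A\<close> of \<open>|\<F> \<psi> (2\<^sup>p \<xi>)|\<^sup>2\<close> if \<open>A\<close> lies in an interval of length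
  \<open>2 \<pi> / 2\<^sup>p\<close>; for an interval of length \<open>2 \<pi> / 2\<^sup>N\<close> with \<open>N < p\<close> it is at most \<open>2\<^sup>p\<^sup>-\<^sup>N\<close> times that integral. Now cut a subset
  \<open>J\<close> of a dyadic shell along the grid of mesh \<open>2 \<pi> / 2\<^sup>N\<close> and add up. The scales with \<open>p \<le> N\<close> give what is
  wanted, and since the dilates \<open>2\<^sup>p J\<close> are disjoint, the others contribute at most \<open>2\<^sup>-\<^sup>N\<close> times the
  squared norm of the transform of \<open>\<psi>\<close>. Let \<open>N\<close> tend to infinity.

  The integral of the dimension function over one period is finite, which makes \<open>m\<close> finite
  almost everywhere.

  The analysis behind this is built up from integration theory. Completeness of \<open>L\<^sup>2\<close> gives
  projections to closed spans of orthonormal systems. Uniqueness of Fourier coefficients follows by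
  approximating indicators of arcs by trigonometric polynomials and yields Parseval's identity.
  Plancherel's theorem is Parseval's identity on a long interval, averaged over the frequency offset.
\<close>

abbreviation norm2 :: "(real \<Rightarrow> complex) \<Rightarrow> real" where
  "norm2 \<equiv> L2_norm lebesgue"

abbreviation inner2 :: "(real \<Rightarrow> complex) \<Rightarrow> (real \<Rightarrow> complex) \<Rightarrow> complex" where
  "inner2 \<equiv> L2_inner lebesgue"

abbreviation fourier_notation ("\<F>") where
  "\<F> \<equiv> fourier_integral"

abbreviation coeff_energy :: "(int \<Rightarrow> complex) \<Rightarrow> ennreal" where
  "coeff_energy c \<equiv> \<integral>\<^sup>+k. ennreal ((cmod (c k))\<^sup>2) \<partial>count_space UNIV"

section \<open>Square integrable functions\<close>

lemma borel_measurable_cnj [measurable (raw)]: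
  "f \<in> borel_measurable M \<Longrightarrow> (\<lambda>x. cnj (f x)) \<in> borel_measurable M"
  by (rule borel_measurable_continuous_on[of cnj]) (auto intro: continuous_intros)

lemma L2_measurable [measurable_dest]: "f \<in> L2 M \<Longrightarrow> f \<in> borel_measurable M"
  by (simp add: L2_def)

lemma L2_integrable_square: "f \<in> L2 M \<Longrightarrow> integrable M (\<lambda>x. (cmod (f x))\<^sup>2)"
  by (simp add: L2_def)

lemma L2_iff_nn_integral:
  "f \<in> L2 M \<longleftrightarrow> f \<in> borel_measurable M \<and> (\<integral>\<^sup>+x. ennreal ((cmod (f x))\<^sup>2) \<partial>M) < \<infinity>"
  unfolding L2_def by (auto simp: integrable_iff_bounded)

lemma nn_integral_L2_norm:
  assumes "f \<in> L2 M"
  shows "(\<integral>\<^sup>+x. ennreal ((cmod (f x))\<^sup>2) \<partial>M) = ennreal ((L2_norm M f)\<^sup>2)"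
  using assms by (simp add: L2_norm_def L2_def nn_integral_eq_integral)

lemma L2_norm_nonneg [simp]: "0 \<le> L2_norm M f"
  by (simp add: L2_norm_def)

lemma L2_dominated:
  assumes "f \<in> borel_measurable M" "g \<in> L2 M" "\<And>x. x \<in> space M \<Longrightarrow> cmod (f x) \<le> cmod (g x)"
  shows "f \<in> L2 M"
proof -
  have "integrable M (\<lambda>x. (cmod (f x))\<^sup>2)"
    by (rule Bochner_Integration.integrable_bound[OF L2_integrable_square[OF assms(2)]])
      (use assms in \<open>auto intro!: AE_I2 power_mono\<close>)
  with assms(1) show ?thesis by (simp add: L2_def)
qed

lemma L2_zero [simp]: "(\<lambda>x. 0) \<in> L2 M"
  by (simp add: L2_def)

lemma L2_scale: "f \<in> L2 M \<Longrightarrow> (\<lambda>x. c * f x) \<in> L2 M"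
  by (auto simp: L2_def norm_mult power_mult_distrib)

lemma L2_add:
  assumes "f \<in> L2 M" "g \<in> L2 M"
  shows "(\<lambda>x. f x + g x) \<in> L2 M"
proof -
  note [measurable] = L2_measurable[OF assms(1)] L2_measurable[OF assms(2)]
  have le: "(cmod (f x + g x))\<^sup>2 \<le> 2 * (cmod (f x))\<^sup>2 + 2 * (cmod (g x))\<^sup>2" for x
  proof -
    have "(cmod (f x + g x))\<^sup>2 \<le> (cmod (f x) + cmod (g x))\<^sup>2"
      by (intro power_mono norm_triangle_ineq) auto
    also have "\<dots> \<le> 2 * (cmod (f x))\<^sup>2 + 2 * (cmod (g x))\<^sup>2"
      using sum_squares_bound[of "cmod (f x)" "cmod (g x)"] by (simp add: power2_sum)
    finally show ?thesis .
  qed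
  have "integrable M (\<lambda>x. (cmod (f x + g x))\<^sup>2)"
    by (rule Bochner_Integration.integrable_bound
        [where f="\<lambda>x. 2 * (cmod (f x))\<^sup>2 + 2 * (cmod (g x))\<^sup>2"])
      (use assms le in \<open>auto simp: L2_def intro!: AE_I2\<close>)
  then show ?thesis by (simp add: L2_def)
qed

lemma L2_diff: "f \<in> L2 M \<Longrightarrow> g \<in> L2 M \<Longrightarrow> (\<lambda>x. f x - g x) \<in> L2 M"
  using L2_add[of f M "\<lambda>x. (-1) * g x"] L2_scale[of g M "-1"] by simp

lemma L2_sum_closed:
  assumes "\<And>i. i \<in> I \<Longrightarrow> f i \<in> L2 M"
  shows "(\<lambda>x. \<Sum>i\<in>I. f i x) \<in> L2 M"
  using assms by (induction I rule: infinite_finite_induct) (auto intro: L2_add)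

lemma L2_product_integrable:
  assumes "f \<in> L2 M" "g \<in> L2 M"
  shows "integrable M (\<lambda>x. f x * cnj (g x))"
proof -
  note [measurable] = L2_measurable[OF assms(1)] L2_measurable[OF assms(2)]
  have le: "cmod (f x * cnj (g x)) \<le> (cmod (f x))\<^sup>2 + (cmod (g x))\<^sup>2" for x
  proof -
    have "cmod (f x * cnj (g x)) = cmod (f x) * cmod (g x)"
      by (simp add: norm_mult)
    also have "\<dots> \<le> 2 * cmod (f x) * cmod (g x)"
      by (simp add: mult.assoc)
    also have "\<dots> \<le> (cmod (f x))\<^sup>2 + (cmod (g x))\<^sup>2"
      by (rule sum_squares_bound)
    finally show ?thesis .
  qed
  show ?thesis
  proof (rule Bochner_Integration.integrable_bound)
    show "integrable M (\<lambda>x. (cmod (f x))\<^sup>2 + (cmod (g x))\<^sup>2)"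
      using assms by (simp add: L2_def)
    show "(\<lambda>x. f x * cnj (g x)) \<in> borel_measurable M"
      by measurable
    show "AE x in M. norm (f x * cnj (g x)) \<le> norm ((cmod (f x))\<^sup>2 + (cmod (g x))\<^sup>2)"
      using le by (intro AE_I2) (simp only: real_norm_def abs_of_nonneg add_nonneg_nonneg zero_le_power2)
  qed
qed

lemma L2_inner_add_left:
  "f \<in> L2 M \<Longrightarrow> g \<in> L2 M \<Longrightarrow> h \<in> L2 M \<Longrightarrow>
    L2_inner M (\<lambda>x. f x + g x) h = L2_inner M f h + L2_inner M g h"
  by (simp add: L2_inner_def ring_distribs L2_product_integrable)

lemma L2_inner_diff_left:
  "f \<in> L2 M \<Longrightarrow> g \<in> L2 M \<Longrightarrow> h \<in> L2 M \<Longrightarrow>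
    L2_inner M (\<lambda>x. f x - g x) h = L2_inner M f h - L2_inner M g h"
  by (simp add: L2_inner_def ring_distribs L2_product_integrable)

lemma L2_inner_scale_left: "L2_inner M (\<lambda>x. c * f x) g = c * L2_inner M f g"
  by (simp add: L2_inner_def mult.assoc)

lemma L2_inner_cnj: "L2_inner M g f = cnj (L2_inner M f g)"
  by (simp add: L2_inner_def mult.commute flip: Bochner_Integration.integral_cnj)

lemma L2_inner_diff_right:
  "f \<in> L2 M \<Longrightarrow> g \<in> L2 M \<Longrightarrow> h \<in> L2 M \<Longrightarrow>
    L2_inner M h (\<lambda>x. f x - g x) = L2_inner M h f - L2_inner M h g"
  by (simp add: L2_inner_def ring_distribs L2_product_integrable)

lemma L2_inner_scale_right: "L2_inner M f (\<lambda>x. c * g x) = cnj c * L2_inner M f g"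
  by (simp add: L2_inner_def mult.left_commute)

lemma L2_inner_sum_left:
  assumes "\<And>i. i \<in> I \<Longrightarrow> f i \<in> L2 M" "g \<in> L2 M"
  shows "L2_inner M (\<lambda>x. \<Sum>i\<in>I. c i * f i x) g = (\<Sum>i\<in>I. c i * L2_inner M (f i) g)"
  using assms(1)
  by (induction I rule: infinite_finite_induct)
    (auto simp: L2_inner_add_left L2_inner_scale_left L2_scale L2_sum_closed assms(2),
     simp_all add: L2_inner_def)

lemma L2_inner_self:
  assumes "f \<in> L2 M"
  shows "L2_inner M f f = complex_of_real ((L2_norm M f)\<^sup>2)"
  using assms
  by (simp add: L2_inner_def L2_norm_def complex_norm_square[symmetric] flip: of_real_power)

lemma L2_norm_diff_square:
  assumes "f \<in> L2 M" "g \<in> L2 M"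
  shows "(L2_norm M (\<lambda>x. f x - g x))\<^sup>2
    = (L2_norm M f)\<^sup>2 + (L2_norm M g)\<^sup>2 - 2 * Re (L2_inner M f g)"
proof -
  let ?d = "\<lambda>x. f x - g x"
  have "complex_of_real ((L2_norm M ?d)\<^sup>2) = L2_inner M ?d ?d"
    by (rule L2_inner_self[symmetric]) (rule L2_diff[OF assms])
  also have "\<dots> = L2_inner M f f - L2_inner M f g - (L2_inner M g f - L2_inner M g g)"
    using assms by (simp add: L2_diff L2_inner_diff_left L2_inner_diff_right)
  also have "\<dots> = of_real ((L2_norm M f)\<^sup>2) + of_real ((L2_norm M g)\<^sup>2)
        - (L2_inner M f g + cnj (L2_inner M f g))"
    using assms by (simp add: L2_inner_self L2_inner_cnj[of M g f])
  also have "\<dots> = of_real ((L2_norm M f)\<^sup>2 + (L2_norm M g)\<^sup>2 - 2 * Re (L2_inner M f g))"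
    unfolding complex_add_cnj by simp
  finally show ?thesis
    unfolding of_real_eq_iff .
qed

lemma L2_Cauchy_Schwarz:
  assumes "f \<in> L2 M" "g \<in> L2 M"
  shows "cmod (L2_inner M f g) \<le> L2_norm M f * L2_norm M g"
proof -
  note [measurable] = L2_measurable[OF assms(1)] L2_measurable[OF assms(2)]
  have "ennreal ((cmod (L2_inner M f g))\<^sup>2) = (ennreal (cmod (L2_inner M f g)))\<^sup>2"
    by (simp add: ennreal_power)
  also have "\<dots> \<le> (\<integral>\<^sup>+x. ennreal (cmod (f x)) * ennreal (cmod (g x)) \<partial>M)\<^sup>2"
  proof (rule power_mono)
    have "ennreal (cmod (L2_inner M f g)) \<le> (\<integral>\<^sup>+x. norm (f x * cnj (g x)) \<partial>M)"
      unfolding L2_inner_def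
      by (rule integral_norm_bound_ennreal) (rule L2_product_integrable[OF assms])
    then show "ennreal (cmod (L2_inner M f g)) \<le> (\<integral>\<^sup>+x. ennreal (cmod (f x)) * ennreal (cmod (g x)) \<partial>M)"
      by (simp add: norm_mult ennreal_mult)
  qed auto
  also have "\<dots> \<le> (\<integral>\<^sup>+x. (ennreal (cmod (f x)))\<^sup>2 \<partial>M) * (\<integral>\<^sup>+x. (ennreal (cmod (g x)))\<^sup>2 \<partial>M)"
    by (rule Cauchy_Schwarz_nn_integral) auto
  also have "\<dots> = ennreal ((L2_norm M f * L2_norm M g)\<^sup>2)"
    by (simp add: ennreal_power nn_integral_L2_norm assms ennreal_mult power_mult_distrib)
  finally have "(cmod (L2_inner M f g))\<^sup>2 \<le> (L2_norm M f * L2_norm M g)\<^sup>2"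
    by (simp add: ennreal_le_iff)
  then show ?thesis
    by (rule power2_le_imp_le) simp
qed

lemma L2_norm_scale: "L2_norm M (\<lambda>x. c * f x) = cmod c * L2_norm M f"
  by (simp add: L2_norm_def norm_mult power_mult_distrib real_sqrt_mult)

lemma L2_norm_minus_commute: "L2_norm M (\<lambda>x. f x - g x) = L2_norm M (\<lambda>x. g x - f x)"
  by (simp add: L2_norm_def norm_minus_commute)

lemma L2_norm_triangle:
  assumes "f \<in> L2 M" "g \<in> L2 M"
  shows "L2_norm M (\<lambda>x. f x + g x) \<le> L2_norm M f + L2_norm M g"
proof -
  let ?g = "\<lambda>x. (-1) * g x"
  have "\<bar>Re (L2_inner M f ?g)\<bar> \<le> L2_norm M f * L2_norm M ?g"
    using abs_Re_le_cmod L2_Cauchy_Schwarz[OF assms(1) L2_scale[OF assms(2), of "-1"]]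
    by (rule order_trans)
  then have "(L2_norm M (\<lambda>x. f x - ?g x))\<^sup>2 \<le> (L2_norm M f + L2_norm M g)\<^sup>2"
    unfolding L2_norm_diff_square[OF assms(1) L2_scale[OF assms(2), of "-1"]] power2_sum
    unfolding L2_norm_scale by simp
  then have "L2_norm M (\<lambda>x. f x - ?g x) \<le> L2_norm M f + L2_norm M g"
    by (rule power2_le_imp_le) simp
  then show ?thesis by simp
qed

lemma L2_norm_triangle_diff:
  assumes "f \<in> L2 M" "g \<in> L2 M" "h \<in> L2 M"
  shows "L2_norm M (\<lambda>x. f x - h x) \<le> L2_norm M (\<lambda>x. f x - g x) + L2_norm M (\<lambda>x. g x - h x)"
  using L2_norm_triangle[OF L2_diff[OF assms(1,2)] L2_diff[OF assms(2,3)]] by simp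

lemma L2_norm_cong_AE:
  assumes "AE x in M. f x = g x" "f \<in> borel_measurable M" "g \<in> borel_measurable M"
  shows "L2_norm M f = L2_norm M g"
  unfolding L2_norm_def
  by (intro arg_cong[where f=sqrt] integral_cong_AE) (use assms in auto)

lemma L2_norm_eq_0:
  assumes "f \<in> L2 M" "L2_norm M f = 0"
  shows "AE x in M. f x = 0"
proof -
  have "(\<integral>\<^sup>+x. ennreal ((cmod (f x))\<^sup>2) \<partial>M) = 0"
    using assms by (simp add: nn_integral_L2_norm)
  then show ?thesis
    using L2_measurable[OF assms(1)] by (subst (asm) nn_integral_0_iff_AE) auto
qed

lemma tendsto_L2_inner:
  assumes f: "\<And>n. F n \<in> L2 M" "f \<in> L2 M" "(\<lambda>n. L2_norm M (\<lambda>x. F n x - f x)) \<longlonglongrightarrow> 0"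
    and g: "\<And>n. G n \<in> L2 M" "g \<in> L2 M" "(\<lambda>n. L2_norm M (\<lambda>x. G n x - g x)) \<longlonglongrightarrow> 0"
  shows "(\<lambda>n. L2_inner M (F n) (G n)) \<longlonglongrightarrow> L2_inner M f g"
proof -
  let ?d = "\<lambda>n. L2_norm M (\<lambda>x. F n x - f x)" and ?e = "\<lambda>n. L2_norm M (\<lambda>x. G n x - g x)"
  have *: "norm (L2_inner M (F n) (G n) - L2_inner M f g)
      \<le> ?d n * (?e n + L2_norm M g) + L2_norm M f * ?e n" for n
  proof -
    have "L2_inner M (F n) (G n) - L2_inner M f g
      = L2_inner M (\<lambda>x. F n x - f x) (G n) + L2_inner M f (\<lambda>x. G n x - g x)"
      using f g by (simp add: L2_inner_diff_left L2_inner_diff_right)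
    also have "norm \<dots> \<le> ?d n * L2_norm M (G n) + L2_norm M f * ?e n"
      by (rule order_trans[OF norm_triangle_ineq])
        (use f g in \<open>auto intro!: add_mono L2_Cauchy_Schwarz L2_diff\<close>)
    also have "L2_norm M (G n) \<le> ?e n + L2_norm M g"
      using L2_norm_triangle[OF L2_diff[OF g(1)[of n] g(2)] g(2)] by simp
    finally show ?thesis by (simp add: mult_left_mono)
  qed
  have "(\<lambda>n. ?d n * (?e n + L2_norm M g) + L2_norm M f * ?e n)
      \<longlonglongrightarrow> 0 * (0 + L2_norm M g) + L2_norm M f * 0"
    by (intro tendsto_intros f g)
  then have lim: "(\<lambda>n. ?d n * (?e n + L2_norm M g) + L2_norm M f * ?e n) \<longlonglongrightarrow> 0"
    by simp
  have "(\<lambda>n. L2_inner M (F n) (G n) - L2_inner M f g) \<longlonglongrightarrow> 0"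
    by (rule Lim_null_comparison[OF always_eventually lim]) (use * in blast)
  then show ?thesis by (simp add: LIM_zero_iff)
qed

lemma tendsto_L2_norm:
  assumes f: "\<And>n. F n \<in> L2 M" "f \<in> L2 M" "(\<lambda>n. L2_norm M (\<lambda>x. F n x - f x)) \<longlonglongrightarrow> 0"
  shows "(\<lambda>n. L2_norm M (F n)) \<longlonglongrightarrow> L2_norm M f"
proof -
  have *: "norm (L2_norm M (F n) - L2_norm M f) \<le> L2_norm M (\<lambda>x. F n x - f x)" for n
  proof -
    have "L2_norm M (F n) \<le> L2_norm M (\<lambda>x. F n x - f x) + L2_norm M f"
      using L2_norm_triangle[OF L2_diff[OF f(1)[of n] f(2)] f(2)] by simp
    moreover have "L2_norm M f \<le> L2_norm M (\<lambda>x. F n x - f x) + L2_norm M (F n)"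
      using L2_norm_triangle[OF L2_diff[OF f(2) f(1)[of n]] f(1)[of n]]
      unfolding L2_norm_minus_commute[of M f "F n"] by simp
    ultimately show ?thesis unfolding real_norm_def by linarith
  qed
  have "(\<lambda>n. L2_norm M (F n) - L2_norm M f) \<longlonglongrightarrow> 0"
    by (rule Lim_null_comparison[OF always_eventually f(3)]) (use * in blast)
  then show ?thesis by (simp add: LIM_zero_iff)
qed

text \<open>The weights \<open>2\<^sup>k\<close> force geometric decay of \<open>d k\<close>.\<close>
lemma summable_norm_if_weighted_squares_finite:
  fixes d :: "nat \<Rightarrow> 'a :: banach"
  assumes "(\<Sum>k. ennreal (2 ^ k * (norm (d k))\<^sup>2)) < \<infinity>"
  shows "summable d"
proof -
  have s: "summable (\<lambda>k. 2 ^ k * (norm (d k))\<^sup>2)"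
    using assms by (intro summable_suminf_not_top) auto
  then have "Bseq (\<lambda>k. 2 ^ k * (norm (d k))\<^sup>2)"
    using summable_LIMSEQ_zero convergentI convergent_imp_Bseq by blast
  then obtain C where C: "C > 0" "\<And>k. 2 ^ k * (norm (d k))\<^sup>2 \<le> C"
    by (auto simp: Bseq_def)
  have b: "norm (d k) \<le> sqrt C * (1 / sqrt 2) ^ k" for k
  proof -
    have "(norm (d k))\<^sup>2 \<le> C * (1 / 2) ^ k"
      using C(2)[of k] by (simp add: field_simps)
    also have "\<dots> = (sqrt C * (1 / sqrt 2) ^ k)\<^sup>2"
    proof -
      have "((1 / sqrt 2 :: real) ^ k)\<^sup>2 = ((1 / sqrt 2)\<^sup>2) ^ k"
        by (simp only: power_mult[symmetric] mult.commute)
      then show ?thesis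
        using C(1) by (simp add: power_mult_distrib power_divide)
    qed
    finally show ?thesis
      using C(1) by (intro power2_le_imp_le[of "norm (d k)"]) auto
  qed
  show ?thesis
    by (rule summable_comparison_test[where g="\<lambda>k. sqrt C * (1 / sqrt 2) ^ k"])
      (use b in \<open>auto intro!: summable_mult summable_geometric\<close>)
qed

text \<open>A subsequence whose consecutive differences \<open>d k\<close> have norm at most \<open>2\<^sup>-\<^sup>k\<close> converges almost
  everywhere, because the sum of the \<open>2\<^sup>k |d k|\<^sup>2\<close> has a finite integral. Fatou's lemma turns the Cauchy
  estimate along the subsequence into convergence in norm to its pointwise limit.\<close>
lemma L2_complete:
  assumes F: "\<And>n. F n \<in> L2 M"
    and cauchy: "\<And>e. e > 0 \<Longrightarrow> \<exists>N. \<forall>m\<ge>N. \<forall>n\<ge>N. L2_norm M (\<lambda>x. F m x - F n x) < e"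
  shows "\<exists>f\<in>L2 M. (\<lambda>n. L2_norm M (\<lambda>x. F n x - f x)) \<longlonglongrightarrow> 0"
proof -
  note [measurable] = L2_measurable[OF F]
  have "\<forall>k. \<exists>N. \<forall>m\<ge>N. \<forall>n\<ge>N. L2_norm M (\<lambda>x. F m x - F n x) < (1/2) ^ k"
    by (intro allI cauchy) simp
  then obtain N where N: "\<And>k m n. m \<ge> N k \<Longrightarrow> n \<ge> N k \<Longrightarrow> L2_norm M (\<lambda>x. F m x - F n x) < (1/2) ^ k"
    by metis
  define r where "r k = k + (\<Sum>i\<le>k. N i)" for k
  have rN: "N k \<le> r k" for k
    unfolding r_def by (intro trans_le_add2 member_le_sum) auto
  have rmono: "strict_mono r"
    by (rule strict_monoI_Suc) (simp add: r_def)
  define d where "d k x = F (r (Suc k)) x - F (r k) x" for k x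
  have dL2: "d k \<in> L2 M" for k
    unfolding d_def[abs_def] by (intro L2_diff F)
  have [measurable]: "d k \<in> borel_measurable M" for k
    by (rule L2_measurable[OF dL2])
  have dle: "(L2_norm M (d k))\<^sup>2 \<le> (1/4) ^ k" for k
  proof -
    have "L2_norm M (d k) \<le> (1/2) ^ k"
      unfolding d_def[abs_def]
      by (rule less_imp_le[OF N])
        (use rN[of k] strict_monoD[OF rmono, of k "Suc k"] in auto)
    then have "(L2_norm M (d k))\<^sup>2 \<le> ((1/2) ^ k)\<^sup>2" by (intro power_mono) auto
    also have "((1/2 :: real) ^ k)\<^sup>2 = ((1/2)\<^sup>2) ^ k"
      by (simp only: power_mult[symmetric] mult.commute)
    finally show ?thesis by (simp add: power_divide)
  qed
  have "(\<integral>\<^sup>+x. (\<Sum>k. ennreal (2 ^ k * (norm (d k x))\<^sup>2)) \<partial>M)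
      = (\<Sum>k. (\<integral>\<^sup>+x. ennreal (2 ^ k * (norm (d k x))\<^sup>2) \<partial>M))"
    by (intro nn_integral_suminf) auto
  also have "\<dots> = (\<Sum>k. ennreal (2 ^ k * (L2_norm M (d k))\<^sup>2))"
    by (simp add: ennreal_mult nn_integral_cmult nn_integral_L2_norm[OF dL2])
  also have "\<dots> \<le> (\<Sum>k. ennreal ((1/2) ^ k))"
  proof (intro suminf_le summableI ennreal_leI)
    fix k :: nat
    have "2 ^ k * (L2_norm M (d k))\<^sup>2 \<le> 2 ^ k * (1/4) ^ k"
      by (intro mult_left_mono dle) auto
    also have "\<dots> = (1/2 :: real) ^ k" by (simp flip: power_mult_distrib)
    finally show "2 ^ k * (L2_norm M (d k))\<^sup>2 \<le> (1/2) ^ k" .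
  qed
  also have "\<dots> < \<infinity>"
    by (subst suminf_ennreal2) (auto intro: summable_geometric)
  finally have "AE x in M. (\<Sum>k. ennreal (2 ^ k * (norm (d k x))\<^sup>2)) \<noteq> \<infinity>"
    by (intro nn_integral_PInf_AE) auto
  then have ae: "AE x in M. convergent (\<lambda>k. F (r k) x)"
  proof eventually_elim
    case (elim x)
    then have "summable (\<lambda>k. d k x)"
      by (intro summable_norm_if_weighted_squares_finite) (simp add: top.not_eq_extremum)
    then have "convergent (\<lambda>n. F (r 0) x + (\<Sum>k<n. d k x))"
      by (intro convergent_add convergent_const) (simp add: summable_iff_convergent)
    also have "(\<lambda>n. F (r 0) x + (\<Sum>k<n. d k x)) = (\<lambda>k. F (r k) x)"
      by (simp add: d_def sum_lessThan_telescope[where f="\<lambda>k. F (r k) x"])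
    finally show ?case .
  qed
  define f where "f x = lim (\<lambda>k. F (r k) x)" for x
  have [measurable]: "f \<in> borel_measurable M"
    unfolding f_def[abs_def] by (rule borel_measurable_lim_metric) simp
  have key: "(\<integral>\<^sup>+x. ennreal ((cmod (F n x - f x))\<^sup>2) \<partial>M) \<le> ennreal (e\<^sup>2)"
    if e: "e > 0" and n: "n \<ge> K" and K: "\<forall>m\<ge>K. \<forall>n\<ge>K. L2_norm M (\<lambda>x. F m x - F n x) < e" for e n K
  proof -
    have "(\<integral>\<^sup>+x. ennreal ((cmod (F n x - f x))\<^sup>2) \<partial>M)
        = (\<integral>\<^sup>+x. liminf (\<lambda>k. ennreal ((cmod (F n x - F (r k) x))\<^sup>2)) \<partial>M)"
    proof (rule nn_integral_cong_AE)
      show "AE x in M. ennreal ((cmod (F n x - f x))\<^sup>2) = liminf (\<lambda>k. ennreal ((cmod (F n x - F (r k) x))\<^sup>2))"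
        using ae
      proof eventually_elim
        case (elim x)
        then have "(\<lambda>k. F (r k) x) \<longlonglongrightarrow> f x" by (simp add: f_def convergent_LIMSEQ_iff)
        then have "(\<lambda>k. ennreal ((cmod (F n x - F (r k) x))\<^sup>2)) \<longlonglongrightarrow> ennreal ((cmod (F n x - f x))\<^sup>2)"
          by (intro tendsto_ennrealI tendsto_intros)
        then show ?case by (intro lim_imp_Liminf[symmetric]) auto
      qed
    qed
    also have "\<dots> \<le> liminf (\<lambda>k. \<integral>\<^sup>+x. ennreal ((cmod (F n x - F (r k) x))\<^sup>2) \<partial>M)"
      by (intro nn_integral_liminf) auto
    also have "\<dots> \<le> limsup (\<lambda>k. \<integral>\<^sup>+x. ennreal ((cmod (F n x - F (r k) x))\<^sup>2) \<partial>M)"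
      by (rule Liminf_le_Limsup) simp
    also have "\<dots> \<le> ennreal (e\<^sup>2)"
    proof (rule Limsup_bounded, rule eventually_sequentiallyI[of K])
      fix k assume "k \<ge> K"
      then have "r k \<ge> K" using seq_suble[OF rmono, of k] by linarith
      with K n have "L2_norm M (\<lambda>x. F n x - F (r k) x) < e" by blast
      then have "(L2_norm M (\<lambda>x. F n x - F (r k) x))\<^sup>2 \<le> e\<^sup>2"
        by (intro power_mono) auto
      then show "(\<integral>\<^sup>+x. ennreal ((cmod (F n x - F (r k) x))\<^sup>2) \<partial>M) \<le> ennreal (e\<^sup>2)"
        by (subst nn_integral_L2_norm[OF L2_diff[OF F F]]) (rule ennreal_leI)
    qed
    finally show ?thesis .
  qed
  have dL: "\<exists>K. \<forall>n\<ge>K. (\<lambda>x. F n x - f x) \<in> L2 M \<and> L2_norm M (\<lambda>x. F n x - f x) \<le> e" if "e > 0" for e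
  proof -
    obtain K where K: "\<forall>m\<ge>K. \<forall>n\<ge>K. L2_norm M (\<lambda>x. F m x - F n x) < e" using cauchy[OF \<open>e > 0\<close>] by blast
    have "(\<lambda>x. F n x - f x) \<in> L2 M \<and> L2_norm M (\<lambda>x. F n x - f x) \<le> e" if n: "n \<ge> K" for n
    proof
      note k = key[OF \<open>e > 0\<close> n K]
      show *: "(\<lambda>x. F n x - f x) \<in> L2 M"
        unfolding L2_iff_nn_integral using k by (auto intro: le_less_trans)
      show "L2_norm M (\<lambda>x. F n x - f x) \<le> e"
        using k \<open>e > 0\<close> unfolding nn_integral_L2_norm[OF *]
        by (subst (asm) ennreal_le_iff) (auto intro: power2_le_imp_le)
    qed
    then show ?thesis by blast
  qed
  have fL2: "f \<in> L2 M"
  proof -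
    obtain n where "(\<lambda>x. F n x - f x) \<in> L2 M" using dL[of 1] by auto
    from L2_diff[OF F[of n] this] show ?thesis by simp
  qed
  have "(\<lambda>n. L2_norm M (\<lambda>x. F n x - f x)) \<longlonglongrightarrow> 0"
  proof (rule LIMSEQ_I)
    fix e :: real assume "e > 0"
    then obtain K where "\<forall>n\<ge>K. L2_norm M (\<lambda>x. F n x - f x) \<le> e / 2" using dL[of "e/2"] by auto
    with \<open>e > 0\<close> show "\<exists>K. \<forall>n\<ge>K. norm (L2_norm M (\<lambda>x. F n x - f x) - 0) < e"
      by (intro exI[of _ K]) (force simp: abs_of_nonneg)
  qed
  with fL2 show ?thesis by blast
qed

section \<open>Orthonormal systems\<close>
lemma L2_inner_finite_expansion:
  fixes e :: "'i \<Rightarrow> 'a \<Rightarrow> complex"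
  assumes e: "\<And>i. i \<in> I \<Longrightarrow> e i \<in> L2 M"
    and on: "\<And>i j. i \<in> I \<Longrightarrow> j \<in> I \<Longrightarrow> L2_inner M (e i) (e j) = (if i = j then 1 else 0)"
    and J: "finite J" "J \<subseteq> I" and i: "i \<in> I"
  shows "L2_inner M (\<lambda>x. \<Sum>j\<in>J. c j * e j x) (e i) = (if i \<in> J then c i else 0)"
proof -
  have "L2_inner M (\<lambda>x. \<Sum>j\<in>J. c j * e j x) (e i) = (\<Sum>j\<in>J. c j * L2_inner M (e j) (e i))"
    by (rule L2_inner_sum_left) (use e J i in auto)
  also have "\<dots> = (\<Sum>j\<in>J. if j = i then c i else 0)"
    by (intro sum.cong) (use on J i in auto)
  finally show ?thesis using J by simp
qed

lemma L2_norm_finite_expansion: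
  fixes e :: "'i \<Rightarrow> 'a \<Rightarrow> complex"
  assumes e: "\<And>i. i \<in> I \<Longrightarrow> e i \<in> L2 M"
    and on: "\<And>i j. i \<in> I \<Longrightarrow> j \<in> I \<Longrightarrow> L2_inner M (e i) (e j) = (if i = j then 1 else 0)"
    and J: "finite J" "J \<subseteq> I"
  shows "(L2_norm M (\<lambda>x. \<Sum>j\<in>J. c j * e j x))\<^sup>2 = (\<Sum>j\<in>J. (cmod (c j))\<^sup>2)"
proof -
  let ?S = "\<lambda>x. \<Sum>j\<in>J. c j * e j x"
  have S: "?S \<in> L2 M"
    using e J by (intro L2_sum_closed L2_scale) auto
  have "L2_inner M ?S ?S = (\<Sum>j\<in>J. c j * L2_inner M (e j) ?S)"
    by (rule L2_inner_sum_left) (use e J S in auto)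
  also have "\<dots> = (\<Sum>j\<in>J. c j * cnj (c j))"
    by (intro sum.cong refl)
      (use J in \<open>auto simp: L2_inner_cnj[of M "e _" ?S] L2_inner_finite_expansion[OF e on J]\<close>)
  also have "\<dots> = of_real (\<Sum>j\<in>J. (cmod (c j))\<^sup>2)"
    unfolding of_real_sum complex_norm_square ..
  finally show ?thesis
    unfolding L2_inner_self[OF S] of_real_eq_iff .
qed

text \<open>Among all combinations of the \<open>e j\<close>, the one with the coefficients \<open>\<langle>f, e j\<rangle>\<close> is nearest to \<open>f\<close>,
  because the difference to it is orthogonal to each \<open>e j\<close>.\<close>

lemma L2_norm_diff_finite_expansion:
  fixes e :: "'i \<Rightarrow> 'a \<Rightarrow> complex"
  assumes e: "\<And>i. i \<in> I \<Longrightarrow> e i \<in> L2 M"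
    and on: "\<And>i j. i \<in> I \<Longrightarrow> j \<in> I \<Longrightarrow> L2_inner M (e i) (e j) = (if i = j then 1 else 0)"
    and J: "finite J" "J \<subseteq> I" and f: "f \<in> L2 M"
  shows "(L2_norm M (\<lambda>x. f x - (\<Sum>j\<in>J. c j * e j x)))\<^sup>2
    = (L2_norm M f)\<^sup>2 - (\<Sum>j\<in>J. (cmod (L2_inner M f (e j)))\<^sup>2)
      + (\<Sum>j\<in>J. (cmod (c j - L2_inner M f (e j)))\<^sup>2)"
proof -
  let ?S = "\<lambda>x. \<Sum>j\<in>J. c j * e j x" and ?a = "\<lambda>j. L2_inner M f (e j)"
  have S: "?S \<in> L2 M"
    using e J by (intro L2_sum_closed L2_scale) auto
  have "L2_inner M ?S f = (\<Sum>j\<in>J. c j * L2_inner M (e j) f)"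
    by (rule L2_inner_sum_left) (use e J f in auto)
  also have "\<dots> = (\<Sum>j\<in>J. c j * cnj (?a j))"
    by (simp add: L2_inner_cnj[of M "e _" f])
  finally have "Re (L2_inner M f ?S) = (\<Sum>j\<in>J. Re (c j * cnj (?a j)))"
    unfolding L2_inner_cnj[of M f ?S] by (simp only: complex_cnj cnj.sel Re_sum)
  moreover have "(L2_norm M ?S)\<^sup>2 = (\<Sum>j\<in>J. (cmod (c j))\<^sup>2)"
    by (rule L2_norm_finite_expansion[OF e on J])
  ultimately have "(L2_norm M (\<lambda>x. f x - ?S x))\<^sup>2
      = (L2_norm M f)\<^sup>2 + (\<Sum>j\<in>J. (cmod (c j))\<^sup>2) - 2 * (\<Sum>j\<in>J. Re (c j * cnj (?a j)))"
    unfolding L2_norm_diff_square[OF f S] by (simp only:)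
  also have "\<dots> = (L2_norm M f)\<^sup>2 + (\<Sum>j\<in>J. (cmod (c j))\<^sup>2 - 2 * Re (c j * cnj (?a j)))"
    by (simp add: sum_subtractf sum_distrib_left)
  also have "(\<Sum>j\<in>J. (cmod (c j))\<^sup>2 - 2 * Re (c j * cnj (?a j)))
      = (\<Sum>j\<in>J. (cmod (c j - ?a j))\<^sup>2 - (cmod (?a j))\<^sup>2)"
    by (intro sum.cong refl) (simp add: cmod_power2 power2_diff algebra_simps)
  finally show ?thesis
    by (simp add: sum_subtractf)
qed

text \<open>The partial sums of the expansion of \<open>f\<close> form a Cauchy sequence by Bessel's inequality; their limit
  \<open>h\<close> is the orthogonal projection of \<open>f\<close> to the closed span.\<close>
lemma L2_orthonormal_projection_nat:
  fixes e :: "nat \<Rightarrow> 'a \<Rightarrow> complex"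
  assumes e: "\<And>i. e i \<in> L2 M"
    and on: "\<And>i j. L2_inner M (e i) (e j) = (if i = j then 1 else 0)"
    and f: "f \<in> L2 M"
  shows "\<exists>h\<in>L2_closed_span M (range e). (\<forall>i. L2_inner M h (e i) = L2_inner M f (e i)) \<and>
    (\<Sum>i. ennreal ((cmod (L2_inner M f (e i)))\<^sup>2)) = ennreal ((L2_norm M h)\<^sup>2)"
proof -
  define a where "a i = L2_inner M f (e i)" for i
  define S where "S n x = (\<Sum>i<n. a i * e i x)" for n x
  have e': "\<And>i. i \<in> UNIV \<Longrightarrow> e i \<in> L2 M" and
    on': "\<And>i j. i \<in> UNIV \<Longrightarrow> j \<in> UNIV \<Longrightarrow> L2_inner M (e i) (e j) = (if i = j then 1 else 0)"
    using e on by auto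
  have S: "S n \<in> L2 M" for n
    unfolding S_def[abs_def] by (intro L2_sum_closed L2_scale e)
  have bessel: "(\<Sum>i<n. (cmod (a i))\<^sup>2) \<le> (L2_norm M f)\<^sup>2" for n
    using L2_norm_diff_finite_expansion[OF e' on' finite_lessThan subset_UNIV f, of a n]
      zero_le_power2[of "L2_norm M (\<lambda>x. f x - (\<Sum>i<n. a i * e i x))"]
    unfolding a_def[symmetric] by simp
  have sa: "summable (\<lambda>i. (cmod (a i))\<^sup>2)"
    by (rule summableI_nonneg_bounded[OF _ bessel]) simp
  have diff: "(L2_norm M (\<lambda>x. S n x - S m x))\<^sup>2 = (\<Sum>i\<in>{m..<n}. (cmod (a i))\<^sup>2)" if "m \<le> n" for m n
  proof -
    have "(\<lambda>x. S n x - S m x) = (\<lambda>x. \<Sum>i\<in>{m..<n}. a i * e i x)"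
      using that by (simp add: S_def fun_eq_iff sum_diff_nat_ivl lessThan_atLeast0)
    then show ?thesis
      using L2_norm_finite_expansion[OF e' on' finite_atLeastLessThan subset_UNIV, of a m n] by simp
  qed
  have "\<exists>h\<in>L2 M. (\<lambda>n. L2_norm M (\<lambda>x. S n x - h x)) \<longlonglongrightarrow> 0"
  proof (rule L2_complete[OF S])
    fix r :: real assume "r > 0"
    then have "r\<^sup>2 > 0" by simp
    with sa obtain N where N: "\<And>m n. m \<ge> N \<Longrightarrow> norm (\<Sum>i\<in>{m..<n}. (cmod (a i))\<^sup>2) < r\<^sup>2"
      unfolding summable_Cauchy by blast
    have 1: "L2_norm M (\<lambda>x. S n x - S m x) < r" if "m \<ge> N" "m \<le> n" for m n
    proof -
      have "(L2_norm M (\<lambda>x. S n x - S m x))\<^sup>2 < r\<^sup>2"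
        unfolding diff[OF that(2)]
        by (rule le_less_trans[OF _ N[OF that(1), of n]]) (simp only: real_norm_def abs_ge_self)
      then show ?thesis
        by (rule power2_less_imp_less) (simp add: less_imp_le[OF \<open>r > 0\<close>])
    qed
    have "L2_norm M (\<lambda>x. S m x - S n x) < r" if "m \<ge> N" "n \<ge> N" for m n
    proof (cases "m \<le> n")
      case True
      with 1[of m n] that show ?thesis by (subst L2_norm_minus_commute) simp
    next
      case False
      with 1[of n m] that show ?thesis by simp
    qed
    then show "\<exists>N. \<forall>m\<ge>N. \<forall>n\<ge>N. L2_norm M (\<lambda>x. S m x - S n x) < r" by blast
  qed
  then obtain h where h: "h \<in> L2 M" "(\<lambda>n. L2_norm M (\<lambda>x. S n x - h x)) \<longlonglongrightarrow> 0" by blast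
  have coef: "L2_inner M h (e i) = a i" for i
  proof (rule LIMSEQ_unique)
    show "(\<lambda>n. L2_inner M (S n) (e i)) \<longlonglongrightarrow> L2_inner M h (e i)"
      by (rule tendsto_L2_inner[OF S h e e]) (simp add: L2_norm_def)
    have "L2_inner M (S n) (e i) = a i" if "n > i" for n
      using L2_inner_finite_expansion[OF e' on' finite_lessThan subset_UNIV UNIV_I, of a n i] that
      by (simp add: S_def[abs_def])
    then show "(\<lambda>n. L2_inner M (S n) (e i)) \<longlonglongrightarrow> a i"
      by (intro tendsto_eventually) (auto intro: eventually_sequentiallyI[of "Suc i"])
  qed
  have "(\<lambda>n. (L2_norm M (S n))\<^sup>2) \<longlonglongrightarrow> (L2_norm M h)\<^sup>2"
    by (intro tendsto_power tendsto_L2_norm[OF S h])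
  moreover have "(L2_norm M (S n))\<^sup>2 = (\<Sum>i<n. (cmod (a i))\<^sup>2)" for n
    using L2_norm_finite_expansion[OF e' on' finite_lessThan subset_UNIV, of a n]
    by (simp add: S_def[abs_def])
  ultimately have "(\<lambda>i. (cmod (a i))\<^sup>2) sums (L2_norm M h)\<^sup>2"
    by (simp add: sums_def)
  then have sq: "(\<Sum>i. ennreal ((cmod (a i))\<^sup>2)) = ennreal ((L2_norm M h)\<^sup>2)"
    by (subst suminf_ennreal2) (auto simp: sums_iff)
  have inj: "inj e"
  proof (rule injI, rule ccontr)
    fix i j assume "e i = e j" "i \<noteq> j"
    with on[of i j] on[of i i] show False by simp
  qed
  have "h \<in> L2_closed_span M (range e)"
    unfolding L2_closed_span_def
  proof (intro CollectI conjI allI impI h)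
    fix r :: real assume "r > 0"
    from LIMSEQ_D[OF h(2) this] obtain n where n: "L2_norm M (\<lambda>x. S n x - h x) < r" by auto
    have "S n x = (\<Sum>b\<in>e ` {..<n}. a (inv e b) * b x)" for x
      by (subst sum.reindex) (auto simp: S_def inj inj_on_subset[OF inj])
    then show "\<exists>B c. finite B \<and> B \<subseteq> range e \<and> L2_norm M (\<lambda>x. h x - (\<Sum>b\<in>B. c b * b x)) < r"
      using n by (intro exI[of _ "e ` {..<n}"] exI[of _ "\<lambda>b. a (inv e b)"])
        (auto simp: L2_norm_minus_commute[of M h])
  qed
  with coef sq show ?thesis unfolding a_def by blast
qed

lemma L2_orthonormal_projection:
  fixes e :: "'i \<Rightarrow> 'a \<Rightarrow> complex" and I :: "'i set"
  assumes I: "countable I" "infinite I"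
    and e: "\<And>i. i \<in> I \<Longrightarrow> e i \<in> L2 M"
    and on: "\<And>i j. i \<in> I \<Longrightarrow> j \<in> I \<Longrightarrow> L2_inner M (e i) (e j) = (if i = j then 1 else 0)"
    and f: "f \<in> L2 M"
  obtains h where "h \<in> L2_closed_span M (e ` I)"
    "\<And>i. i \<in> I \<Longrightarrow> L2_inner M h (e i) = L2_inner M f (e i)"
    "(\<integral>\<^sup>+i. ennreal ((cmod (L2_inner M f (e i)))\<^sup>2) \<partial>count_space I) = ennreal ((L2_norm M h)\<^sup>2)"
proof -
  define b where "b = from_nat_into I"
  have b: "bij_betw b UNIV I"
    unfolding b_def by (rule bij_betw_from_nat_into[OF I])
  have bI: "b n \<in> I" for n using b by (auto simp: bij_betw_def)
  have bi: "b n = b m \<longleftrightarrow> n = m" for n m using b by (auto simp: bij_betw_def inj_eq)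
  have im: "range (\<lambda>n. e (b n)) = e ` I"
    using b by (auto simp: bij_betw_def)
  have "\<exists>h\<in>L2_closed_span M (range (\<lambda>n. e (b n))).
      (\<forall>n. L2_inner M h (e (b n)) = L2_inner M f (e (b n))) \<and>
      (\<Sum>n. ennreal ((cmod (L2_inner M f (e (b n))))\<^sup>2)) = ennreal ((L2_norm M h)\<^sup>2)"
    by (rule L2_orthonormal_projection_nat) (simp_all add: e on f bI bi)
  then obtain h where h: "h \<in> L2_closed_span M (range (\<lambda>n. e (b n)))"
      "\<forall>n. L2_inner M h (e (b n)) = L2_inner M f (e (b n))"
      "(\<Sum>n. ennreal ((cmod (L2_inner M f (e (b n))))\<^sup>2)) = ennreal ((L2_norm M h)\<^sup>2)"
    by blast
  show ?thesis
  proof (rule that)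
    show "h \<in> L2_closed_span M (e ` I)" using h(1) im by simp
    show "L2_inner M h (e i) = L2_inner M f (e i)" if "i \<in> I" for i
      using h(2) that b by (metis bij_betw_inv_into_right)
    show "(\<integral>\<^sup>+i. ennreal ((cmod (L2_inner M f (e i)))\<^sup>2) \<partial>count_space I) = ennreal ((L2_norm M h)\<^sup>2)"
      using h(3) by (subst nn_integral_bij_count_space[OF b, symmetric])
        (simp add: nn_integral_count_space_nat)
  qed
qed

lemma L2_closed_span_subset: "L2_closed_span M S \<subseteq> L2 M"
  by (auto simp: L2_closed_span_def)

lemma L2_closed_span_orthogonal:
  assumes h: "h \<in> L2_closed_span M S" and S: "S \<subseteq> L2 M" and g: "g \<in> L2 M"
    and orth: "\<And>b. b \<in> S \<Longrightarrow> L2_inner M b g = 0"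
  shows "L2_inner M h g = 0"
proof -
  have h2: "h \<in> L2 M" using h L2_closed_span_subset by blast
  have le: "cmod (L2_inner M h g) \<le> r * L2_norm M g" if "r > 0" for r
  proof -
    from h that obtain B c where B: "finite B" "B \<subseteq> S" "L2_norm M (\<lambda>x. h x - (\<Sum>b\<in>B. c b * b x)) < r"
      unfolding L2_closed_span_def by blast
    let ?s = "\<lambda>x. \<Sum>b\<in>B. c b * b x"
    have s: "?s \<in> L2 M" using B S by (intro L2_sum_closed L2_scale) auto
    have "L2_inner M ?s g = (\<Sum>b\<in>B. c b * L2_inner M b g)"
      by (rule L2_inner_sum_left) (use B S g in auto)
    also have "\<dots> = 0" using orth B by (intro sum.neutral) auto
    finally have "L2_inner M h g = L2_inner M (\<lambda>x. h x - ?s x) g"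
      using h2 s g by (simp add: L2_inner_diff_left)
    also have "cmod \<dots> \<le> L2_norm M (\<lambda>x. h x - ?s x) * L2_norm M g"
      by (intro L2_Cauchy_Schwarz L2_diff h2 s g)
    also have "\<dots> \<le> r * L2_norm M g"
      using B(3) by (intro mult_right_mono) auto
    finally show ?thesis .
  qed
  have "cmod (L2_inner M h g) \<le> 0"
  proof (rule field_le_epsilon)
    fix d :: real assume "d > 0"
    then have "cmod (L2_inner M h g) \<le> d / (L2_norm M g + 1) * L2_norm M g"
      by (intro le) (simp add: add_nonneg_pos)
    also have "\<dots> \<le> d"
    proof -
      have "0 < L2_norm M g + 1" by (simp add: add_nonneg_pos)
      then show ?thesis
        using \<open>d > 0\<close> by (simp add: divide_le_eq algebra_simps)
    qed
    finally show "cmod (L2_inner M h g) \<le> 0 + d" by simp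
  qed
  then show ?thesis by simp
qed

text \<open>For an orthonormal basis, membership in the closed span of a part of it is detected by the
  vanishing of the other coefficients: dropping them from an approximation brings it nearer.\<close>

lemma L2_closed_span_part_of_basis:
  fixes e :: "'i \<Rightarrow> 'a \<Rightarrow> complex"
  assumes basis: "L2_orthonormal_basis M e"
  shows "L2_closed_span M (e ` J) = {f \<in> L2 M. \<forall>i. i \<notin> J \<longrightarrow> L2_inner M f (e i) = 0}"
proof (intro equalityI subsetI)
  from basis have e: "\<And>i. e i \<in> L2 M"
    and on: "\<And>i j. L2_inner M (e i) (e j) = (if i = j then 1 else 0)"
    and cs: "L2_closed_span M (range e) = L2 M"
    by (auto simp: L2_orthonormal_basis_def)
  fix f
  show "f \<in> {f \<in> L2 M. \<forall>i. i \<notin> J \<longrightarrow> L2_inner M f (e i) = 0}" if "f \<in> L2_closed_span M (e ` J)"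
  proof (intro CollectI conjI allI impI)
    show "f \<in> L2 M" using that L2_closed_span_subset by blast
    show "L2_inner M f (e i) = 0" if i: "i \<notin> J" for i
      by (rule L2_closed_span_orthogonal[OF \<open>f \<in> L2_closed_span M (e ` J)\<close>]) (use e on i in auto)
  qed
  assume "f \<in> {f \<in> L2 M. \<forall>i. i \<notin> J \<longrightarrow> L2_inner M f (e i) = 0}"
  then have f: "f \<in> L2 M" and z: "\<And>i. i \<notin> J \<Longrightarrow> L2_inner M f (e i) = 0" by auto
  have inj: "inj e"
  proof (rule injI, rule ccontr)
    fix i j assume "e i = e j" "i \<noteq> j"
    with on[of i j] on[of i i] show False by simp
  qed
  show "f \<in> L2_closed_span M (e ` J)"
    unfolding L2_closed_span_def
  proof (intro CollectI conjI allI impI f)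
    fix r :: real assume "r > 0"
    moreover have "f \<in> L2_closed_span M (range e)" using f cs by simp
    ultimately obtain B c where B: "finite B" "B \<subseteq> range e" "L2_norm M (\<lambda>x. f x - (\<Sum>b\<in>B. c b * b x)) < r"
      unfolding L2_closed_span_def by blast
    define K where "K = e -` B"
    have K: "finite K" "B = e ` K"
      using B inj by (auto simp: K_def intro: finite_vimageI)
    have BK: "(\<Sum>b\<in>B. c b * b x) = (\<Sum>i\<in>K. c (e i) * e i x)" for x
      unfolding K(2) by (subst sum.reindex) (auto intro: inj_on_subset[OF inj])
    let ?a = "\<lambda>i. L2_inner M f (e i)"
    let ?d = "\<lambda>i. if i \<in> J then c (e i) else 0"
    have "(L2_norm M (\<lambda>x. f x - (\<Sum>i\<in>K. ?d i * e i x)))\<^sup>2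
        \<le> (L2_norm M (\<lambda>x. f x - (\<Sum>i\<in>K. c (e i) * e i x)))\<^sup>2"
    proof -
      have "(\<Sum>i\<in>K. (cmod (?d i - ?a i))\<^sup>2) \<le> (\<Sum>i\<in>K. (cmod (c (e i) - ?a i))\<^sup>2)"
        by (intro sum_mono) (auto simp: z)
      then show ?thesis
        using L2_norm_diff_finite_expansion[of UNIV e M K f ?d]
          L2_norm_diff_finite_expansion[of UNIV e M K f "\<lambda>i. c (e i)"] e on K(1) f
        by simp
    qed
    then have "L2_norm M (\<lambda>x. f x - (\<Sum>i\<in>K. ?d i * e i x))
        \<le> L2_norm M (\<lambda>x. f x - (\<Sum>i\<in>K. c (e i) * e i x))"
      by (rule power2_le_imp_le) simp
    also have "(\<lambda>x. f x - (\<Sum>i\<in>K. ?d i * e i x)) = (\<lambda>x. f x - (\<Sum>b\<in>e ` (K \<inter> J). c b * b x))"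
    proof
      fix x
      have "(\<Sum>i\<in>K. ?d i * e i x) = (\<Sum>i\<in>K \<inter> J. c (e i) * e i x)"
        using K(1) by (simp add: sum.inter_restrict if_distrib[of "\<lambda>u. u * _"] cong: if_cong)
      also have "\<dots> = (\<Sum>b\<in>e ` (K \<inter> J). c b * b x)"
        by (subst sum.reindex) (auto intro: inj_on_subset[OF inj])
      finally show "f x - (\<Sum>i\<in>K. ?d i * e i x) = f x - (\<Sum>b\<in>e ` (K \<inter> J). c b * b x)" by simp
    qed
    finally have "L2_norm M (\<lambda>x. f x - (\<Sum>b\<in>e ` (K \<inter> J). c b * b x)) < r"
      using B(3) by (simp add: BK)
    then show "\<exists>B c. finite B \<and> B \<subseteq> e ` J \<and> L2_norm M (\<lambda>x. f x - (\<Sum>b\<in>B. c b * b x)) < r"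
      using K(1) by (intro exI[of _ "e ` (K \<inter> J)"] exI[of _ c]) auto
  qed
qed

section \<open>Fourier series\<close>
lemma borel_measurable_cis [measurable (raw)]:
  "f \<in> borel_measurable M \<Longrightarrow> (\<lambda>x. cis (f x)) \<in> borel_measurable M"
  by (rule borel_measurable_continuous_on[of cis]) (auto intro: continuous_intros)

lemma borel_measurable_lebesgue_ident [measurable]: "(\<lambda>x. x) \<in> borel_measurable lebesgue"
  by (intro measurable_completion) simp

text \<open>The rays generate the Borel sets, so the positive and the negative part of \<open>f\<close> are densities of
  the same measure.\<close>
lemma AE_zero_if_integral_over_rays_zero_real:
  fixes f :: "real \<Rightarrow> real"
  assumes f: "integrable lebesgue f"
    and zero: "\<And>t. (LINT x|lebesgue. indicator {t<..} x * f x) = 0"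
  shows "AE x in lebesgue. f x = 0"
proof -
  have "f \<in> borel_measurable (completion lborel)" using f by auto
  then obtain g where g[measurable]: "g \<in> borel_measurable lborel" and fg: "AE x in lborel. f x = g x"
    using completion_ex_borel_measurable_real by blast
  have fg': "AE x in lebesgue. f x = g x" using fg by (rule AE_completion)
  have g_int: "integrable lborel g"
  proof -
    have "integrable lebesgue g"
      by (rule integrable_cong_AE_imp[OF f measurable_completion[OF g] fg'])
    then show ?thesis using g by (simp add: integrable_completion)
  qed
  have zero': "(LINT x|lborel. indicator {t<..} x * g x) = 0" for t
  proof -
    have "(LINT x|lborel. indicator {t<..} x * g x) = (LINT x|lebesgue. indicator {t<..} x * g x)"
      by (rule integral_completion[symmetric]) simp
    also have "\<dots> = (LINT x|lebesgue. indicator {t<..} x * f x)"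
    proof (rule integral_cong_AE)
      show "AE x in lebesgue. indicator {t<..} x * g x = indicator {t<..} x * f x"
        using fg' by eventually_elim simp
      have "(\<lambda>x. indicator {t<..} x * g x) \<in> borel_measurable lborel" by simp
      then show "(\<lambda>x. indicator {t<..} x * g x) \<in> borel_measurable lebesgue"
        by (rule measurable_completion)
      have "{t<..} \<in> sets lebesgue" by simp
      then show "(\<lambda>x. indicator {t<..} x * f x) \<in> borel_measurable lebesgue"
        using borel_measurable_integrable[OF f] by (intro borel_measurable_times borel_measurable_indicator)
    qed
    finally show ?thesis using zero by simp
  qed
  let ?P = "density lborel (\<lambda>x. ennreal (g x))" and ?N = "density lborel (\<lambda>x. ennreal (- g x))"
  have em: "emeasure (density lborel (\<lambda>x. ennreal (h x))) {t<..}
      = ennreal (LINT x|lborel. indicator {t<..} x * max 0 (h x))"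
    if h: "integrable lborel h" for h and t :: real
  proof -
    have [measurable]: "h \<in> borel_measurable lborel" using h by auto
    have i: "integrable lborel (\<lambda>x. indicator {t<..} x * max 0 (h x))"
      by (rule Bochner_Integration.integrable_bound[OF h]) (auto intro!: AE_I2 simp: indicator_def)
    have "emeasure (density lborel (\<lambda>x. ennreal (h x))) {t<..}
        = (\<integral>\<^sup>+x. ennreal (indicator {t<..} x * max 0 (h x)) \<partial>lborel)"
      by (subst emeasure_density)
        (auto intro!: nn_integral_cong simp: indicator_def max_def ennreal_neg)
    also have "\<dots> = ennreal (LINT x|lborel. indicator {t<..} x * max 0 (h x))"
      by (rule nn_integral_eq_integral[OF i]) (auto intro!: AE_I2)
    finally show ?thesis .
  qed
  have "?P = ?N"
  proof (rule measure_eqI_lessThan)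
    show "emeasure ?P {t<..} < \<infinity>" for t
      using em[OF g_int] by simp
    show "emeasure ?P {t<..} = emeasure ?N {t<..}" for t
    proof -
      have i: "integrable lborel (\<lambda>x. indicator {t<..} x * max 0 (g x))"
        "integrable lborel (\<lambda>x. indicator {t<..} x * max 0 (- g x))"
        by (rule Bochner_Integration.integrable_bound[OF g_int]; auto intro!: AE_I2 simp: indicator_def)+
      have "(LINT x|lborel. indicator {t<..} x * max 0 (g x)) - (LINT x|lborel. indicator {t<..} x * max 0 (- g x))
          = (LINT x|lborel. indicator {t<..} x * max 0 (g x) - indicator {t<..} x * max 0 (- g x))"
        by (rule Bochner_Integration.integral_diff[OF i, symmetric])
      also have "\<dots> = (LINT x|lborel. indicator {t<..} x * g x)"
        by (intro Bochner_Integration.integral_cong) (auto simp: indicator_def max_def)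
      also have "\<dots> = 0" by (rule zero')
      finally show ?thesis
        using em[OF g_int] em[of "\<lambda>x. - g x"] g_int by simp
    qed
  qed auto
  then have "AE x in lborel. ennreal (g x) = ennreal (- g x)"
    by (intro sigma_finite_measure.density_unique[OF sigma_finite_lborel]) auto
  then have "AE x in lborel. g x = 0"
  proof eventually_elim
    case (elim x)
    show ?case
    proof (cases "0 \<le> g x")
      case True
      then have "ennreal (g x) = 0" using elim by (simp add: ennreal_neg)
      with True show ?thesis by (simp add: ennreal_eq_0_iff)
    next
      case False
      then have "ennreal (- g x) = 0" using elim by (simp add: ennreal_neg)
      with False show ?thesis by (simp add: ennreal_eq_0_iff)
    qed
  qed
  then have "AE x in lebesgue. g x = 0" by (rule AE_completion)
  with fg' show ?thesis by eventually_elim simp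
qed

lemma AE_zero_if_integral_over_rays_zero:
  fixes f :: "real \<Rightarrow> complex"
  assumes f: "integrable lebesgue f"
    and zero: "\<And>t. (LINT x|lebesgue. indicator {t<..} x * f x) = 0"
  shows "AE x in lebesgue. f x = 0"
proof -
  have i: "integrable lebesgue (\<lambda>x. indicator {t<..} x * f x)" for t
    using integrable_mult_indicator[of "{t<..}" lebesgue f] f
    by (simp add: scaleR_conv_of_real of_real_indicator)
  have "AE x in lebesgue. Re (f x) = 0"
  proof (rule AE_zero_if_integral_over_rays_zero_real)
    show "integrable lebesgue (\<lambda>x. Re (f x))" using f by simp
    show "(LINT x|lebesgue. indicator {t<..} x * Re (f x)) = 0" for t
    proof -
      have "(LINT x|lebesgue. indicator {t<..} x * Re (f x)) = (LINT x|lebesgue. Re (indicator {t<..} x * f x))"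
        by (intro Bochner_Integration.integral_cong) (auto simp: indicator_def)
      also have "\<dots> = Re (LINT x|lebesgue. indicator {t<..} x * f x)"
        by (rule integral_Re[OF i])
      finally show ?thesis by (simp add: zero)
    qed
  qed
  moreover have "AE x in lebesgue. Im (f x) = 0"
  proof (rule AE_zero_if_integral_over_rays_zero_real)
    show "integrable lebesgue (\<lambda>x. Im (f x))" using f by simp
    show "(LINT x|lebesgue. indicator {t<..} x * Im (f x)) = 0" for t
    proof -
      have "(LINT x|lebesgue. indicator {t<..} x * Im (f x)) = (LINT x|lebesgue. Im (indicator {t<..} x * f x))"
        by (intro Bochner_Integration.integral_cong) (auto simp: indicator_def)
      also have "\<dots> = Im (LINT x|lebesgue. indicator {t<..} x * f x)"
        by (rule integral_Im[OF i])
      finally show ?thesis by (simp add: zero)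
    qed
  qed
  ultimately show ?thesis by eventually_elim (simp add: complex_eq_iff)
qed

text \<open>Polynomials in \<open>u\<close> that converge on \<open>[0, 1]\<close> boundedly to a step at \<open>1/2\<close>; evaluated at a
  trigonometric polynomial they remain trigonometric polynomials. The limit depends on the size of
  \<open>2\<^sup>n u\<^sup>n\<close>, which is estimated by Bernoulli's inequality on either side of the step.\<close>
definition steep_step :: "nat \<Rightarrow> real \<Rightarrow> real" where
  "steep_step n u = 1 - (1 - u ^ n) ^ (2 ^ n)"

lemma steep_step_bounds: "0 \<le> u \<Longrightarrow> u \<le> 1 \<Longrightarrow> 0 \<le> steep_step n u \<and> steep_step n u \<le> 1"
proof -
  assume u: "0 \<le> u" "u \<le> 1"
  have y: "0 \<le> u ^ n" "u ^ n \<le> 1"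
    using u by (auto intro: power_le_one)
  have "0 \<le> (1 - u ^ n) ^ (2 ^ n)" "(1 - u ^ n) ^ (2 ^ n) \<le> 1"
    by (rule zero_le_power, use y in simp, rule power_le_one, use y in simp_all)
  then show ?thesis by (simp only: steep_step_def) simp
qed

lemma steep_step_below:
  assumes "0 \<le> u" "u < 1/2"
  shows "(\<lambda>n. steep_step n u) \<longlonglongrightarrow> 0"
proof (rule tendsto_sandwich[OF always_eventually always_eventually tendsto_const])
  show "\<forall>n. 0 \<le> steep_step n u" using assms steep_step_bounds by auto
  show "\<forall>n. steep_step n u \<le> (2 * u) ^ n"
  proof
    fix n
    have "u ^ n \<le> 1" using assms by (intro power_le_one) auto
    then have "1 + real (2 ^ n) * (- (u ^ n)) \<le> (1 + - (u ^ n)) ^ (2 ^ n)"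
      by (intro Bernoulli_inequality) auto
    then show "steep_step n u \<le> (2 * u) ^ n"
      by (simp add: steep_step_def power_mult_distrib)
  qed
  show "(\<lambda>n. (2 * u) ^ n) \<longlonglongrightarrow> 0" using assms by (intro LIMSEQ_power_zero) auto
qed

lemma steep_step_above:
  assumes "1/2 < u" "u \<le> 1"
  shows "(\<lambda>n. steep_step n u) \<longlonglongrightarrow> 1"
proof -
  have "(\<lambda>n. (1 - u ^ n) ^ (2 ^ n)) \<longlonglongrightarrow> 0"
  proof (rule tendsto_sandwich[OF always_eventually always_eventually tendsto_const])
    have u1: "u ^ n \<le> 1" for n using assms by (intro power_le_one) auto
    show "\<forall>n. 0 \<le> (1 - u ^ n) ^ (2 ^ n)" using u1 by auto
    show "\<forall>n. (1 - u ^ n) ^ (2 ^ n) \<le> (1 / (2 * u)) ^ n"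
    proof
      fix n
      define y m where "y = u ^ n" and "m = (2 ^ n :: nat)"
      have y: "0 < y" "y \<le> 1" using assms u1 by (auto simp: y_def)
      have "1 + real m * y \<le> (1 + y) ^ m"
        using y by (intro Bernoulli_inequality) auto
      moreover have "(2 * u) ^ n = real m * y"
        by (simp add: power_mult_distrib y_def m_def)
      ultimately have "(2 * u) ^ n \<le> (1 + y) ^ m" by linarith
      then have "(1 - y) ^ m * (2 * u) ^ n \<le> (1 - y) ^ m * (1 + y) ^ m"
        using y by (intro mult_left_mono) auto
      also have "\<dots> = ((1 - y) * (1 + y)) ^ m"
        by (rule power_mult_distrib[symmetric])
      also have "\<dots> \<le> 1"
      proof (rule power_le_one)
        have "(1 - y) * (1 + y) = 1 - y * y" by (simp add: algebra_simps)
        moreover have "0 \<le> y * y" using y by simp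
        moreover have "0 \<le> (1 - y) * (1 + y)" using y by (intro mult_nonneg_nonneg) auto
        ultimately show "(1 - y) * (1 + y) \<le> 1" "0 \<le> (1 - y) * (1 + y)" by linarith+
      qed
      finally have "(1 - y) ^ m * (2 * u) ^ n \<le> 1" .
      moreover have "0 < (2 * u) ^ n" using assms by simp
      ultimately have "(1 - y) ^ m \<le> 1 / (2 * u) ^ n" by (simp only: pos_le_divide_eq)
      then show "(1 - u ^ n) ^ (2 ^ n) \<le> (1 / (2 * u)) ^ n"
        by (simp only: power_one_over y_def m_def)
    qed
    show "(\<lambda>n. (1 / (2 * u)) ^ n) \<longlonglongrightarrow> 0" using assms by (intro LIMSEQ_power_zero) auto
  qed
  from tendsto_diff[OF tendsto_const[of 1] this] show ?thesis
    by (simp add: steep_step_def)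
qed

lemma cos_greater_iff_arc:
  assumes r: "0 < r" "r < pi" and x: "\<bar>x\<bar> < 2 * pi - r"
  shows "\<bar>x\<bar> < r \<Longrightarrow> cos x > cos r" and "\<bar>x\<bar> > r \<Longrightarrow> cos x < cos r"
proof -
  show "cos x > cos r" if "\<bar>x\<bar> < r"
    using cos_monotone_0_pi[of "\<bar>x\<bar>" r] that r by simp
  show "cos x < cos r" if "\<bar>x\<bar> > r"
  proof (cases "\<bar>x\<bar> \<le> pi")
    case True
    then show ?thesis using cos_monotone_0_pi[of r "\<bar>x\<bar>"] that r by simp
  next
    case False
    then have "cos (2 * pi - \<bar>x\<bar>) < cos r"
      using cos_monotone_0_pi[of r "2 * pi - \<bar>x\<bar>"] that r x by simp
    then show ?thesis by (simp add: cos_diff)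
  qed
qed

text \<open>Multiplying \<open>g\<close> by a trigonometric polynomial preserves the vanishing of all coefficients. For a
  suitable affine function \<open>u\<close> of \<open>cos (w (x - c))\<close>, which exceeds \<open>1/2\<close> exactly on a given arc, the
  functions \<open>steep_step n \<circ> u\<close> tend to the indicator of the arc. So the integral of \<open>g\<close> over each
  arc is \<open>0\<close>.\<close>
lemma Fourier_coefficients_unique:
  fixes g :: "real \<Rightarrow> complex" and w a :: real
  assumes w: "w > 0" and g: "integrable lebesgue g"
    and supp: "\<And>x. x \<notin> {a..<a + 2 * pi / w} \<Longrightarrow> g x = 0"
    and coef: "\<And>k::int. (LINT x|lebesgue. g x * cis (of_int k * w * x)) = 0"
  shows "AE x in lebesgue. g x = 0"
proof (rule AE_zero_if_integral_over_rays_zero[OF g])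
  let ?L = "2 * pi / w"
  \<comment> \<open>The bounded test functions \<open>h\<close> such that all Fourier coefficients of \<open>g h\<close> vanish.\<close>
  define Z where "Z h \<longleftrightarrow> h \<in> borel_measurable borel \<and> (\<exists>C. \<forall>x. cmod (h x) \<le> C) \<and>
    (\<forall>k::int. (LINT x|lebesgue. g x * h x * cis (of_int k * w * x)) = 0)" for h :: "real \<Rightarrow> complex"
  have Zint: "integrable lebesgue (\<lambda>x. g x * h x * cis (of_int k * w * x))" if "Z h" for h and k :: int
  proof -
    from that obtain C where C: "\<And>x. cmod (h x) \<le> C" and h: "h \<in> borel_measurable borel"
      by (auto simp: Z_def)
    have h': "h \<in> borel_measurable lebesgue" using h by (auto intro: measurable_completion)
    have c': "(\<lambda>x. cis (of_int k * w * x)) \<in> borel_measurable lebesgue"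
      by (intro measurable_completion) (auto intro!: borel_measurable_continuous_onI continuous_intros)
    show ?thesis
    proof (rule Bochner_Integration.integrable_bound)
      show "integrable lebesgue (\<lambda>x. C *\<^sub>R g x)" using g by simp
      show "(\<lambda>x. g x * h x * cis (of_int k * w * x)) \<in> borel_measurable lebesgue"
        using borel_measurable_integrable[OF g] h' c' by simp
      show "AE x in lebesgue. norm (g x * h x * cis (of_int k * w * x)) \<le> norm (C *\<^sub>R g x)"
      proof (intro AE_I2)
        fix x
        have "cmod (g x) * cmod (h x) \<le> cmod (g x) * \<bar>C\<bar>"
          using C[of x] by (intro mult_left_mono) auto
        then show "norm (g x * h x * cis (of_int k * w * x)) \<le> norm (C *\<^sub>R g x)"
          by (simp add: norm_mult mult.commute)
      qed
    qed
  qed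
  have Z1: "Z (\<lambda>x. 1)" using coef by (auto simp: Z_def)
  have Zscale: "Z (\<lambda>x. c * h x)" if "Z h" for c h
  proof -
    from that obtain C where C: "\<forall>x. cmod (h x) \<le> C" and [measurable]: "h \<in> borel_measurable borel"
      by (auto simp: Z_def)
    have "\<forall>x. cmod (c * h x) \<le> cmod c * C" using C by (auto simp: norm_mult intro!: mult_left_mono)
    moreover have "(LINT x|lebesgue. g x * (c * h x) * cis (of_int k * w * x)) = 0" for k :: int
    proof -
      have "(LINT x|lebesgue. g x * (c * h x) * cis (of_int k * w * x))
        = (LINT x|lebesgue. c * (g x * h x * cis (of_int k * w * x)))"
        by (simp add: mult_ac)
      also have "\<dots> = 0" using that by (simp add: Z_def)
      finally show ?thesis .
    qed
    ultimately show ?thesis unfolding Z_def by auto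
  qed
  have Zadd: "Z (\<lambda>x. h x + h' x)" if "Z h" "Z h'" for h h'
  proof -
    from that obtain C C' where C: "\<forall>x. cmod (h x) \<le> C" "\<forall>x. cmod (h' x) \<le> C'"
      and [measurable]: "h \<in> borel_measurable borel" "h' \<in> borel_measurable borel"
      by (auto simp: Z_def)
    have "\<forall>x. cmod (h x + h' x) \<le> C + C'" using C by (auto intro: norm_triangle_le add_mono)
    moreover have "(LINT x|lebesgue. g x * (h x + h' x) * cis (of_int k * w * x)) = 0" for k :: int
    proof -
      have "(LINT x|lebesgue. g x * (h x + h' x) * cis (of_int k * w * x))
        = (LINT x|lebesgue. g x * h x * cis (of_int k * w * x) + g x * h' x * cis (of_int k * w * x))"
        by (simp add: algebra_simps)
      also have "\<dots> = 0" using that Zint[OF that(1)] Zint[OF that(2)] by (simp add: Z_def)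
      finally show ?thesis .
    qed
    ultimately show ?thesis unfolding Z_def by auto
  qed
  have Zcis: "Z (\<lambda>x. h x * cis (of_int k * w * x))" if "Z h" for h and k :: int
  proof -
    from that obtain C where C: "\<forall>x. cmod (h x) \<le> C" and [measurable]: "h \<in> borel_measurable borel"
      by (auto simp: Z_def)
    have "(\<lambda>x. cis (of_int k * w * x)) \<in> borel_measurable borel"
      by (auto intro!: borel_measurable_continuous_onI continuous_intros)
    moreover have "(LINT x|lebesgue. g x * (h x * cis (of_int k * w * x)) * cis (of_int l * w * x)) = 0" for l :: int
    proof -
      have "g x * (h x * cis (of_int k * w * x)) * cis (of_int l * w * x)
          = g x * h x * cis (of_int (k + l) * w * x)" for x
        by (simp add: cis_mult mult.assoc ring_distribs)
      then show ?thesis using that by (simp only: Z_def)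
    qed
    ultimately show ?thesis unfolding Z_def using C by (auto simp: norm_mult)
  qed
  have sub: "(LINT x|lebesgue. indicator {t<..<a + ?L} x * g x) = 0" if t: "a < t" "t < a + ?L" for t
  proof -
    \<comment> \<open>The midpoint and the angular radius of the arc from \<open>t\<close> to the end of the period.\<close>
    define c r where "c = (t + (a + ?L)) / 2" and "r = w * ((a + ?L) - t) / 2"
    have wL: "w * ?L = 2 * pi" using w by simp
    have wc: "2 * (w * c) = w * t + w * a + 2 * pi" and wr: "2 * r = w * a + 2 * pi - w * t"
      using w by (auto simp: c_def r_def field_simps)
    have wt: "w * a < w * t" "w * t < w * a + 2 * pi"
      using t w mult_strict_left_mono[OF t(2) w] wL unfolding ring_distribs by auto
    then have r: "0 < r" "r < pi"
      using wr by auto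
    define u where "u x = 1/2 + (cos (w * (x - c)) - cos r) / 4" for x
    have u01: "0 \<le> u x \<and> u x \<le> 1" for x
    proof -
      have "-2 \<le> cos (w * (x - c)) - cos r" "cos (w * (x - c)) - cos r \<le> 2"
        using cos_ge_minus_one[of "w * (x - c)"] cos_le_one[of "w * (x - c)"]
          cos_ge_minus_one[of r] cos_le_one[of r] by linarith+
      moreover have "u x = (2 + (cos (w * (x - c)) - cos r)) / 4"
        by (simp add: u_def add_divide_distrib)
      ultimately show ?thesis by simp
    qed
    have u_cont: "continuous_on UNIV u"
      unfolding u_def[abs_def] by (intro continuous_intros) auto
    have Zu: "Z (\<lambda>x. h x * of_real (u x))" if h: "Z h" for h
    proof -
      have "h x * of_real (u x) = of_real (1/2 - cos r / 4) * h x
          + (cis (- (w * c)) / 8 * (h x * cis (of_int 1 * w * x)) + cis (w * c) / 8 * (h x * cis (of_int (-1) * w * x)))" for x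
      proof -
        have "cis (w * (x - c)) = cis (- (w * c)) * cis (of_int 1 * w * x)"
          "cis (- (w * (x - c))) = cis (w * c) * cis (of_int (-1) * w * x)"
          by (simp_all add: cis_mult algebra_simps)
        moreover have "complex_of_real (cos (w * (x - c))) = (cis (w * (x - c)) + cis (- (w * (x - c)))) / 2"
          by (simp add: complex_eq_iff)
        ultimately have "complex_of_real (cos (w * (x - c)))
            = (cis (- (w * c)) * cis (of_int 1 * w * x) + cis (w * c) * cis (of_int (-1) * w * x)) / 2"
          by (simp only:)
        then have "complex_of_real (u x) = of_real (1/2 - cos r / 4)
            + (cis (- (w * c)) * cis (of_int 1 * w * x) + cis (w * c) * cis (of_int (-1) * w * x)) / 8"
          unfolding u_def by (simp add: diff_divide_distrib mult.commute)
        then show ?thesis by (simp only:) (simp add: ring_distribs add_divide_distrib mult_ac)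
      qed
      then show ?thesis
        by (simp only:) (intro Zadd Zscale Zcis h)
    qed
    have Zpow: "Z (\<lambda>x. h x * of_real (u x ^ n))" if h: "Z h" for h n
    proof (induction n)
      case 0
      then show ?case using h by simp
    next
      case (Suc n)
      then show ?case using Zu[OF Suc] by (simp add: mult_ac)
    qed
    have Zdiff: "Z (\<lambda>x. h x * of_real (1 - u x ^ n))" if h: "Z h" for h n
      using Zadd[OF h Zscale[OF Zpow[OF h, of n], of "-1"]] by (simp add: algebra_simps)
    have Zpow2: "Z (\<lambda>x. of_real ((1 - u x ^ n) ^ m))" for n m
    proof (induction m)
      case 0
      then show ?case using Z1 by simp
    next
      case (Suc m)
      then show ?case using Zdiff[OF Suc, of n] by (simp add: mult_ac)
    qed
    have Zstep: "Z (\<lambda>x. of_real (steep_step n (u x)))" for n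
      using Zadd[OF Z1 Zscale[OF Zpow2[of n "2 ^ n"], of "-1"]] by (simp add: steep_step_def)
    have z: "(LINT x|lebesgue. g x * of_real (steep_step n (u x))) = 0" for n
      using Zstep[of n] unfolding Z_def by (auto dest!: spec[of _ 0])
    have "(\<lambda>n. LINT x|lebesgue. g x * of_real (steep_step n (u x)))
        \<longlonglongrightarrow> (LINT x|lebesgue. indicator {t<..<a + ?L} x * g x)"
    proof (rule integral_dominated_convergence[where w="\<lambda>x. cmod (g x)"])
      have [measurable]: "g \<in> borel_measurable lebesgue" using g by auto
      have "{t<..<a + ?L} \<in> sets lebesgue" by simp
      then show "(\<lambda>x. indicator {t<..<a + ?L} x * g x) \<in> borel_measurable lebesgue"
        by (intro borel_measurable_times borel_measurable_indicator) auto
      have [measurable]: "u \<in> borel_measurable lebesgue"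
        using u_cont by (intro measurable_completion) (auto intro: borel_measurable_continuous_onI)
      show "(\<lambda>x. g x * of_real (steep_step n (u x))) \<in> borel_measurable lebesgue" for n
        unfolding steep_step_def by measurable
      show "integrable lebesgue (\<lambda>x. cmod (g x))" using g by simp
      show "AE x in lebesgue. cmod (g x * of_real (steep_step n (u x))) \<le> cmod (g x)" for n
      proof (intro AE_I2)
        fix x
        show "cmod (g x * of_real (steep_step n (u x))) \<le> cmod (g x)"
          using u01[of x] steep_step_bounds[of "u x" n] by (simp add: norm_mult mult_left_le)
      qed
      have "AE x in lebesgue. x \<notin> {a, t}"
        by (rule AE_not_in) (simp add: negligible_iff_null_sets[symmetric])
      then show "AE x in lebesgue. (\<lambda>n. g x * of_real (steep_step n (u x))) \<longlonglongrightarrow> indicator {t<..<a + ?L} x * g x"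
      proof eventually_elim
        case (elim x)
        show ?case
        proof (cases "x \<in> {a..<a + ?L}")
          case False
          then show ?thesis using supp[of x] by simp
        next
          case True
          have wx: "w * (x - c) = w * x - w * c" by (rule right_diff_distrib)
          from True elim have "a < x" "x < a + ?L" by auto
          then have "w * a < w * x" "w * x < w * (a + ?L)"
            using w by (simp_all only: mult_less_cancel_left_pos)
          then have ord: "w * a < w * x" "w * x < w * a + 2 * pi"
            unfolding distrib_left wL by auto
          have b: "\<bar>w * (x - c)\<bar> < 2 * pi - r"
            unfolding wx abs_less_iff using ord wt wc wr by (intro conjI; linarith)
          show ?thesis
          proof (cases "x > t")
            case T: True
            have "w * x > w * t" using T w by simp
            then have "\<bar>w * (x - c)\<bar> < r"
              unfolding wx abs_less_iff using ord wt wc wr by (intro conjI; linarith)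
            from cos_greater_iff_arc(1)[OF r b this] have "u x > 1/2" by (simp add: u_def)
            then have "(\<lambda>n. steep_step n (u x)) \<longlonglongrightarrow> 1"
              using u01 by (intro steep_step_above) auto
            then have "(\<lambda>n. g x * of_real (steep_step n (u x))) \<longlonglongrightarrow> g x * of_real 1"
              by (intro tendsto_intros)
            then show ?thesis using T True by simp
          next
            case F: False
            then have "x < t" using elim by auto
            then have "w * x < w * t" using w by simp
            then have "\<bar>w * (x - c)\<bar> > r"
              unfolding wx using ord wt wc wr by linarith
            from cos_greater_iff_arc(2)[OF r b this] have "u x < 1/2" by (simp add: u_def)
            then have "(\<lambda>n. steep_step n (u x)) \<longlonglongrightarrow> 0"
              using u01 by (intro steep_step_below) auto
            then have "(\<lambda>n. g x * of_real (steep_step n (u x))) \<longlonglongrightarrow> g x * of_real 0"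
              by (intro tendsto_intros)
            then show ?thesis using F by simp
          qed
        qed
      qed
    qed
    then show ?thesis using z by (simp add: LIMSEQ_const_iff)
  qed
  fix t :: real
  \<comment> \<open>Within the period, the ray beyond \<open>t\<close> is everything, an arc, or empty.\<close>
  consider "t \<le> a" | "a < t" "t < a + ?L" | "a + ?L \<le> t" by linarith
  then show "(LINT x|lebesgue. indicator {t<..} x * g x) = 0"
  proof cases
    case 1
    have "AE x in lebesgue. x \<notin> {a}"
      by (rule AE_not_in) (simp add: negligible_iff_null_sets[symmetric])
    then have "AE x in lebesgue. indicator {t<..} x * g x = g x * cis (of_int 0 * w * x)"
    proof eventually_elim
      case (elim x)
      then show ?case using 1 supp[of x] by (cases "x \<in> {a..<a + ?L}") auto
    qed
    then have "(LINT x|lebesgue. indicator {t<..} x * g x) = (LINT x|lebesgue. g x * cis (of_int 0 * w * x))"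
      using borel_measurable_integrable[OF g]
      by (intro integral_cong_AE) (auto intro!: borel_measurable_times borel_measurable_indicator)
    then show ?thesis by (simp only: coef)
  next
    case 2
    have "indicator {t<..} x * g x = indicator {t<..<a + ?L} x * g x" for x
      using supp[of x] by (cases "x < a + ?L") (auto simp: indicator_def)
    then show ?thesis using sub[OF 2] by (simp only:)
  next
    case 3
    have "indicator {t<..} x * g x = 0" for x
      using supp[of x] 3 by (auto simp: indicator_def)
    then show ?thesis by (simp only: Bochner_Integration.integral_zero)
  qed
qed

lemma L2_finite_support_integrable:
  assumes f: "f \<in> L2 M" and S: "S \<in> sets M" "emeasure M S < \<infinity>"
    and supp: "\<And>x. x \<in> space M \<Longrightarrow> x \<notin> S \<Longrightarrow> f x = 0"
  shows "integrable M f"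
proof (rule Bochner_Integration.integrable_bound)
  show "integrable M (\<lambda>x. indicator S x + (cmod (f x))\<^sup>2)"
    using S L2_integrable_square[OF f] by simp
  show "f \<in> borel_measurable M" by (rule L2_measurable[OF f])
  show "AE x in M. norm (f x) \<le> norm (indicator S x + (cmod (f x))\<^sup>2)"
  proof (intro AE_I2)
    fix x assume x: "x \<in> space M"
    show "norm (f x) \<le> norm (indicator S x + (cmod (f x))\<^sup>2)"
    proof (cases "x \<in> S")
      case True
      have "2 * cmod (f x) * 1 \<le> (cmod (f x))\<^sup>2 + 1\<^sup>2" by (rule sum_squares_bound)
      moreover have "0 \<le> cmod (f x)" by simp
      ultimately have "cmod (f x) \<le> 1 + (cmod (f x))\<^sup>2"
        by (simp only: one_power2 mult_1_right)
      then show ?thesis using True by (simp add: abs_of_nonneg)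
    next
      case False
      then show ?thesis using supp[OF x] by simp
    qed
  qed
qed

lemma integral_cis_period:
  fixes w a :: real and j :: int
  assumes w: "w > 0"
  shows "(LINT x|lebesgue. indicator {a..<a + 2 * pi / w} x * cis (of_int j * w * x))
    = (if j = 0 then of_real (2 * pi / w) else 0)"
proof -
  let ?b = "a + 2 * pi / w"
  let ?c = "\<lambda>x. cis (of_int j * w * x)"
  have "AE x in lebesgue. x \<notin> {?b}"
    by (rule AE_not_in) (simp add: negligible_iff_null_sets[symmetric])
  then have ae: "AE x in lebesgue. indicator {a..<?b} x * ?c x = indicator {a..?b} x *\<^sub>R ?c x"
    by eventually_elim (auto simp: indicator_def)
  have cm: "?c \<in> borel_measurable borel"
    by (intro borel_measurable_continuous_onI continuous_intros)
  have "(LINT x|lebesgue. indicator {a..<?b} x * ?c x) = (LINT x|lebesgue. indicator {a..?b} x *\<^sub>R ?c x)"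
    by (rule integral_cong_AE[OF _ _ ae])
      (use cm in \<open>auto intro!: measurable_completion borel_measurable_times borel_measurable_scaleR borel_measurable_indicator\<close>)
  also have "\<dots> = (LINT x|lborel. indicator {a..?b} x *\<^sub>R ?c x)"
    by (rule integral_completion)
      (use cm in \<open>auto intro!: borel_measurable_scaleR borel_measurable_indicator\<close>)
  also have "\<dots> = (if j = 0 then of_real (2 * pi / w) else 0)"
  proof (cases "j = 0")
    case True
    have "(LINT x|lborel. indicator {a..?b} x *\<^sub>R ?c x) = (LINT x|lborel. indicator {a..?b} x *\<^sub>R (1 :: complex))"
      using True by simp
    also have "\<dots> = of_real (2 * pi / w)"
      using w by (simp add: scaleR_conv_of_real)
    finally show ?thesis using True by simp
  next
    case False
    have jw: "\<i> * of_real (of_int j * w) \<noteq> 0" using False w by simp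
    have "(LINT x|lborel. indicator {a..?b} x *\<^sub>R ?c x)
        = ?c ?b / (\<i> * of_real (of_int j * w)) - ?c a / (\<i> * of_real (of_int j * w))"
    proof (rule integral_FTC_atLeastAtMost)
      show "a \<le> ?b" using w by simp
      show "continuous_on {a..?b} ?c" by (intro continuous_intros)
      fix x assume "a \<le> x" "x \<le> ?b"
      have "((\<lambda>z. exp (\<i> * of_real (of_int j * w) * z) / (\<i> * of_real (of_int j * w))) has_field_derivative
          exp (\<i> * of_real (of_int j * w) * of_real x)) (at (of_real x))"
        using jw by (auto intro!: derivative_eq_intros)
      then have "((\<lambda>x. exp (\<i> * of_real (of_int j * w) * of_real x) / (\<i> * of_real (of_int j * w))) has_vector_derivative
          exp (\<i> * of_real (of_int j * w) * of_real x)) (at x within {a..?b})"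
        by (rule has_vector_derivative_real_field)
      then show "((\<lambda>x. ?c x / (\<i> * of_real (of_int j * w))) has_vector_derivative ?c x) (at x within {a..?b})"
        by (simp add: cis_conv_exp mult.assoc)
    qed
    also have "?c ?b = ?c a"
    proof -
      have "of_int j * w * ?b = of_int j * w * a + 2 * pi * of_int j"
        using w by (simp add: field_simps)
      then have "?c ?b = ?c a * cis (2 * pi * of_int j)" by (simp only: cis_mult)
      then show ?thesis by simp
    qed
    finally show ?thesis using False by simp
  qed
  finally show ?thesis .
qed

text \<open>The projection \<open>h\<close> of \<open>g\<close> to the span of the exponentials has the same Fourier coefficients as \<open>g\<close>,
  so the two agree on the interval by uniqueness. The exponentials are cut off to the interval in
  order to stay inside \<open>L\<^sup>2\<close> of the line.\<close>
lemma Parseval: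
  fixes g :: "real \<Rightarrow> complex" and w a :: real
  assumes w: "w > 0" and g: "g \<in> L2 lebesgue"
    and supp: "\<And>x. x \<notin> {a..<a + 2 * pi / w} \<Longrightarrow> g x = 0"
  shows "coeff_energy (\<lambda>k. LINT x|lebesgue. g x * cis (- (of_int k * w * x)))
    = ennreal (2 * pi / w) * (\<integral>\<^sup>+x. ennreal ((cmod (g x))\<^sup>2) \<partial>lebesgue)"
proof -
  let ?S = "{a..<a + 2 * pi / w}"
  define s where "s = sqrt (w / (2 * pi))"
  have s2: "s * s = w / (2 * pi)" and s0: "s > 0" using w by (auto simp: s_def)
  define e where "e k x = of_real s * (indicator ?S x * cis (of_int k * w * x))" for k :: int and x
  have Sm: "?S \<in> sets lebesgue" "emeasure lebesgue ?S < \<infinity>" using w by auto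
  have em: "e k \<in> borel_measurable lebesgue" for k
    unfolding e_def[abs_def]
    using Sm by (intro borel_measurable_times borel_measurable_const borel_measurable_indicator
        borel_measurable_cis borel_measurable_lebesgue_ident)
  have e: "e k \<in> L2 lebesgue" for k
    unfolding L2_def
  proof (intro CollectI conjI em)
    have "(cmod (e k x))\<^sup>2 = s * s * indicator ?S x" for x
      by (simp add: e_def norm_mult power_mult_distrib power2_eq_square indicator_def)
    then show "integrable lebesgue (\<lambda>x. (cmod (e k x))\<^sup>2)"
      using Sm by simp
  qed
  have in_e: "inner2 f (e k) = of_real s * (LINT x|lebesgue. indicator ?S x * f x * cis (- (of_int k * w * x)))" for f k
  proof -
    have "f x * cnj (e k x) = of_real s * (indicator ?S x * f x * cis (- (of_int k * w * x)))" for x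
      by (simp add: e_def cis_cnj indicator_def)
    then show ?thesis
      unfolding L2_inner_def by (simp only: Bochner_Integration.integral_mult_right_zero)
  qed
  have on: "inner2 (e k) (e l) = (if k = l then 1 else 0)" for k l
  proof -
    have "indicator ?S x * e k x * cis (- (of_int l * w * x))
        = of_real s * (indicator ?S x * cis (of_int (k - l) * w * x))" for x
    proof -
      have "of_int (k - l) * w * x = of_int k * w * x + - (of_int l * w * x)" by (simp add: algebra_simps)
      then have "cis (of_int (k - l) * w * x) = cis (of_int k * w * x) * cis (- (of_int l * w * x))"
        by (simp only: cis_mult)
      then show ?thesis by (simp add: e_def indicator_def)
    qed
    then have "inner2 (e k) (e l) = of_real s * (LINT x|lebesgue. of_real s * (indicator ?S x * cis (of_int (k - l) * w * x)))"
      unfolding in_e by (simp only:)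
    also have "\<dots> = of_real (s * s) * (if k - l = 0 then of_real (2 * pi / w) else 0)"
      unfolding Bochner_Integration.integral_mult_right_zero integral_cis_period[OF w] of_real_mult
      by (rule mult.assoc[symmetric])
    also have "\<dots> = (if k = l then 1 else 0)"
      using w by (simp add: s2)
    finally show ?thesis .
  qed
  obtain h where h: "h \<in> L2_closed_span lebesgue (e ` UNIV)"
    "\<And>k. inner2 h (e k) = inner2 g (e k)"
    "(\<integral>\<^sup>+k. ennreal ((cmod (inner2 g (e k)))\<^sup>2) \<partial>count_space UNIV) = ennreal ((norm2 h)\<^sup>2)"
    using L2_orthonormal_projection[of UNIV e lebesgue g] e on g by (auto simp: infinite_UNIV_int)
  have h2: "h \<in> L2 lebesgue" using h(1) L2_closed_span_subset by blast
  define d where "d x = indicator ?S x * (g x - h x)" for x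
  have d_meas: "d \<in> borel_measurable lebesgue"
    unfolding d_def[abs_def] using L2_measurable[OF g] L2_measurable[OF h2] Sm
    by (intro borel_measurable_times borel_measurable_indicator borel_measurable_diff)
  have d2: "d \<in> L2 lebesgue"
    by (rule L2_dominated[OF d_meas L2_diff[OF g h2]]) (auto simp: d_def indicator_def)
  have "AE x in lebesgue. d x = 0"
  proof (rule Fourier_coefficients_unique[OF w])
    show "integrable lebesgue d"
      by (rule L2_finite_support_integrable[OF d2 Sm]) (simp add: d_def)
    show "d x = 0" if "x \<notin> ?S" for x using that by (simp add: d_def)
    fix k :: int
    have "inner2 (\<lambda>x. g x - h x) (e (- k)) = 0"
      using g h2 e h(2) by (simp add: L2_inner_diff_left)
    then have "(LINT x|lebesgue. indicator ?S x * (g x - h x) * cis (- (of_int (- k) * w * x))) = 0"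
      unfolding in_e using s0 by simp
    then show "(LINT x|lebesgue. d x * cis (of_int k * w * x)) = 0"
      by (simp add: d_def)
  qed
  then have gh: "AE x in lebesgue. g x = indicator ?S x * h x"
  proof eventually_elim
    case (elim x)
    then show ?case using supp[of x] by (cases "x \<in> ?S") (auto simp: d_def)
  qed
  \<comment> \<open>\<open>g - h\<close> is orthogonal to the span that contains \<open>h\<close>, and \<open>g\<close> agrees with \<open>h\<close> on the support of \<open>g\<close>.\<close>
  have "inner2 h (\<lambda>x. g x - h x) = 0"
  proof (rule L2_closed_span_orthogonal[OF h(1) _ L2_diff[OF g h2]])
    show "e ` UNIV \<subseteq> L2 lebesgue" using e by auto
    fix b assume "b \<in> e ` UNIV"
    then obtain k where b: "b = e k" by auto
    have "inner2 (\<lambda>x. g x - h x) (e k) = 0"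
      using g h2 e h(2) by (simp add: L2_inner_diff_left)
    then show "inner2 b (\<lambda>x. g x - h x) = 0"
      unfolding b by (subst L2_inner_cnj) simp
  qed
  then have "inner2 h h = inner2 h g"
    using g h2 by (simp add: L2_inner_diff_right)
  also have "\<dots> = inner2 g g"
    unfolding L2_inner_def
  proof (rule integral_cong_AE)
    show "(\<lambda>x. h x * cnj (g x)) \<in> borel_measurable lebesgue" "(\<lambda>x. g x * cnj (g x)) \<in> borel_measurable lebesgue"
      using L2_measurable[OF g] L2_measurable[OF h2]
      by (auto intro!: borel_measurable_times borel_measurable_cnj)
    show "AE x in lebesgue. h x * cnj (g x) = g x * cnj (g x)"
      using gh
    proof eventually_elim
      case (elim x)
      then show ?case by (cases "x \<in> ?S") auto
    qed
  qed
  finally have hg: "(norm2 h)\<^sup>2 = (norm2 g)\<^sup>2"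
    unfolding L2_inner_self[OF h2] L2_inner_self[OF g] of_real_eq_iff .
  have ge: "inner2 g (e k) = of_real s * (LINT x|lebesgue. g x * cis (- (of_int k * w * x)))" for k
  proof -
    have "indicator ?S x * g x = g x" for x using supp[of x] by (cases "x \<in> ?S") auto
    then show ?thesis unfolding in_e by (simp only:)
  qed
  let ?c = "\<lambda>k::int. LINT x|lebesgue. g x * cis (- (of_int k * w * x))"
  have c: "ennreal ((cmod (?c k))\<^sup>2) = ennreal (2 * pi / w) * ennreal ((cmod (inner2 g (e k)))\<^sup>2)" for k
  proof -
    have "(cmod (inner2 g (e k)))\<^sup>2 = (s * s) * (cmod (?c k))\<^sup>2"
      unfolding ge using s0 by (simp add: norm_mult power_mult_distrib power2_eq_square)
    then have "(cmod (?c k))\<^sup>2 = (2 * pi / w) * (cmod (inner2 g (e k)))\<^sup>2"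
      using w by (simp add: s2)
    moreover have "0 \<le> 2 * pi / w" using w by simp
    ultimately show ?thesis by (simp only: ennreal_mult zero_le_power2)
  qed
  show ?thesis
    unfolding c nn_integral_L2_norm[OF g] hg[symmetric] h(3)[symmetric]
    by (rule nn_integral_cmult) simp
qed

section \<open>Plancherel's theorem\<close>
lemma measurable_lebesgue_affine:
  "c \<noteq> 0 \<Longrightarrow> (\<lambda>x::real. t + c * x) \<in> lebesgue \<rightarrow>\<^sub>M lebesgue"
  using lebesgue_affine_measurable[where c="\<lambda>x::real. c" and t=t] by simp

lemma L2_lebesgue_affine:
  fixes f :: "real \<Rightarrow> complex"
  assumes f: "f \<in> L2 lebesgue" and c: "c \<noteq> 0"
  shows "(\<lambda>x. f (t + c * x)) \<in> L2 lebesgue"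
    and "norm2 (\<lambda>x. f (t + c * x)) = norm2 f / sqrt \<bar>c\<bar>"
proof -
  have "integrable lebesgue (\<lambda>x. (cmod (f (t + c * x)))\<^sup>2)"
    by (rule lebesgue_integrable_real_affine[OF L2_integrable_square[OF f] c])
  moreover have "(\<lambda>x. f (t + c * x)) \<in> borel_measurable lebesgue"
    by (rule measurable_compose[OF measurable_lebesgue_affine[OF c] L2_measurable[OF f]])
  ultimately show "(\<lambda>x. f (t + c * x)) \<in> L2 lebesgue" by (simp add: L2_def)
  have "(LINT x|lebesgue. (cmod (f x))\<^sup>2) = \<bar>c\<bar> * (LINT x|lebesgue. (cmod (f (t + c * x)))\<^sup>2)"
    using lebesgue_integral_real_affine[OF c, of "\<lambda>x. (cmod (f x))\<^sup>2" t] by simp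
  then show "norm2 (\<lambda>x. f (t + c * x)) = norm2 f / sqrt \<bar>c\<bar>"
    using c by (simp add: L2_norm_def real_sqrt_mult)
qed

lemma sigma_finite_lebesgue: "sigma_finite_measure (lebesgue :: real measure)"
proof
  let ?A = "range (\<lambda>n::nat. {- real n..real n})"
  have "\<Union>?A = space lebesgue"
  proof (intro equalityI subsetI)
    fix x :: real
    obtain n :: nat where "\<bar>x\<bar> \<le> real n" using real_arch_simple by blast
    then have "x \<in> {- real n..real n}" by auto
    then show "x \<in> \<Union>?A" by blast
  qed simp
  then show "\<exists>A. countable A \<and> A \<subseteq> sets (lebesgue :: real measure) \<and> \<Union>A = space lebesgue \<and> (\<forall>a\<in>A. emeasure lebesgue a \<noteq> \<infinity>)"
    by (intro exI[of _ ?A]) auto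
qed

interpretation lebesgue: sigma_finite_measure "lebesgue :: real measure"
  by (rule sigma_finite_lebesgue)

interpretation lebesgue_pair: pair_sigma_finite "lebesgue :: real measure" "lebesgue :: real measure" ..

text \<open>The translates of a half-open interval by multiples of its length tile the line.\<close>
lemma nn_integral_indicator_translates:
  fixes x a p :: real
  assumes p: "p > 0"
  shows "(\<integral>\<^sup>+k. indicator {a..<a + p} (x - p * of_int k) \<partial>count_space (UNIV :: int set)) = (1 :: ennreal)"
proof -
  define m where "m = \<lfloor>(x - a) / p\<rfloor>"
  have iff: "x - p * of_int k \<in> {a..<a + p} \<longleftrightarrow> k = m" for k
  proof -
    have "x - p * of_int k \<in> {a..<a + p} \<longleftrightarrow> of_int k \<le> (x - a) / p \<and> (x - a) / p < of_int k + 1"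
      using p by (auto simp: pos_le_divide_eq pos_divide_less_eq algebra_simps)
    also have "\<dots> \<longleftrightarrow> k = m"
      unfolding m_def by (subst eq_commute[of k]) (simp add: floor_eq_iff)
    finally show ?thesis .
  qed
  have "(\<integral>\<^sup>+k. indicator {a..<a + p} (x - p * of_int k) \<partial>count_space (UNIV :: int set))
      = (\<Sum>k\<in>{m}. indicator {a..<a + p} (x - p * of_int k) :: ennreal)"
    by (rule nn_integral_count_space') (use iff in \<open>auto simp: indicator_def\<close>)
  also have "\<dots> = 1" using iff[of m] by (simp add: indicator_def)
  finally show ?thesis .
qed

lemma nn_integral_periodize:
  fixes h :: "real \<Rightarrow> ennreal" and a p :: real
  assumes h[measurable]: "h \<in> borel_measurable lebesgue" and p: "p > 0"
  shows "(\<integral>\<^sup>+x. h x \<partial>lebesgue) = (\<integral>\<^sup>+x. indicator {a..<a + p} x * (\<integral>\<^sup>+k. h (x + p * of_int k) \<partial>count_space (UNIV :: int set)) \<partial>lebesgue)"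
proof -
  have i: "(\<lambda>x. indicator {a..<a + p} (x - c) * h x) \<in> borel_measurable lebesgue" for c
  proof -
    have "(\<lambda>x. indicator {a..<a + p} (x - c)) = (indicator {a + c..<a + p + c} :: real \<Rightarrow> ennreal)"
      by (auto simp: fun_eq_iff indicator_def)
    then show ?thesis by (simp add: borel_measurable_times_ennreal)
  qed
  have hk: "(\<lambda>x. h (x + c)) \<in> borel_measurable lebesgue" for c
    using measurable_compose[OF measurable_lebesgue_affine[of 1 c] h] by (simp add: add.commute)
  have "(\<integral>\<^sup>+x. h x \<partial>lebesgue)
      = (\<integral>\<^sup>+x. (\<integral>\<^sup>+k. indicator {a..<a + p} (x - p * of_int k) * h x \<partial>count_space (UNIV :: int set)) \<partial>lebesgue)"
    by (intro nn_integral_cong) (simp add: nn_integral_multc nn_integral_indicator_translates[OF p])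
  also have "\<dots> = (\<integral>\<^sup>+k. (\<integral>\<^sup>+x. indicator {a..<a + p} (x - p * of_int k) * h x \<partial>lebesgue) \<partial>count_space (UNIV :: int set))"
    by (rule nn_integral_count_space_nn_integral) (auto intro: i)
  also have "\<dots> = (\<integral>\<^sup>+k. (\<integral>\<^sup>+x. indicator {a..<a + p} x * h (x + p * of_int k) \<partial>lebesgue) \<partial>count_space (UNIV :: int set))"
  proof (rule nn_integral_cong)
    fix k :: int
    show "(\<integral>\<^sup>+x. indicator {a..<a + p} (x - p * of_int k) * h x \<partial>lebesgue)
        = (\<integral>\<^sup>+x. indicator {a..<a + p} x * h (x + p * of_int k) \<partial>lebesgue)"
      by (subst nn_integral_real_affine_lebesgue[OF i, of 1 _ "p * of_int k"]) (simp_all add: add.commute)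
  qed
  also have "\<dots> = (\<integral>\<^sup>+x. (\<integral>\<^sup>+k. indicator {a..<a + p} x * h (x + p * of_int k) \<partial>count_space (UNIV :: int set)) \<partial>lebesgue)"
    by (rule nn_integral_count_space_nn_integral[symmetric])
      (auto intro!: borel_measurable_times_ennreal borel_measurable_indicator hk)
  also have "\<dots> = (\<integral>\<^sup>+x. indicator {a..<a + p} x * (\<integral>\<^sup>+k. h (x + p * of_int k) \<partial>count_space (UNIV :: int set)) \<partial>lebesgue)"
    by (intro nn_integral_cong nn_integral_cmult) simp
  finally show ?thesis .
qed

lemma fourier_integral_cis: "\<F> f \<xi> = (LINT x|lebesgue. f x * cis (- (x * \<xi>)))"
  by (simp add: fourier_integral_def cis_conv_exp)

lemma integrable_mult_cis:
  fixes f :: "real \<Rightarrow> complex"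
  assumes f: "integrable lebesgue f" and g: "g \<in> borel_measurable lebesgue"
  shows "integrable lebesgue (\<lambda>x. f x * cis (g x))"
proof (rule Bochner_Integration.integrable_bound[OF f])
  show "(\<lambda>x. f x * cis (g x)) \<in> borel_measurable lebesgue"
    by (intro borel_measurable_times borel_measurable_integrable[OF f] borel_measurable_cis g)
qed (simp add: norm_mult)

lemma borel_measurable_lebesgue_linear: "(\<lambda>x. c * x) \<in> borel_measurable (lebesgue :: real measure)"
  "(\<lambda>x. x * c) \<in> borel_measurable (lebesgue :: real measure)"
  "(\<lambda>x. - (c * x)) \<in> borel_measurable (lebesgue :: real measure)"
  "(\<lambda>x. - (x * c)) \<in> borel_measurable (lebesgue :: real measure)"
  by (intro borel_measurable_times borel_measurable_uminus borel_measurable_const borel_measurable_lebesgue_ident)+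

lemma measurable_lebesgue_fst_snd [measurable]:
  "fst \<in> borel_measurable (lebesgue \<Otimes>\<^sub>M lebesgue)" "snd \<in> borel_measurable (lebesgue \<Otimes>\<^sub>M lebesgue)"
  using measurable_compose[OF measurable_fst borel_measurable_lebesgue_ident]
    measurable_compose[OF measurable_snd borel_measurable_lebesgue_ident] by auto

lemma borel_measurable_fourier_integral:
  assumes f: "integrable lebesgue f"
  shows "\<F> f \<in> borel_measurable lebesgue"
proof -
  have [measurable]: "f \<in> borel_measurable lebesgue" using f by auto
  have "(\<lambda>p. f (snd p) * cis (- (snd p * fst p))) \<in> borel_measurable (lebesgue \<Otimes>\<^sub>M lebesgue)"
    by (intro borel_measurable_times borel_measurable_cis borel_measurable_uminus measurable_lebesgue_fst_snd
        measurable_compose[OF measurable_snd]) auto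
  then have "(\<lambda>\<xi>. LINT x|lebesgue. f x * cis (- (x * \<xi>))) \<in> borel_measurable lebesgue"
    by (intro lebesgue.borel_measurable_lebesgue_integral) (simp add: case_prod_beta)
  then show ?thesis by (simp add: fourier_integral_cis[abs_def])
qed

lemma fourier_integral_diff:
  assumes "integrable lebesgue f" "integrable lebesgue g"
  shows "\<F> (\<lambda>x. f x - g x) \<xi> = \<F> f \<xi> - \<F> g \<xi>"
  using assms unfolding fourier_integral_cis
  by (simp add: left_diff_distrib integrable_mult_cis borel_measurable_lebesgue_linear)

lemma fourier_integral_scale: "\<F> (\<lambda>x. c * f x) \<xi> = c * \<F> f \<xi>"
  unfolding fourier_integral_cis by (simp add: mult.assoc)

text \<open>For a function supported in an interval of length \<open>2 \<pi> L\<close>, the values of the transform at the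
  points \<open>t + k / L\<close> are the Fourier coefficients of a modulated copy, so the sum of their squares
  is the same for each \<open>t\<close>; integrating over one period of \<open>t\<close> gives Plancherel's identity.\<close>

lemma Plancherel_compact_support:
  fixes L :: real
  assumes f: "f \<in> L2 lebesgue" and L: "L > 0" and supp: "\<And>x. x \<notin> {-pi * L..<pi * L} \<Longrightarrow> f x = 0"
  shows "integrable lebesgue f"
    and "(\<integral>\<^sup>+\<xi>. ennreal ((cmod (\<F> f \<xi>))\<^sup>2) \<partial>lebesgue) = ennreal (2 * pi * (norm2 f)\<^sup>2)"
proof -
  show fi: "integrable lebesgue f"
    by (rule L2_finite_support_integrable[OF f, of "{-pi * L..<pi * L}"]) (use L supp in auto)
  have m: "(\<lambda>\<xi>. ennreal ((cmod (\<F> f \<xi>))\<^sup>2)) \<in> borel_measurable lebesgue"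
    by (intro measurable_compose[OF _ measurable_ennreal] borel_measurable_power
        measurable_compose[OF borel_measurable_fourier_integral[OF fi] borel_measurable_norm])
  have sum: "coeff_energy (\<lambda>k. \<F> f (t + (1 / L) * of_int k))
      = ennreal (2 * pi * L * (norm2 f)\<^sup>2)" for t
  proof -
    let ?g = "\<lambda>x. f x * cis (- (x * t))"
    have g2: "?g \<in> L2 lebesgue"
      by (rule L2_dominated[OF _ f])
        (auto simp: norm_mult intro!: borel_measurable_times borel_measurable_cis L2_measurable[OF f] borel_measurable_lebesgue_linear)
    have "\<F> f (t + (1 / L) * of_int k) = (LINT x|lebesgue. ?g x * cis (- (of_int k * (1 / L) * x)))" for k :: int
    proof -
      have "cis (- (x * (t + (1 / L) * of_int k))) = cis (- (x * t)) * cis (- (of_int k * (1 / L) * x))" for x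
        by (simp add: cis_mult algebra_simps)
      then show ?thesis unfolding fourier_integral_cis by (simp only: mult.assoc)
    qed
    moreover have "coeff_energy (\<lambda>k. LINT x|lebesgue. ?g x * cis (- (of_int k * (1 / L) * x)))
      = ennreal (2 * pi / (1 / L)) * (\<integral>\<^sup>+x. ennreal ((cmod (?g x))\<^sup>2) \<partial>lebesgue)"
    proof (rule Parseval[OF _ g2])
      show "?g x = 0" if "x \<notin> {- pi * L..<- pi * L + 2 * pi / (1 / L)}" for x
      proof -
        have "- pi * L + 2 * pi / (1 / L) = pi * L" by (simp add: algebra_simps)
        with that have "f x = 0" by (intro supp) (simp only: not_False_eq_True)
        then show ?thesis by simp
      qed
    qed (use L in simp)
    moreover have "(\<integral>\<^sup>+x. ennreal ((cmod (?g x))\<^sup>2) \<partial>lebesgue) = ennreal ((norm2 f)\<^sup>2)"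
      by (simp add: norm_mult nn_integral_L2_norm[OF f])
    ultimately show ?thesis
      using L by (simp only:) (simp add: ennreal_mult)
  qed
  have "(\<integral>\<^sup>+\<xi>. ennreal ((cmod (\<F> f \<xi>))\<^sup>2) \<partial>lebesgue)
      = (\<integral>\<^sup>+t. indicator {0..<0 + 1 / L} t * coeff_energy (\<lambda>k. \<F> f (t + (1 / L) * of_int k)) \<partial>lebesgue)"
    by (rule nn_integral_periodize[OF m]) (use L in simp)
  also have "\<dots> = (\<integral>\<^sup>+t. indicator {0..<0 + 1 / L} t * ennreal (2 * pi * L * (norm2 f)\<^sup>2) \<partial>lebesgue)"
    by (simp only: sum)
  also have "\<dots> = ennreal (2 * pi * L * (norm2 f)\<^sup>2) * emeasure lebesgue {0..<0 + 1 / L}"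
    by (subst nn_integral_multc) (simp_all add: mult.commute)
  also have "\<dots> = ennreal (2 * pi * L * (norm2 f)\<^sup>2 * (1 / L))"
    using L by (subst ennreal_mult) auto
  also have "2 * pi * L * (norm2 f)\<^sup>2 * (1 / L) = 2 * pi * (norm2 f)\<^sup>2"
    using L by simp
  finally show "(\<integral>\<^sup>+\<xi>. ennreal ((cmod (\<F> f \<xi>))\<^sup>2) \<partial>lebesgue) = ennreal (2 * pi * (norm2 f)\<^sup>2)" .
qed

text \<open>The interval has length \<open>2 \<pi> (n + 1)\<close> rather than \<open>2 \<pi> n\<close>, so that
  \<open>Plancherel_compact_support\<close> applies for every \<open>n\<close>.\<close>
definition truncate :: "nat \<Rightarrow> (real \<Rightarrow> complex) \<Rightarrow> real \<Rightarrow> complex" where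
  "truncate n f x = indicator {- pi * real (Suc n)..<pi * real (Suc n)} x * f x"

lemma truncate_L2:
  assumes f: "f \<in> L2 lebesgue"
  shows "truncate n f \<in> L2 lebesgue"
proof (rule L2_dominated[OF _ f])
  show "truncate n f \<in> borel_measurable lebesgue"
    unfolding truncate_def[abs_def]
    by (intro borel_measurable_times borel_measurable_indicator L2_measurable[OF f]) simp
  show "cmod (truncate n f x) \<le> cmod (f x)" for x
    by (simp add: truncate_def indicator_def)
qed

lemma Plancherel_truncate:
  assumes f: "f \<in> L2 lebesgue"
  shows "integrable lebesgue (truncate n f)"
    and "(\<integral>\<^sup>+\<xi>. ennreal ((cmod (\<F> (truncate n f) \<xi>))\<^sup>2) \<partial>lebesgue)
      = ennreal (2 * pi * (norm2 (truncate n f))\<^sup>2)"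
  using Plancherel_compact_support[OF truncate_L2[OF f], of "real (Suc n)" n]
  by (simp_all add: truncate_def)

lemma truncate_eventually_eq: "\<forall>\<^sub>F n in sequentially. truncate n f x = f x"
proof (rule eventually_sequentiallyI)
  fix n assume n: "nat \<lceil>\<bar>x\<bar>\<rceil> \<le> n"
  have "\<bar>x\<bar> < real (Suc n)" using n by linarith
  also have "real (Suc n) = 1 * real (Suc n)" by simp
  also have "\<dots> \<le> pi * real (Suc n)" using pi_gt3 by (intro mult_right_mono) auto
  finally show "truncate n f x = f x" by (simp add: truncate_def indicator_def abs_less_iff)
qed

lemma truncate_tendsto:
  assumes f: "f \<in> L2 lebesgue"
  shows "(\<lambda>n. norm2 (\<lambda>x. truncate n f x - f x)) \<longlonglongrightarrow> 0"
proof -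
  have "(\<lambda>n. LINT x|lebesgue. (cmod (truncate n f x - f x))\<^sup>2) \<longlonglongrightarrow> (LINT x|(lebesgue :: real measure). 0)"
  proof (rule integral_dominated_convergence[where w="\<lambda>x. (cmod (f x))\<^sup>2"])
    show "integrable lebesgue (\<lambda>x. (cmod (f x))\<^sup>2)" by (rule L2_integrable_square[OF f])
    show "(\<lambda>x. (cmod (truncate n f x - f x))\<^sup>2) \<in> borel_measurable lebesgue" for n
      using L2_integrable_square[OF L2_diff[OF truncate_L2[OF f, of n] f]] by auto
    show "AE x in lebesgue. (\<lambda>n. (cmod (truncate n f x - f x))\<^sup>2) \<longlonglongrightarrow> 0"
    proof (intro AE_I2 tendsto_eventually)
      show "\<forall>\<^sub>F n in sequentially. (cmod (truncate n f x - f x))\<^sup>2 = 0" for x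
        using truncate_eventually_eq[of f x] by eventually_elim simp
    qed
    show "AE x in lebesgue. norm ((cmod (truncate n f x - f x))\<^sup>2) \<le> (cmod (f x))\<^sup>2" for n
      by (intro AE_I2) (simp add: truncate_def indicator_def)
  qed simp
  then have "(\<lambda>n. sqrt (LINT x|lebesgue. (cmod (truncate n f x - f x))\<^sup>2)) \<longlonglongrightarrow> sqrt 0"
    by (intro tendsto_real_sqrt) simp
  then show ?thesis by (simp add: L2_norm_def)
qed

lemma fourier_integral_truncate_tendsto:
  assumes f: "integrable lebesgue f"
  shows "(\<lambda>n. \<F> (truncate n f) \<xi>) \<longlonglongrightarrow> \<F> f \<xi>"
  unfolding fourier_integral_cis
proof (rule integral_dominated_convergence[where w="\<lambda>x. cmod (f x)"])
  show "(\<lambda>x. f x * cis (- (x * \<xi>))) \<in> borel_measurable lebesgue"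
    using integrable_mult_cis[OF f borel_measurable_lebesgue_linear(4)] by auto
  show "(\<lambda>x. truncate n f x * cis (- (x * \<xi>))) \<in> borel_measurable lebesgue" for n
    unfolding truncate_def
    by (intro borel_measurable_times borel_measurable_indicator borel_measurable_integrable[OF f]
        borel_measurable_cis borel_measurable_lebesgue_linear) simp
  show "integrable lebesgue (\<lambda>x. cmod (f x))" using f by simp
  show "AE x in lebesgue. (\<lambda>n. truncate n f x * cis (- (x * \<xi>))) \<longlonglongrightarrow> f x * cis (- (x * \<xi>))"
  proof (intro AE_I2 tendsto_eventually)
    show "\<forall>\<^sub>F n in sequentially. truncate n f x * cis (- (x * \<xi>)) = f x * cis (- (x * \<xi>))" for x
      using truncate_eventually_eq[of f x] by eventually_elim simp
  qed
  show "AE x in lebesgue. norm (truncate n f x * cis (- (x * \<xi>))) \<le> cmod (f x)" for n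
    by (intro AE_I2) (simp add: truncate_def indicator_def norm_mult)
qed

text \<open>Fatou's lemma along the truncations of \<open>f\<close>, whose transforms converge pointwise.\<close>
lemma Plancherel_bound:
  assumes f: "f \<in> L2 lebesgue" and fi: "integrable lebesgue f"
  shows "\<F> f \<in> L2 lebesgue"
    and "norm2 (\<F> f) \<le> sqrt (2 * pi) * norm2 f"
proof -
  have "(\<integral>\<^sup>+\<xi>. ennreal ((cmod (\<F> f \<xi>))\<^sup>2) \<partial>lebesgue)
      = (\<integral>\<^sup>+\<xi>. liminf (\<lambda>n. ennreal ((cmod (\<F> (truncate n f) \<xi>))\<^sup>2)) \<partial>lebesgue)"
  proof (intro nn_integral_cong lim_imp_Liminf[symmetric])
    show "(\<lambda>n. ennreal ((cmod (\<F> (truncate n f) \<xi>))\<^sup>2)) \<longlonglongrightarrow> ennreal ((cmod (\<F> f \<xi>))\<^sup>2)" for \<xi>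
      by (intro tendsto_ennrealI tendsto_power tendsto_norm fourier_integral_truncate_tendsto[OF fi])
  qed simp
  also have "\<dots> \<le> liminf (\<lambda>n. (\<integral>\<^sup>+\<xi>. ennreal ((cmod (\<F> (truncate n f) \<xi>))\<^sup>2) \<partial>lebesgue))"
    by (intro nn_integral_liminf measurable_compose[OF _ measurable_ennreal] borel_measurable_power
        measurable_compose[OF borel_measurable_fourier_integral[OF Plancherel_truncate(1)[OF f]] borel_measurable_norm])
  also have "\<dots> \<le> limsup (\<lambda>n. (\<integral>\<^sup>+\<xi>. ennreal ((cmod (\<F> (truncate n f) \<xi>))\<^sup>2) \<partial>lebesgue))"
    by (rule Liminf_le_Limsup) simp
  also have "\<dots> \<le> ennreal (2 * pi * (norm2 f)\<^sup>2)"
  proof (rule Limsup_bounded, rule always_eventually, rule allI)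
    fix n
    have "norm2 (truncate n f) \<le> norm2 f"
      unfolding L2_norm_def
      by (intro real_sqrt_le_mono integral_mono L2_integrable_square truncate_L2 f)
        (simp add: truncate_def indicator_def)
    then show "(\<integral>\<^sup>+\<xi>. ennreal ((cmod (\<F> (truncate n f) \<xi>))\<^sup>2) \<partial>lebesgue) \<le> ennreal (2 * pi * (norm2 f)\<^sup>2)"
      unfolding Plancherel_truncate(2)[OF f]
      by (intro ennreal_leI mult_left_mono power_mono) auto
  qed
  finally have le: "(\<integral>\<^sup>+\<xi>. ennreal ((cmod (\<F> f \<xi>))\<^sup>2) \<partial>lebesgue) \<le> ennreal (2 * pi * (norm2 f)\<^sup>2)" .
  then show F: "\<F> f \<in> L2 lebesgue"
    unfolding L2_iff_nn_integral using borel_measurable_fourier_integral[OF fi]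
    by (auto intro: le_less_trans)
  have "(norm2 (\<F> f))\<^sup>2 \<le> 2 * pi * (norm2 f)\<^sup>2"
    using le unfolding nn_integral_L2_norm[OF F] by (subst (asm) ennreal_le_iff) auto
  also have "\<dots> = (sqrt (2 * pi) * norm2 f)\<^sup>2" by (simp add: power_mult_distrib)
  finally show "norm2 (\<F> f) \<le> sqrt (2 * pi) * norm2 f"
    by (rule power2_le_imp_le) simp
qed

text \<open>The bound applied to \<open>f - truncate n f\<close> shows that the transforms of the truncations converge to
  that of \<open>f\<close> in norm, so the exact identity for the truncations passes to the limit.\<close>
lemma Plancherel_L1_L2:
  assumes f: "f \<in> L2 lebesgue" and fi: "integrable lebesgue f"
  shows "norm2 (\<F> f) = sqrt (2 * pi) * norm2 f"
proof (rule LIMSEQ_unique)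
  let ?t = "\<lambda>n. truncate n f"
  note t = truncate_L2[OF f] and ti = Plancherel_truncate(1)[OF f]
  have "(\<lambda>n. norm2 (\<lambda>\<xi>. \<F> (?t n) \<xi> - \<F> f \<xi>)) \<longlonglongrightarrow> 0"
  proof (rule tendsto_sandwich[OF always_eventually always_eventually tendsto_const])
    show "\<forall>n. 0 \<le> norm2 (\<lambda>\<xi>. \<F> (?t n) \<xi> - \<F> f \<xi>)" by simp
    show "\<forall>n. norm2 (\<lambda>\<xi>. \<F> (?t n) \<xi> - \<F> f \<xi>)
        \<le> sqrt (2 * pi) * norm2 (\<lambda>x. ?t n x - f x)"
      using Plancherel_bound(2)[OF L2_diff[OF t f] Bochner_Integration.integrable_diff[OF ti fi]]
      unfolding fourier_integral_diff[OF ti fi] by blast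
    show "(\<lambda>n. sqrt (2 * pi) * norm2 (\<lambda>x. ?t n x - f x)) \<longlonglongrightarrow> 0"
      using tendsto_mult[OF tendsto_const truncate_tendsto[OF f], of "sqrt (2 * pi)"] by simp
  qed
  then show "(\<lambda>n. norm2 (\<F> (?t n))) \<longlonglongrightarrow> norm2 (\<F> f)"
    by (rule tendsto_L2_norm[OF Plancherel_bound(1)[OF t ti] Plancherel_bound(1)[OF f fi]])
  have eq: "norm2 (\<F> (?t n)) = sqrt (2 * pi) * norm2 (?t n)" for n
  proof -
    have "ennreal ((norm2 (\<F> (?t n)))\<^sup>2) = ennreal (2 * pi * (norm2 (?t n))\<^sup>2)"
      unfolding nn_integral_L2_norm[OF Plancherel_bound(1)[OF t ti], symmetric] by (rule Plancherel_truncate(2)[OF f])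
    then have "(norm2 (\<F> (?t n)))\<^sup>2 = 2 * pi * (norm2 (?t n))\<^sup>2"
      by (subst (asm) ennreal_inj) auto
    also have "\<dots> = (sqrt (2 * pi) * norm2 (?t n))\<^sup>2" by (simp add: power_mult_distrib)
    finally show ?thesis by (rule power2_eq_imp_eq) auto
  qed
  show "(\<lambda>n. norm2 (\<F> (?t n))) \<longlonglongrightarrow> sqrt (2 * pi) * norm2 f"
    unfolding eq by (intro tendsto_mult tendsto_const tendsto_L2_norm[OF t f truncate_tendsto[OF f]])
qed


section \<open>The Fourier transform on \<open>L\<^sup>2\<close>\<close>

text \<open>The transform \<open>F\<close> of \<open>f\<close> is described by its distances from the transforms of all integrable
  functions \<open>s\<close>. In this form it is invariant under changes on null sets, and the rules for scaling,
  translation and dilation reduce to the corresponding rules for the Fourier integral of \<open>s\<close>.\<close>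
definition is_fourier :: "(real \<Rightarrow> complex) \<Rightarrow> (real \<Rightarrow> complex) \<Rightarrow> bool" where
  "is_fourier f F \<longleftrightarrow> f \<in> L2 lebesgue \<and> F \<in> L2 lebesgue \<and>
    (\<forall>s \<in> L2 lebesgue. integrable lebesgue s \<longrightarrow>
      norm2 (\<lambda>\<xi>. \<F> s \<xi> - F \<xi>) = sqrt (2 * pi) * norm2 (\<lambda>x. s x - f x))"

lemma is_fourierD:
  assumes "is_fourier f F"
  shows "f \<in> L2 lebesgue" "F \<in> L2 lebesgue"
    "s \<in> L2 lebesgue \<Longrightarrow> integrable lebesgue s \<Longrightarrow>
      norm2 (\<lambda>\<xi>. \<F> s \<xi> - F \<xi>) = sqrt (2 * pi) * norm2 (\<lambda>x. s x - f x)"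
  using assms by (auto simp: is_fourier_def)

lemma is_fourier_tendsto:
  assumes fF: "is_fourier f F" and s: "\<And>n. s n \<in> L2 lebesgue" "\<And>n. integrable lebesgue (s n)"
    and lim: "(\<lambda>n. norm2 (\<lambda>x. s n x - f x)) \<longlonglongrightarrow> 0"
  shows "(\<lambda>n. norm2 (\<lambda>\<xi>. \<F> (s n) \<xi> - F \<xi>)) \<longlonglongrightarrow> 0"
  unfolding is_fourierD(3)[OF fF s] using tendsto_mult[OF tendsto_const lim, of "sqrt (2 * pi)"] by simp

text \<open>The transforms of the truncations of \<open>f\<close> form a Cauchy sequence by Plancherel's theorem.\<close>
lemma is_fourier_exists:
  assumes f: "f \<in> L2 lebesgue"
  shows "\<exists>F. is_fourier f F"
proof -
  let ?t = "\<lambda>n. truncate n f" and ?c = "sqrt (2 * pi)"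
  have c: "?c > 0" by simp
  note t = truncate_L2[OF f] and ti = Plancherel_truncate(1)[OF f]
  have dist: "norm2 (\<lambda>\<xi>. \<F> s \<xi> - \<F> (?t n) \<xi>) = ?c * norm2 (\<lambda>x. s x - ?t n x)"
    if s: "s \<in> L2 lebesgue" and si: "integrable lebesgue s" for s n
    using Plancherel_L1_L2[OF L2_diff[OF s t] Bochner_Integration.integrable_diff[OF si ti]]
    unfolding fourier_integral_diff[OF si ti] .
  have "\<exists>F\<in>L2 lebesgue. (\<lambda>n. norm2 (\<lambda>\<xi>. \<F> (?t n) \<xi> - F \<xi>)) \<longlonglongrightarrow> 0"
  proof (rule L2_complete[OF Plancherel_bound(1)[OF t ti]])
    fix e :: real assume "e > 0"
    then have "e / (2 * ?c) > 0" using c by simp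
    from LIMSEQ_D[OF truncate_tendsto[OF f] this] obtain N
      where N: "\<And>n. n \<ge> N \<Longrightarrow> norm2 (\<lambda>x. ?t n x - f x) < e / (2 * ?c)" by auto
    have "norm2 (\<lambda>\<xi>. \<F> (?t m) \<xi> - \<F> (?t n) \<xi>) < e" if "m \<ge> N" "n \<ge> N" for m n
    proof -
      have "norm2 (\<lambda>x. ?t m x - ?t n x)
          \<le> norm2 (\<lambda>x. ?t m x - f x) + norm2 (\<lambda>x. f x - ?t n x)"
        by (rule L2_norm_triangle_diff[OF t f t])
      also have "norm2 (\<lambda>x. f x - ?t n x) = norm2 (\<lambda>x. ?t n x - f x)"
        by (rule L2_norm_minus_commute)
      also have "norm2 (\<lambda>x. ?t m x - f x) + \<dots> < e / (2 * ?c) + e / (2 * ?c)"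
        by (intro add_strict_mono N that)
      also have "\<dots> = e / ?c" by simp
      finally show ?thesis
        unfolding dist[OF t ti] using c by (simp only: pos_less_divide_eq mult.commute)
    qed
    then show "\<exists>N. \<forall>m\<ge>N. \<forall>n\<ge>N. norm2 (\<lambda>\<xi>. \<F> (?t m) \<xi> - \<F> (?t n) \<xi>) < e"
      by blast
  qed
  then obtain F where F: "F \<in> L2 lebesgue"
    and lim: "(\<lambda>n. norm2 (\<lambda>\<xi>. \<F> (?t n) \<xi> - F \<xi>)) \<longlonglongrightarrow> 0" by blast
  have "norm2 (\<lambda>\<xi>. \<F> s \<xi> - F \<xi>) = ?c * norm2 (\<lambda>x. s x - f x)"
    if s: "s \<in> L2 lebesgue" and si: "integrable lebesgue s" for s
  proof (rule LIMSEQ_unique)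
    note s' = Plancherel_bound(1)[OF s si] and t' = Plancherel_bound(1)[OF t ti]
    show "(\<lambda>n. norm2 (\<lambda>\<xi>. \<F> s \<xi> - \<F> (?t n) \<xi>))
        \<longlonglongrightarrow> norm2 (\<lambda>\<xi>. \<F> s \<xi> - F \<xi>)"
    proof (rule tendsto_L2_norm[OF L2_diff[OF s' t'] L2_diff[OF s' F]])
      have "(\<lambda>\<xi>. (\<F> s \<xi> - \<F> (?t n) \<xi>) - (\<F> s \<xi> - F \<xi>))
          = (\<lambda>\<xi>. F \<xi> - \<F> (?t n) \<xi>)" for n by auto
      then show "(\<lambda>n. norm2 (\<lambda>\<xi>. (\<F> s \<xi> - \<F> (?t n) \<xi>) - (\<F> s \<xi> - F \<xi>))) \<longlonglongrightarrow> 0"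
        using lim by (simp only: L2_norm_minus_commute[of lebesgue F])
    qed
    have "(\<lambda>n. norm2 (\<lambda>x. s x - ?t n x)) \<longlonglongrightarrow> norm2 (\<lambda>x. s x - f x)"
    proof (rule tendsto_L2_norm[OF L2_diff[OF s t] L2_diff[OF s f]])
      have "(\<lambda>x. (s x - ?t n x) - (s x - f x)) = (\<lambda>x. f x - ?t n x)" for n by auto
      then show "(\<lambda>n. norm2 (\<lambda>x. (s x - ?t n x) - (s x - f x))) \<longlonglongrightarrow> 0"
        using truncate_tendsto[OF f] by (simp only: L2_norm_minus_commute[of lebesgue f])
    qed
    then show "(\<lambda>n. norm2 (\<lambda>\<xi>. \<F> s \<xi> - \<F> (?t n) \<xi>)) \<longlonglongrightarrow> ?c * norm2 (\<lambda>x. s x - f x)"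
      unfolding dist[OF s si] by (rule tendsto_mult[OF tendsto_const])
  qed
  then show ?thesis using f F by (auto simp: is_fourier_def)
qed

lemma L2_norm_AE_eq_diff:
  assumes "f \<in> L2 M" "g \<in> L2 M" "L2_norm M (\<lambda>x. f x - g x) = 0"
  shows "AE x in M. f x = g x"
  using L2_norm_eq_0[OF L2_diff[OF assms(1,2)] assms(3)] by eventually_elim simp

text \<open>The condition in the definition of \<open>fourier_L2\<close> can be met, and it determines the function up to a
  null set, because it fixes the limit of the transforms of the truncations.\<close>
lemma is_fourier_fourier_L2:
  assumes f: "f \<in> L2 lebesgue"
  shows "is_fourier f (fourier_L2 f)"
proof -
  define P where "P F \<longleftrightarrow> F \<in> L2 lebesgue \<and>
     (\<forall>s. (\<forall>n::nat. s n \<in> L2 lebesgue \<and> integrable lebesgue (s n)) \<and>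
           (\<lambda>n. norm2 (\<lambda>x. s n x - f x)) \<longlonglongrightarrow> 0 \<longrightarrow>
           (\<lambda>n. norm2 (\<lambda>\<xi>. \<F> (s n) \<xi> - F \<xi>)) \<longlonglongrightarrow> 0)" for F
  obtain G where G: "is_fourier f G" using is_fourier_exists[OF f] by blast
  have "P G"
    unfolding P_def
  proof (intro conjI allI impI is_fourierD(2)[OF G])
    fix s :: "nat \<Rightarrow> real \<Rightarrow> complex"
    assume s: "(\<forall>n. s n \<in> L2 lebesgue \<and> integrable lebesgue (s n)) \<and>
      (\<lambda>n. norm2 (\<lambda>x. s n x - f x)) \<longlonglongrightarrow> 0"
    show "(\<lambda>n. norm2 (\<lambda>\<xi>. \<F> (s n) \<xi> - G \<xi>)) \<longlonglongrightarrow> 0"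
      by (rule is_fourier_tendsto[OF G]) (use s in auto)
  qed
  moreover have "fourier_L2 f = (SOME F. P F)" by (simp only: fourier_L2_def P_def)
  ultimately have P: "P (fourier_L2 f)" by (metis someI)
  let ?F = "fourier_L2 f" and ?t = "\<lambda>n. truncate n f"
  have F: "?F \<in> L2 lebesgue" using P by (simp add: P_def)
  note t = truncate_L2[OF f] and ti = Plancherel_truncate(1)[OF f]
  note t' = Plancherel_bound(1)[OF t ti] and g = is_fourierD(2)[OF G]
  have limF: "(\<lambda>n. norm2 (\<lambda>\<xi>. \<F> (?t n) \<xi> - ?F \<xi>)) \<longlonglongrightarrow> 0"
    using P t ti truncate_tendsto[OF f] unfolding P_def by (elim conjE allE[of _ ?t]) blast
  have limG: "(\<lambda>n. norm2 (\<lambda>\<xi>. \<F> (?t n) \<xi> - G \<xi>)) \<longlonglongrightarrow> 0"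
    by (rule is_fourier_tendsto[OF G t ti truncate_tendsto[OF f]])
  have "norm2 (\<lambda>\<xi>. ?F \<xi> - G \<xi>) \<le> 0"
  proof (rule LIMSEQ_le_const)
    show "(\<lambda>n. norm2 (\<lambda>\<xi>. \<F> (?t n) \<xi> - ?F \<xi>)
        + norm2 (\<lambda>\<xi>. \<F> (?t n) \<xi> - G \<xi>)) \<longlonglongrightarrow> 0"
      using tendsto_add[OF limF limG] by simp
    show "\<exists>N. \<forall>n\<ge>N. norm2 (\<lambda>\<xi>. ?F \<xi> - G \<xi>) \<le> norm2 (\<lambda>\<xi>. \<F> (?t n) \<xi> - ?F \<xi>)
        + norm2 (\<lambda>\<xi>. \<F> (?t n) \<xi> - G \<xi>)"
      using L2_norm_triangle_diff[OF F t' g] unfolding L2_norm_minus_commute[of lebesgue ?F "\<F> _"] by blast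
  qed
  then have "norm2 (\<lambda>\<xi>. ?F \<xi> - G \<xi>) = 0" by (simp add: order_antisym)
  then have FG: "AE \<xi> in lebesgue. ?F \<xi> = G \<xi>" by (rule L2_norm_AE_eq_diff[OF F g])
  have "norm2 (\<lambda>\<xi>. \<F> s \<xi> - ?F \<xi>) = norm2 (\<lambda>\<xi>. \<F> s \<xi> - G \<xi>)"
    if "s \<in> L2 lebesgue" "integrable lebesgue s" for s
  proof (rule L2_norm_cong_AE)
    show "AE \<xi> in lebesgue. \<F> s \<xi> - ?F \<xi> = \<F> s \<xi> - G \<xi>"
      using FG by eventually_elim simp
  qed (intro L2_measurable L2_diff Plancherel_bound that F g)+
  then show ?thesis using f F is_fourierD(3)[OF G] by (auto simp: is_fourier_def)
qed

lemma is_fourier_norm: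
  assumes fF: "is_fourier f F"
  shows "norm2 F = sqrt (2 * pi) * norm2 f"
proof -
  have "\<F> (\<lambda>x. 0) \<xi> = 0" for \<xi> by (simp add: fourier_integral_cis)
  then have "norm2 (\<lambda>\<xi>. 0 - F \<xi>) = sqrt (2 * pi) * norm2 (\<lambda>x. 0 - f x)"
    using is_fourierD(3)[OF fF, of "\<lambda>x. 0"] by simp
  then show ?thesis by (simp add: L2_norm_def)
qed

lemma is_fourier_norm_diff:
  assumes fF: "is_fourier f F" and gG: "is_fourier g G"
  shows "norm2 (\<lambda>\<xi>. F \<xi> - G \<xi>) = sqrt (2 * pi) * norm2 (\<lambda>x. f x - g x)"
proof (rule LIMSEQ_unique)
  note f = is_fourierD(1,2)[OF fF] and g = is_fourierD(1,2)[OF gG]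
  let ?t = "\<lambda>n. truncate n f"
  note t = truncate_L2[OF f(1)] and ti = Plancherel_truncate(1)[OF f(1)]
  note t' = Plancherel_bound(1)[OF t ti]
  show "(\<lambda>n. norm2 (\<lambda>\<xi>. \<F> (?t n) \<xi> - G \<xi>)) \<longlonglongrightarrow> norm2 (\<lambda>\<xi>. F \<xi> - G \<xi>)"
    by (rule tendsto_L2_norm[OF L2_diff[OF t' g(2)] L2_diff[OF f(2) g(2)]])
      (use is_fourier_tendsto[OF fF t ti truncate_tendsto[OF f(1)]] in simp)
  have "(\<lambda>n. norm2 (\<lambda>x. ?t n x - g x)) \<longlonglongrightarrow> norm2 (\<lambda>x. f x - g x)"
    by (rule tendsto_L2_norm[OF L2_diff[OF t g(1)] L2_diff[OF f(1) g(1)]])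
      (use truncate_tendsto[OF f(1)] in simp)
  then show "(\<lambda>n. norm2 (\<lambda>\<xi>. \<F> (?t n) \<xi> - G \<xi>)) \<longlonglongrightarrow> sqrt (2 * pi) * norm2 (\<lambda>x. f x - g x)"
    unfolding is_fourierD(3)[OF gG t ti] by (rule tendsto_mult[OF tendsto_const])
qed

lemma is_fourier_scale:
  assumes fF: "is_fourier f F"
  shows "is_fourier (\<lambda>x. c * f x) (\<lambda>\<xi>. c * F \<xi>)"
proof (cases "c = 0")
  case True
  have "is_fourier (\<lambda>x. 0) (\<lambda>\<xi>. 0)"
    using Plancherel_L1_L2 by (simp add: is_fourier_def)
  then show ?thesis using True by simp
next
  case False
  show ?thesis
    unfolding is_fourier_def
  proof (intro conjI ballI impI L2_scale is_fourierD(1,2)[OF fF])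
    fix s :: "real \<Rightarrow> complex" assume s: "s \<in> L2 lebesgue" "integrable lebesgue s"
    let ?s = "\<lambda>x. inverse c * s x"
    have s': "?s \<in> L2 lebesgue" "integrable lebesgue ?s"
      using L2_scale[OF s(1), of "inverse c"] s(2) by simp_all
    have 1: "\<F> s \<xi> - c * F \<xi> = c * (\<F> ?s \<xi> - F \<xi>)" for \<xi>
      unfolding fourier_integral_scale using False by (simp add: right_diff_distrib)
    have 2: "s x - c * f x = c * (?s x - f x)" for x
      using False by (simp add: right_diff_distrib)
    show "norm2 (\<lambda>\<xi>. \<F> s \<xi> - c * F \<xi>) = sqrt (2 * pi) * norm2 (\<lambda>x. s x - c * f x)"
      unfolding 1 2 L2_norm_scale is_fourierD(3)[OF fF s'] by (rule mult.left_commute)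
  qed
qed

text \<open>Polarization gives the real part; the imaginary part is the real part for \<open>\<i> g\<close> in place of \<open>g\<close>.\<close>
lemma is_fourier_inner:
  assumes fF: "is_fourier f F" and gG: "is_fourier g G"
  shows "inner2 F G = of_real (2 * pi) * inner2 f g"
proof -
  have Re: "Re (inner2 F G) = 2 * pi * Re (inner2 f g)"
    if fF: "is_fourier f F" and gG: "is_fourier g G" for f F g G
  proof -
    have "(norm2 (\<lambda>\<xi>. F \<xi> - G \<xi>))\<^sup>2 = 2 * pi * (norm2 (\<lambda>x. f x - g x))\<^sup>2"
      "(norm2 F)\<^sup>2 = 2 * pi * (norm2 f)\<^sup>2"
      "(norm2 G)\<^sup>2 = 2 * pi * (norm2 g)\<^sup>2"
      using is_fourier_norm_diff[OF fF gG] is_fourier_norm[OF fF] is_fourier_norm[OF gG]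
      by (simp_all add: power_mult_distrib)
    then show ?thesis
      unfolding L2_norm_diff_square[OF is_fourierD(2)[OF fF] is_fourierD(2)[OF gG]]
        L2_norm_diff_square[OF is_fourierD(1)[OF fF] is_fourierD(1)[OF gG]]
      by (simp add: algebra_simps)
  qed
  have "Re (inner2 F (\<lambda>\<xi>. \<i> * G \<xi>)) = 2 * pi * Re (inner2 f (\<lambda>x. \<i> * g x))"
    by (rule Re[OF fF is_fourier_scale[OF gG]])
  then have "Im (inner2 F G) = 2 * pi * Im (inner2 f g)"
    unfolding L2_inner_scale_right by simp
  with Re[OF fF gG] show ?thesis by (simp add: complex_eq_iff)
qed

lemma is_fourier_translation:
  assumes fF: "is_fourier f F"
  shows "is_fourier (\<lambda>x. f (x + c)) (\<lambda>\<xi>. cis (c * \<xi>) * F \<xi>)"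
  unfolding is_fourier_def
proof (intro conjI ballI impI)
  note f = is_fourierD(1,2)[OF fF]
  show "(\<lambda>x. f (x + c)) \<in> L2 lebesgue"
    using L2_lebesgue_affine(1)[OF f(1), of 1 c] by (simp add: add.commute)
  show "(\<lambda>\<xi>. cis (c * \<xi>) * F \<xi>) \<in> L2 lebesgue"
    by (rule L2_dominated[OF _ f(2)])
      (auto simp: norm_mult intro!: borel_measurable_times borel_measurable_cis borel_measurable_lebesgue_linear L2_measurable[OF f(2)])
  fix s :: "real \<Rightarrow> complex" assume s: "s \<in> L2 lebesgue" "integrable lebesgue s"
  let ?s = "\<lambda>x. s (x - c)"
  have s': "?s \<in> L2 lebesgue" "integrable lebesgue ?s"
    using L2_lebesgue_affine(1)[OF s(1), of 1 "- c"] lebesgue_integrable_real_affine[OF s(2), of 1 "- c"]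
    by (simp_all add: add.commute)
  have "\<F> ?s \<xi> = cis (- (c * \<xi>)) * \<F> s \<xi>" for \<xi>
  proof -
    have "\<F> ?s \<xi> = (LINT x|lebesgue. ?s (c + 1 * x) * cis (- ((c + 1 * x) * \<xi>)))"
      unfolding fourier_integral_cis by (subst lebesgue_integral_real_affine[of 1 _ c]) simp_all
    also have "\<dots> = (LINT x|lebesgue. cis (- (c * \<xi>)) * (s x * cis (- (x * \<xi>))))"
    proof (rule Bochner_Integration.integral_cong[OF refl])
      fix x
      have "cis (- ((c + 1 * x) * \<xi>)) = cis (- (c * \<xi>)) * cis (- (x * \<xi>))"
        by (simp add: cis_mult algebra_simps)
      then show "?s (c + 1 * x) * cis (- ((c + 1 * x) * \<xi>)) = cis (- (c * \<xi>)) * (s x * cis (- (x * \<xi>)))"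
        by simp
    qed
    finally show ?thesis unfolding fourier_integral_cis by simp
  qed
  then have 1: "\<F> ?s \<xi> - F \<xi> = cis (- (c * \<xi>)) * (\<F> s \<xi> - cis (c * \<xi>) * F \<xi>)" for \<xi>
    by (simp add: right_diff_distrib mult.assoc[symmetric] cis_mult)
  have "norm2 (\<lambda>\<xi>. \<F> s \<xi> - cis (c * \<xi>) * F \<xi>) = norm2 (\<lambda>\<xi>. \<F> ?s \<xi> - F \<xi>)"
    unfolding 1 by (simp add: L2_norm_def norm_mult)
  also have "\<dots> = sqrt (2 * pi) * norm2 (\<lambda>x. ?s x - f x)"
    by (rule is_fourierD(3)[OF fF s'])
  also have "norm2 (\<lambda>x. ?s x - f x) = norm2 (\<lambda>x. s x - f (x + c))"
    using L2_lebesgue_affine(2)[OF L2_diff[OF s'(1) f(1)], of 1 c] by (simp add: add.commute)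
  finally show "norm2 (\<lambda>\<xi>. \<F> s \<xi> - cis (c * \<xi>) * F \<xi>) = sqrt (2 * pi) * norm2 (\<lambda>x. s x - f (x + c))" .
qed

lemma is_fourier_dilation:
  assumes fF: "is_fourier f F" and c: "c > 0"
  shows "is_fourier (\<lambda>x. of_real (sqrt c) * f (c * x)) (\<lambda>\<xi>. F (\<xi> / c) / of_real (sqrt c))"
  unfolding is_fourier_def
proof (intro conjI ballI impI)
  note f = is_fourierD(1,2)[OF fF]
  have c0: "c \<noteq> 0" and c1: "1 / c \<noteq> 0" using c by auto
  show A: "(\<lambda>x. of_real (sqrt c) * f (c * x)) \<in> L2 lebesgue"
    using L2_scale[OF L2_lebesgue_affine(1)[OF f(1) c0, of 0]] by simp
  show B: "(\<lambda>\<xi>. F (\<xi> / c) / of_real (sqrt c)) \<in> L2 lebesgue"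
    using L2_scale[OF L2_lebesgue_affine(1)[OF f(2) c1, of 0], of "1 / of_real (sqrt c)"] by simp
  fix s :: "real \<Rightarrow> complex" assume s: "s \<in> L2 lebesgue" "integrable lebesgue s"
  let ?s = "\<lambda>x. s (x / c) / of_real (sqrt c)"
  have s': "?s \<in> L2 lebesgue" "integrable lebesgue ?s"
    using L2_scale[OF L2_lebesgue_affine(1)[OF s(1) c1, of 0], of "1 / of_real (sqrt c)"]
      lebesgue_integrable_real_affine[OF s(2) c1, of 0]
    by simp_all
  have sc: "complex_of_real (sqrt c) * of_real (sqrt c) = of_real c"
    using c by (simp flip: of_real_mult)
  have scnz: "complex_of_real (sqrt c) \<noteq> 0" using c by simp
  have "\<F> ?s \<xi> = of_real (sqrt c) * \<F> s (c * \<xi>)" for \<xi>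
  proof -
    have "\<F> ?s \<xi> = \<bar>c\<bar> *\<^sub>R (LINT x|lebesgue. ?s (0 + c * x) * cis (- ((0 + c * x) * \<xi>)))"
      unfolding fourier_integral_cis by (rule lebesgue_integral_real_affine[OF c0])
    also have "\<dots> = \<bar>c\<bar> *\<^sub>R (LINT x|lebesgue. (1 / of_real (sqrt c)) * (s x * cis (- (x * (c * \<xi>)))))"
      using c by (simp add: mult_ac)
    also have "\<dots> = (of_real c / of_real (sqrt c)) * \<F> s (c * \<xi>)"
      unfolding fourier_integral_cis Bochner_Integration.integral_mult_right_zero
      using c by (simp add: scaleR_conv_of_real)
    also have "complex_of_real c / of_real (sqrt c) = of_real (sqrt c)"
      unfolding sc[symmetric] using scnz by simp
    finally show ?thesis .
  qed
  then have 1: "\<F> s (0 + c * \<xi>) - F ((0 + c * \<xi>) / c) / of_real (sqrt c)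
      = (1 / of_real (sqrt c)) * (\<F> ?s \<xi> - F \<xi>)" for \<xi>
    using c scnz by (simp add: right_diff_distrib)
  let ?d = "\<lambda>\<xi>. \<F> s \<xi> - F (\<xi> / c) / of_real (sqrt c)"
  have d: "?d \<in> L2 lebesgue" by (intro L2_diff Plancherel_bound(1) s B)
  have "norm2 ?d / sqrt \<bar>c\<bar> = norm2 (\<lambda>\<xi>. ?d (0 + c * \<xi>))"
    by (rule L2_lebesgue_affine(2)[OF d c0, symmetric])
  also have "\<dots> = (1 / sqrt c) * norm2 (\<lambda>\<xi>. \<F> ?s \<xi> - F \<xi>)"
    unfolding 1 L2_norm_scale using c by (simp add: norm_divide)
  finally have I: "norm2 ?d = sqrt (2 * pi) * norm2 (\<lambda>x. ?s x - f x)"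
    using c unfolding is_fourierD(3)[OF fF s'] by simp
  let ?e = "\<lambda>x. s x - of_real (sqrt c) * f (c * x)"
  have e: "?e \<in> L2 lebesgue" by (intro L2_diff s A)
  have 2: "?e (0 + 1 / c * x) = of_real (sqrt c) * (?s x - f x)" for x
    using c scnz by (simp add: right_diff_distrib)
  have "norm2 ?e / sqrt \<bar>1 / c\<bar> = norm2 (\<lambda>x. ?e (0 + 1 / c * x))"
    by (rule L2_lebesgue_affine(2)[OF e c1, symmetric])
  also have "\<dots> = sqrt c * norm2 (\<lambda>x. ?s x - f x)"
    unfolding 2 L2_norm_scale using c by simp
  finally have "norm2 ?e = norm2 (\<lambda>x. ?s x - f x)"
    using c by (simp add: real_sqrt_divide)
  with I show "norm2 ?d = sqrt (2 * pi) * norm2 ?e" by simp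
qed

definition inverse_fourier :: "(real \<Rightarrow> complex) \<Rightarrow> real \<Rightarrow> complex" where
  "inverse_fourier g x = \<F> g (- x) / of_real (2 * pi)"

lemma inverse_fourier_L2:
  assumes g: "g \<in> L2 lebesgue" "integrable lebesgue g"
  shows "inverse_fourier g \<in> L2 lebesgue"
  using L2_scale[OF L2_lebesgue_affine(1)[OF Plancherel_bound(1)[OF g], of "-1" 0], of "1 / of_real (2 * pi)"]
  by (simp add: inverse_fourier_def[abs_def])

lemma fourier_duality_L1:
  assumes s: "s \<in> L2 lebesgue" "integrable lebesgue s" and g: "g \<in> L2 lebesgue" "integrable lebesgue g"
  shows "inner2 (\<F> s) g = of_real (2 * pi) * inner2 s (inverse_fourier g)"
proof -
  let ?k = "\<lambda>x \<xi>. s x * cis (- (x * \<xi>)) * cnj (g \<xi>)"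
  have sm: "s \<in> borel_measurable lebesgue" and gm: "g \<in> borel_measurable lebesgue" using s g by auto
  have "integrable (lebesgue \<Otimes>\<^sub>M lebesgue) (\<lambda>p. ?k (fst p) (snd p))"
  proof (rule lebesgue_pair.Fubini_integrable)
    show "(\<lambda>p. ?k (fst p) (snd p)) \<in> borel_measurable (lebesgue \<Otimes>\<^sub>M lebesgue)"
      by (intro borel_measurable_times borel_measurable_cis borel_measurable_cnj borel_measurable_uminus measurable_lebesgue_fst_snd
          measurable_compose[OF measurable_fst sm] measurable_compose[OF measurable_snd gm])
    have "(\<lambda>x. LINT y|lebesgue. norm (?k (fst (x, y)) (snd (x, y)))) = (\<lambda>x. norm (s x) * (LINT y|lebesgue. norm (g y)))"
      by (simp add: norm_mult)
    then show "integrable lebesgue (\<lambda>x. LINT y|lebesgue. norm (?k (fst (x, y)) (snd (x, y))))"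
      using s(2) by simp
    show "AE x in lebesgue. integrable lebesgue (\<lambda>y. ?k (fst (x, y)) (snd (x, y)))"
    proof (intro AE_I2)
      fix x :: real
      have "integrable lebesgue (\<lambda>y. s x * (cnj (g y) * cis (- (x * y))))"
        using integrable_mult_cis[OF integrable_cnj[OF g(2)] borel_measurable_lebesgue_linear(3)[of x]] by simp
      then show "integrable lebesgue (\<lambda>y. ?k (fst (x, y)) (snd (x, y)))"
        by (simp add: mult_ac)
    qed
  qed
  then have "(LINT \<xi>|lebesgue. LINT x|lebesgue. ?k x \<xi>) = (LINT x|lebesgue. LINT \<xi>|lebesgue. ?k x \<xi>)"
    by (intro lebesgue_pair.Fubini_integral) (simp only: case_prod_unfold)
  moreover have "(LINT \<xi>|lebesgue. LINT x|lebesgue. ?k x \<xi>) = inner2 (\<F> s) g"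
    unfolding L2_inner_def fourier_integral_cis by simp
  moreover have "(LINT x|lebesgue. LINT \<xi>|lebesgue. ?k x \<xi>) = of_real (2 * pi) * inner2 s (inverse_fourier g)"
  proof -
    have "(LINT \<xi>|lebesgue. ?k x \<xi>) = of_real (2 * pi) * (s x * cnj (inverse_fourier g x))" for x
    proof -
      have "(LINT \<xi>|lebesgue. ?k x \<xi>) = (LINT \<xi>|lebesgue. s x * cnj (g \<xi> * cis (- (\<xi> * (- x)))))"
        by (simp add: cis_cnj mult_ac)
      also have "\<dots> = s x * cnj (\<F> g (- x))"
        unfolding fourier_integral_cis by (simp only: Bochner_Integration.integral_mult_right_zero Bochner_Integration.integral_cnj)
      finally show ?thesis by (simp add: inverse_fourier_def)
    qed
    then show ?thesis
      unfolding L2_inner_def by (simp only: Bochner_Integration.integral_mult_right_zero)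
  qed
  ultimately show ?thesis by simp
qed

text \<open>This replaces the inversion theorem: it determines all inner products with the function whose
  transform is \<open>g\<close>, although that function need not be integrable. For integrable \<open>f\<close> it is Fubini's
  theorem, and both sides are continuous in \<open>f\<close>.\<close>
lemma fourier_duality:
  assumes fF: "is_fourier f F" and g: "g \<in> L2 lebesgue" "integrable lebesgue g"
  shows "inner2 F g = of_real (2 * pi) * inner2 f (inverse_fourier g)"
proof (rule LIMSEQ_unique)
  note f = is_fourierD(1,2)[OF fF] and i = inverse_fourier_L2[OF g]
  let ?t = "\<lambda>n. truncate n f"
  note t = truncate_L2[OF f(1)] and ti = Plancherel_truncate(1)[OF f(1)]
  have z: "(\<lambda>n::nat. norm2 (\<lambda>x. h x - h x)) \<longlonglongrightarrow> 0" for h by (simp add: L2_norm_def)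
  show "(\<lambda>n. inner2 (\<F> (?t n)) g) \<longlonglongrightarrow> inner2 F g"
    by (rule tendsto_L2_inner[OF Plancherel_bound(1)[OF t ti] f(2)
          is_fourier_tendsto[OF fF t ti truncate_tendsto[OF f(1)]] g(1) g(1) z])
  show "(\<lambda>n. inner2 (\<F> (?t n)) g) \<longlonglongrightarrow> of_real (2 * pi) * inner2 f (inverse_fourier g)"
    unfolding fourier_duality_L1[OF t ti g]
    by (intro tendsto_mult tendsto_const tendsto_L2_inner[OF t f(1) truncate_tendsto[OF f(1)] i i z])
qed

section \<open>The core space and its generators\<close>
definition wavelet_fn :: "(real \<Rightarrow> complex) \<Rightarrow> int \<Rightarrow> int \<Rightarrow> real \<Rightarrow> complex" where
  "wavelet_fn \<psi> j k x = of_real (2 powr (of_int j / 2)) * \<psi> (2 powi j * x + of_int k)"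

definition shift :: "int \<Rightarrow> (real \<Rightarrow> complex) \<Rightarrow> real \<Rightarrow> complex" where
  "shift l f x = f (x + of_int l)"

lemma wavelet_basis:
  assumes "wavelet \<psi>"
  shows "\<psi> \<in> L2 lebesgue" and "L2_orthonormal_basis lebesgue (\<lambda>(j, k). wavelet_fn \<psi> j k)"
  using assms by (simp_all add: wavelet_def wavelet_fn_def[abs_def])

lemma translation_eq_shift: "translation = shift 1"
  by (simp add: fun_eq_iff translation_def shift_def)

lemma shift_shift: "shift a (shift b f) = shift (a + b) f"
  by (simp add: shift_def fun_eq_iff add.assoc)

lemma shift_0: "shift 0 f = f"
  by (simp add: shift_def fun_eq_iff)

lemma inv_translation: "inv translation = shift (-1)"
  by (rule inv_equality) (simp_all add: translation_eq_shift shift_shift shift_0)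

lemma shift_pow: "(shift a ^^ n) f = shift (int n * a) f"
  by (induction n) (simp_all add: shift_0 shift_shift algebra_simps)

lemma int_iterate_translation: "int_iterate translation l f = shift l f"
  unfolding int_iterate_def inv_translation unfolding translation_eq_shift
  by (auto simp: shift_pow)

lemma inv_dilation: "inv dilation = (\<lambda>f x. f (x / 2) / of_real (sqrt 2))"
  by (rule inv_equality) (simp_all add: dilation_def fun_eq_iff)

lemma inv_dilation_pow: "(inv dilation ^^ n) f = (\<lambda>x. f (x / 2 ^ n) / of_real (sqrt 2) ^ n)"
  by (induction n) (simp_all add: inv_dilation fun_eq_iff)

lemma powr_half_int: "2 powr (of_int (- int n) / 2) = 1 / sqrt 2 ^ n"
proof -
  have "2 powr (of_int (- int n) / 2) = (2 powr (1/2)) powr (- real n)"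
    by (simp add: powr_powr)
  also have "\<dots> = inverse (sqrt 2 powr real n)"
    by (simp add: powr_half_sqrt powr_minus)
  also have "\<dots> = 1 / sqrt 2 ^ n"
    by (simp add: powr_realpow inverse_eq_divide)
  finally show ?thesis .
qed

lemma int_iterate_dilation_neg:
  assumes "n < 0"
  shows "int_iterate dilation n (int_iterate translation l \<psi>) = wavelet_fn \<psi> n l"
proof -
  define p where "p = nat (- n)"
  have n: "n = - int p" using assms by (simp add: p_def)
  have "int_iterate dilation n f = (\<lambda>x. f (x / 2 ^ p) / of_real (sqrt 2) ^ p)" for f
    using assms by (simp add: int_iterate_def inv_dilation_pow p_def)
  then have "int_iterate dilation n (int_iterate translation l \<psi>) x = wavelet_fn \<psi> n l x" for x
    unfolding int_iterate_translation wavelet_fn_def n powr_half_int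
    by (simp add: shift_def power_int_minus field_simps)
  then show ?thesis by blast
qed

text \<open>The indices of the wavelets that span the core space.\<close>
definition coarse :: "(int \<times> int) set" where
  "coarse = {(j, k). j < 0}"

lemma core_space_eq_span: "core_space \<psi> = L2_closed_span lebesgue ((\<lambda>(j, k). wavelet_fn \<psi> j k) ` coarse)"
proof -
  have "{int_iterate dilation n (int_iterate translation l \<psi>) | n l. n < 0} = (\<lambda>(j, k). wavelet_fn \<psi> j k) ` coarse"
    by (force simp: coarse_def int_iterate_dilation_neg)
  then show ?thesis by (simp add: core_space_def)
qed

lemma core_space_iff:
  assumes "wavelet \<psi>"
  shows "f \<in> core_space \<psi> \<longleftrightarrow> f \<in> L2 lebesgue \<and> (\<forall>j k. 0 \<le> j \<longrightarrow> inner2 f (wavelet_fn \<psi> j k) = 0)"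
  unfolding core_space_eq_span L2_closed_span_part_of_basis[OF wavelet_basis(2)[OF assms]]
  by (auto simp: coarse_def)

lemma shift_L2: "f \<in> L2 lebesgue \<Longrightarrow> shift l f \<in> L2 lebesgue"
  using L2_lebesgue_affine(1)[of f 1 "of_int l"] by (simp add: shift_def[abs_def] add.commute)

lemma L2_inner_shift: "inner2 (shift l f) g = inner2 f (shift (- l) g)"
  unfolding L2_inner_def shift_def
  by (subst lebesgue_integral_real_affine[of 1 "\<lambda>x. f x * cnj (g (x + of_int (- l)))" "of_int l"])
    (simp_all add: add.commute)

text \<open>At scales \<open>j \<ge> 0\<close> an integer translation permutes the wavelets, so the orthogonal complement
  of the core space, and hence the core space itself, is invariant.\<close>

lemma shift_core_space:
  assumes w: "wavelet \<psi>" and f: "f \<in> core_space \<psi>"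
  shows "shift l f \<in> core_space \<psi>"
  unfolding core_space_iff[OF w]
proof (intro conjI allI impI)
  from f have f2: "f \<in> L2 lebesgue" and z: "\<And>j k. 0 \<le> j \<Longrightarrow> inner2 f (wavelet_fn \<psi> j k) = 0"
    by (auto simp: core_space_iff[OF w])
  show "shift l f \<in> L2 lebesgue" by (rule shift_L2[OF f2])
  fix j k :: int assume j: "0 \<le> j"
  have "shift (- l) (wavelet_fn \<psi> j k) = wavelet_fn \<psi> j (k - 2 ^ nat j * l)"
  proof
    fix x :: real
    have "(2 :: real) powi j = 2 ^ nat j" using j by (simp add: power_int_def)
    then have "2 powi j * (x + of_int (- l)) + of_int k = 2 powi j * x + of_int (k - 2 ^ nat j * l)"
      by (simp add: algebra_simps)
    then show "shift (- l) (wavelet_fn \<psi> j k) x = wavelet_fn \<psi> j (k - 2 ^ nat j * l) x"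
      by (simp only: shift_def wavelet_fn_def)
  qed
  then show "inner2 (shift l f) (wavelet_fn \<psi> j k) = 0"
    using z[OF j] by (simp add: L2_inner_shift)
qed

definition level_set :: "(real \<Rightarrow> enat) \<Rightarrow> nat \<Rightarrow> real set" where
  "level_set m n = {\<xi> \<in> {-pi..pi}. enat (Suc n) \<le> m \<xi>}"

lemma level_measure_eq: "level_measure m n = lebesgue_on (level_set m n)"
  by (simp add: level_measure_def level_set_def)

lemma level_set_measurable:
  assumes "m \<in> lebesgue_on {-pi..pi} \<rightarrow>\<^sub>M count_space UNIV"
  shows "level_set m n \<in> sets lebesgue"
proof -
  have "m -` {y. enat (Suc n) \<le> y} \<inter> space (lebesgue_on {-pi..pi}) \<in> sets (lebesgue_on {-pi..pi})"
    by (rule measurable_sets[OF assms]) simp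
  also have "m -` {y. enat (Suc n) \<le> y} \<inter> space (lebesgue_on {-pi..pi}) = level_set m n"
    by (auto simp: level_set_def)
  finally show ?thesis
    by (subst (asm) sets_restrict_space_iff) auto
qed

lemma L2_lebesgue_on_iff:
  assumes S: "S \<in> sets lebesgue"
  shows "f \<in> L2 (lebesgue_on S) \<longleftrightarrow> (\<lambda>x. indicator S x * f x) \<in> L2 lebesgue"
proof -
  have "indicator S x *\<^sub>R (cmod (f x))\<^sup>2 = (cmod (indicator S x * f x))\<^sup>2" for x
    by (simp add: indicator_def)
  moreover have "indicator S x *\<^sub>R f x = indicator S x * f x" for x
    by (simp add: indicator_def)
  ultimately show ?thesis
    using S by (simp add: L2_def borel_measurable_restrict_space_iff integrable_restrict_space)
qed

lemma L2_inner_lebesgue_on: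
  assumes S: "S \<in> sets lebesgue"
  shows "L2_inner (lebesgue_on S) f g = (LINT x|lebesgue. indicator S x * (f x * cnj (g x)))"
proof -
  have "indicator S x *\<^sub>R (f x * cnj (g x)) = indicator S x * (f x * cnj (g x))" for x
    by (simp add: indicator_def)
  then show ?thesis
    using S by (simp add: L2_inner_def integral_restrict_space)
qed

text \<open>The vector \<open>v n\<close> corresponds to the constant \<open>1 / sqrt (2 \<pi>)\<close> on the \<open>n\<close>-th level set. The inner
  products of \<open>f\<close> with its translates are therefore the Fourier coefficients of the \<open>n\<close>-th component
  of \<open>f\<close>, and Parseval's identity recovers the norm of each component.\<close>

lemma core_generators:
  assumes w: "wavelet \<psi>" and cm: "core_multiplicity \<psi> m"
  obtains v :: "nat \<Rightarrow> real \<Rightarrow> complex"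
  where "\<And>n. v n \<in> core_space \<psi>"
    "\<And>n l. inner2 (shift l (v n)) (v n)
      = (LINT \<xi>|lebesgue. indicator (level_set m n) \<xi> * cis (of_int l * \<xi>)) / of_real (2 * pi)"
    "\<And>f. f \<in> core_space \<psi> \<Longrightarrow>
      (\<Sum>n. coeff_energy (\<lambda>l. inner2 f (shift l (v n))))
      = ennreal ((norm2 f)\<^sup>2)"
proof -
  let ?V = "core_space \<psi>" and ?N = "level_measure m" and ?E = "level_set m"
  from cm obtain U where mm: "m \<in> lebesgue_on {-pi..pi} \<rightarrow>\<^sub>M count_space UNIV"
    and uni: "L2_unitary lebesgue ?V ?N U"
    and intertwine: "\<And>f. f \<in> ?V \<Longrightarrow> L2_sum_eq ?N (U (translation f)) (\<lambda>n \<xi>. cis \<xi> * U f n \<xi>)"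
    unfolding core_multiplicity_def by blast
  have U_sum: "\<And>f. f \<in> ?V \<Longrightarrow> U f \<in> L2_sum ?N"
    and U_inner: "\<And>f g. f \<in> ?V \<Longrightarrow> g \<in> ?V \<Longrightarrow> L2_sum_inner ?N (U f) (U g) = inner2 f g"
    and U_surj: "\<And>h. h \<in> L2_sum ?N \<Longrightarrow> \<exists>f\<in>?V. L2_sum_eq ?N (U f) h"
    using uni unfolding L2_unitary_def by blast+
  note E[measurable] = level_set_measurable[OF mm]
  have Efin: "emeasure lebesgue (?E n) < \<infinity>" for n
  proof -
    have "emeasure lebesgue (?E n) \<le> emeasure lebesgue {-pi..pi}"
      by (rule emeasure_mono) (auto simp: level_set_def)
    then show ?thesis by (rule le_less_trans) simp
  qed
  have U_L2: "U f n \<in> L2 (?N n)" if "f \<in> ?V" for f n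
    using U_sum[OF that] by (auto simp: L2_sum_def)

  \<comment> \<open>With this constant the exponentials \<open>c e\<^sup>i\<^sup>l\<^sup>\<xi>\<close> are orthonormal on a period.\<close>
  define c where "c = complex_of_real (1 / sqrt (2 * pi))"
  have cc: "c * c = 1 / of_real (2 * pi)" and cnjc: "cnj c = c"
    by (simp_all add: c_def flip: of_real_mult)
  have "cmod c = 1 / sqrt (2 * pi)"
    unfolding c_def norm_of_real by simp
  then have normc: "(cmod c)\<^sup>2 = 1 / (2 * pi)"
    by (simp only: power_divide real_sqrt_pow2 power_one) simp
  define u where "u n i \<xi> = (if i = n then c else 0)" for n i :: nat and \<xi> :: real
  have u_L2: "u n i \<in> L2 (?N i)" for n i
  proof -
    have "(\<lambda>\<xi>. indicator (?E i) \<xi> * u n i \<xi>) \<in> L2 lebesgue"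
    proof -
      have "integrable lebesgue (\<lambda>\<xi>. (cmod (u n i 0))\<^sup>2 * indicator (?E i) \<xi>)"
        using E[of i] Efin[of i] by simp
      moreover have "(cmod (indicator (?E i) \<xi> * u n i \<xi>))\<^sup>2 = (cmod (u n i 0))\<^sup>2 * indicator (?E i) \<xi>" for \<xi>
        by (simp add: indicator_def u_def)
      moreover have "(\<lambda>\<xi>. indicator (?E i) \<xi> * u n i \<xi>) \<in> borel_measurable lebesgue"
        unfolding u_def by (intro borel_measurable_times borel_measurable_indicator E borel_measurable_const)
      ultimately show ?thesis by (simp add: L2_def)
    qed
    then show ?thesis unfolding level_measure_eq by (simp add: L2_lebesgue_on_iff[OF E])
  qed
  have "u n \<in> L2_sum ?N" for n
  proof -
    have "L2_norm (?N i) (u n i) = 0" if "i \<notin> {n}" for i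
      using that by (simp add: u_def[abs_def] L2_norm_def)
    then have "summable (\<lambda>i. (L2_norm (?N i) (u n i))\<^sup>2)"
      by (intro summable_finite[of "{n}"]) auto
    then show ?thesis using u_L2 by (simp add: L2_sum_def)
  qed
  then have "\<forall>n. \<exists>f. f \<in> ?V \<and> L2_sum_eq ?N (U f) (u n)" using U_surj by blast
  then obtain v where v: "\<And>n. v n \<in> ?V" and Uv: "\<And>n. L2_sum_eq ?N (U (v n)) (u n)" by metis

  have U_step: "AE \<xi> in ?N n. U (shift (l + 1) f) n \<xi> = cis \<xi> * U (shift l f) n \<xi>" if f: "f \<in> ?V" for f n l
    using intertwine[OF shift_core_space[OF w f, of l]]
    by (simp add: translation_eq_shift shift_shift L2_sum_eq_def add.commute)
  have U_shift: "AE \<xi> in ?N n. U (shift l f) n \<xi> = cis (of_int l * \<xi>) * U f n \<xi>" if f: "f \<in> ?V" for f n l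
  proof (induction l rule: int_induct[where k=0])
    case base
    then show ?case by (simp add: shift_0)
  next
    case (step1 i)
    from step1(2) U_step[OF f, where n=n and l=i] show ?case
    proof eventually_elim
      case (elim \<xi>)
      have "cis (of_int (i + 1) * \<xi>) = cis \<xi> * cis (of_int i * \<xi>)"
        by (simp add: cis_mult algebra_simps)
      then show ?case using elim by (simp add: mult.assoc)
    qed
  next
    case (step2 i)
    from step2(2) U_step[OF f, where n=n and l="i - 1"] show ?case
    proof eventually_elim
      case (elim \<xi>)
      have c1: "cis (- \<xi>) * cis \<xi> = 1" by (simp add: cis_mult)
      have "cis (of_int (i - 1) * \<xi>) = cis (- \<xi>) * cis (of_int i * \<xi>)"
        by (simp add: cis_mult algebra_simps)
      then have "cis (of_int (i - 1) * \<xi>) * U f n \<xi> = cis (- \<xi>) * U (shift i f) n \<xi>"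
        using elim by (simp add: mult.assoc)
      also have "\<dots> = (cis (- \<xi>) * cis \<xi>) * U (shift (i - 1) f) n \<xi>"
        using elim by (simp add: mult.assoc)
      finally show ?case by (simp only: c1 mult_1)
    qed
  qed
  have Usv: "AE \<xi> in ?N i. U (shift l (v n)) i \<xi> = cis (of_int l * \<xi>) * u n i \<xi>" for i n l
  proof -
    have "AE \<xi> in ?N i. U (v n) i \<xi> = u n i \<xi>" using Uv[of n] by (simp add: L2_sum_eq_def)
    then show ?thesis using U_shift[OF v[of n], where n=i and l=l] by eventually_elim simp
  qed
  have u_meas: "(\<lambda>\<xi>. cis (of_int l * \<xi>) * u n i \<xi>) \<in> borel_measurable (?N i)" for l n i
  proof -
    have "(\<lambda>\<xi>. cis (of_int l * \<xi>) * u n i \<xi>) \<in> borel_measurable lebesgue"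
      unfolding u_def by (intro borel_measurable_times borel_measurable_cis borel_measurable_lebesgue_linear borel_measurable_const)
    then show ?thesis unfolding level_measure_eq by (rule measurable_restrict_space1)
  qed

  have coef: "inner2 f (shift l (v n))
      = c * (LINT \<xi>|lebesgue. indicator (?E n) \<xi> * (U f n \<xi> * cis (- (of_int l * \<xi>))))"
    if f: "f \<in> ?V" for f l n
  proof -
    have each: "L2_inner (?N i) (U f i) (U (shift l (v n)) i) = L2_inner (?N i) (U f i) (\<lambda>\<xi>. cis (of_int l * \<xi>) * u n i \<xi>)" for i
      unfolding L2_inner_def
    proof (rule integral_cong_AE)
      have a: "U f i \<in> borel_measurable (?N i)" "U (shift l (v n)) i \<in> borel_measurable (?N i)"
        by (intro L2_measurable U_L2 f shift_core_space[OF w v])+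
      show "(\<lambda>\<xi>. U f i \<xi> * cnj (U (shift l (v n)) i \<xi>)) \<in> borel_measurable (?N i)"
        "(\<lambda>\<xi>. U f i \<xi> * cnj (cis (of_int l * \<xi>) * u n i \<xi>)) \<in> borel_measurable (?N i)"
        by (intro borel_measurable_times borel_measurable_cnj a u_meas)+
      show "AE \<xi> in ?N i. U f i \<xi> * cnj (U (shift l (v n)) i \<xi>) = U f i \<xi> * cnj (cis (of_int l * \<xi>) * u n i \<xi>)"
        using Usv[where i=i and l=l and n=n] by eventually_elim simp
    qed
    have "inner2 f (shift l (v n)) = L2_sum_inner ?N (U f) (U (shift l (v n)))"
      by (rule U_inner[OF f shift_core_space[OF w v], symmetric])
    also have "\<dots> = (\<Sum>i. L2_inner (?N i) (U f i) (\<lambda>\<xi>. cis (of_int l * \<xi>) * u n i \<xi>))"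
      unfolding L2_sum_inner_def each ..
    also have "\<dots> = (\<Sum>i\<in>{n}. L2_inner (?N i) (U f i) (\<lambda>\<xi>. cis (of_int l * \<xi>) * u n i \<xi>))"
      by (rule suminf_finite) (simp_all add: u_def L2_inner_def)
    also have "\<dots> = (LINT \<xi>|lebesgue. indicator (?E n) \<xi> * (U f n \<xi> * cnj (cis (of_int l * \<xi>) * c)))"
      unfolding level_measure_eq by (simp add: L2_inner_lebesgue_on[OF E] u_def)
    also have "\<dots> = (LINT \<xi>|lebesgue. c * (indicator (?E n) \<xi> * (U f n \<xi> * cis (- (of_int l * \<xi>)))))"
      by (intro Bochner_Integration.integral_cong refl) (simp add: cis_cnj cnjc mult_ac)
    finally show ?thesis by (simp only: Bochner_Integration.integral_mult_right_zero)
  qed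

  have gram: "inner2 (shift l (v n)) (v n)
      = (LINT \<xi>|lebesgue. indicator (?E n) \<xi> * cis (of_int l * \<xi>)) / of_real (2 * pi)" for n l
  proof -
    have f: "shift l (v n) \<in> ?V" by (rule shift_core_space[OF w v])
    have a: "U (shift l (v n)) n \<in> borel_measurable (?N n)" by (intro L2_measurable U_L2 f)
    have "inner2 (shift l (v n)) (v n) = c * (LINT \<xi>|lebesgue. indicator (?E n) \<xi> * (U (shift l (v n)) n \<xi> * cis (- (of_int 0 * \<xi>))))"
      using coef[OF f, of 0 n] by (simp only: shift_0)
    also have "(LINT \<xi>|lebesgue. indicator (?E n) \<xi> * (U (shift l (v n)) n \<xi> * cis (- (of_int 0 * \<xi>))))
        = (LINT \<xi>|lebesgue. indicator (?E n) \<xi> * (cis (of_int l * \<xi>) * c))"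
    proof (rule integral_cong_AE)
      have ae: "AE \<xi> in lebesgue. \<xi> \<in> ?E n \<longrightarrow> U (shift l (v n)) n \<xi> = cis (of_int l * \<xi>) * u n n \<xi>"
        using Usv[where i=n and l=l and n=n] E[of n] unfolding level_measure_eq by (simp add: AE_restrict_space_iff)
      show "AE \<xi> in lebesgue. indicator (?E n) \<xi> * (U (shift l (v n)) n \<xi> * cis (- (of_int 0 * \<xi>)))
          = indicator (?E n) \<xi> * (cis (of_int l * \<xi>) * c)"
        using ae by eventually_elim (auto simp: indicator_def u_def)
      have "(\<lambda>\<xi>. indicator (?E n) \<xi> * U (shift l (v n)) n \<xi>) \<in> borel_measurable lebesgue"
        using U_L2[OF f, of n] unfolding level_measure_eq
        by (simp only: L2_lebesgue_on_iff[OF E] L2_measurable)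
      then show "(\<lambda>\<xi>. indicator (?E n) \<xi> * (U (shift l (v n)) n \<xi> * cis (- (of_int 0 * \<xi>)))) \<in> borel_measurable lebesgue"
        by simp
      show "(\<lambda>\<xi>. indicator (?E n) \<xi> * (cis (of_int l * \<xi>) * c)) \<in> borel_measurable lebesgue"
        by (intro borel_measurable_times borel_measurable_indicator E borel_measurable_const borel_measurable_cis borel_measurable_lebesgue_linear)
    qed
    also have "\<dots> = c * (LINT \<xi>|lebesgue. indicator (?E n) \<xi> * cis (of_int l * \<xi>))"
      by (simp only: Bochner_Integration.integral_mult_right_zero[symmetric] mult_ac)
    also have "c * (c * (LINT \<xi>|lebesgue. indicator (?E n) \<xi> * cis (of_int l * \<xi>)))
        = (LINT \<xi>|lebesgue. indicator (?E n) \<xi> * cis (of_int l * \<xi>)) / of_real (2 * pi)"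
      unfolding mult.assoc[symmetric] cc by simp
    finally show ?thesis .
  qed

  have level_sum: "coeff_energy (\<lambda>l. inner2 f (shift l (v n)))
      = ennreal ((L2_norm (?N n) (U f n))\<^sup>2)" if f: "f \<in> ?V" for f n
  proof -
    \<comment> \<open>Level sets may contain the endpoint \<open>\<pi>\<close>, which a half-open period excludes.\<close>
    let ?g = "\<lambda>\<xi>. indicator (?E n \<inter> {-pi..<pi}) \<xi> * U f n \<xi>"
    have h2: "(\<lambda>\<xi>. indicator (?E n) \<xi> * U f n \<xi>) \<in> L2 lebesgue"
      using U_L2[OF f, of n] unfolding level_measure_eq by (simp only: L2_lebesgue_on_iff[OF E])
    have pos: "0 \<le> 1 / (2 * pi)" by simp
    have eq: "?g \<xi> = indicator {-pi..<pi} \<xi> * (indicator (?E n) \<xi> * U f n \<xi>)" for \<xi>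
      by (cases "\<xi> \<in> ?E n"; cases "\<xi> \<in> {-pi..<pi}") auto
    have g2: "?g \<in> L2 lebesgue"
      by (rule L2_dominated[OF _ h2], unfold eq, intro borel_measurable_times borel_measurable_indicator L2_measurable[OF h2])
        (auto simp: indicator_def)
    have pi0: "AE \<xi> in lebesgue. \<xi> \<notin> {pi}"
      by (rule AE_not_in) (simp add: negligible_iff_null_sets[symmetric])
    then have ae: "AE \<xi> in lebesgue. indicator (?E n) \<xi> * U f n \<xi> = ?g \<xi>"
      by eventually_elim (auto simp: indicator_def level_set_def)
    have "inner2 f (shift l (v n)) = c * (LINT \<xi>|lebesgue. ?g \<xi> * cis (- (of_int l * 1 * \<xi>)))" for l
    proof -
      have "(LINT \<xi>|lebesgue. indicator (?E n) \<xi> * (U f n \<xi> * cis (- (of_int l * \<xi>))))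
          = (LINT \<xi>|lebesgue. ?g \<xi> * cis (- (of_int l * 1 * \<xi>)))"
      proof (rule integral_cong_AE)
        have "(\<lambda>\<xi>. (indicator (?E n) \<xi> * U f n \<xi>) * cis (- (of_int l * \<xi>))) \<in> borel_measurable lebesgue"
          by (intro borel_measurable_times[OF L2_measurable[OF h2]] borel_measurable_cis borel_measurable_lebesgue_linear)
        then show "(\<lambda>\<xi>. indicator (?E n) \<xi> * (U f n \<xi> * cis (- (of_int l * \<xi>)))) \<in> borel_measurable lebesgue"
          by (simp only: mult.assoc)
        show "(\<lambda>\<xi>. ?g \<xi> * cis (- (of_int l * 1 * \<xi>))) \<in> borel_measurable lebesgue"
          by (intro borel_measurable_times[OF L2_measurable[OF g2]] borel_measurable_cis borel_measurable_lebesgue_linear)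
        show "AE \<xi> in lebesgue. indicator (?E n) \<xi> * (U f n \<xi> * cis (- (of_int l * \<xi>))) = ?g \<xi> * cis (- (of_int l * 1 * \<xi>))"
          using ae
        proof eventually_elim
          case (elim \<xi>)
          then show ?case by (simp only: mult.assoc[symmetric] mult_1_right)
        qed
      qed
      then show ?thesis unfolding coef[OF f] by (simp only:)
    qed
    then have "coeff_energy (\<lambda>l. inner2 f (shift l (v n)))
        = (\<integral>\<^sup>+l. ennreal (1 / (2 * pi)) * ennreal ((cmod (LINT \<xi>|lebesgue. ?g \<xi> * cis (- (of_int l * 1 * \<xi>))))\<^sup>2) \<partial>count_space (UNIV :: int set))"
      by (simp only: norm_mult power_mult_distrib normc ennreal_mult[OF pos zero_le_power2])
    also have "\<dots> = ennreal (1 / (2 * pi)) * (ennreal (2 * pi / 1) * (\<integral>\<^sup>+\<xi>. ennreal ((cmod (?g \<xi>))\<^sup>2) \<partial>lebesgue))"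
    proof (subst nn_integral_cmult)
      show "ennreal (1 / (2 * pi)) * coeff_energy (\<lambda>l. LINT \<xi>|lebesgue. ?g \<xi> * cis (- (of_int l * 1 * \<xi>)))
        = ennreal (1 / (2 * pi)) * (ennreal (2 * pi / 1) * (\<integral>\<^sup>+\<xi>. ennreal ((cmod (?g \<xi>))\<^sup>2) \<partial>lebesgue))"
        by (subst Parseval[OF zero_less_one g2, of "- pi"]) (auto simp: indicator_def)
    qed simp
    also have "\<dots> = (\<integral>\<^sup>+\<xi>. ennreal ((cmod (?g \<xi>))\<^sup>2) \<partial>lebesgue)"
      by (simp add: mult.assoc[symmetric] ennreal_mult[symmetric])
    also have "\<dots> = (\<integral>\<^sup>+\<xi>. ennreal ((cmod (indicator (?E n) \<xi> * U f n \<xi>))\<^sup>2) \<partial>lebesgue)"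
    proof (rule nn_integral_cong_AE)
      show "AE \<xi> in lebesgue. ennreal ((cmod (?g \<xi>))\<^sup>2) = ennreal ((cmod (indicator (?E n) \<xi> * U f n \<xi>))\<^sup>2)"
        using ae by eventually_elim (simp only:)
    qed
    also have "\<dots> = (\<integral>\<^sup>+\<xi>. ennreal ((cmod (U f n \<xi>))\<^sup>2) * indicator (?E n) \<xi> \<partial>lebesgue)"
      by (intro nn_integral_cong) (simp add: indicator_def)
    also have "\<dots> = (\<integral>\<^sup>+\<xi>. ennreal ((cmod (U f n \<xi>))\<^sup>2) \<partial>(?N n))"
      unfolding level_measure_eq using E[of n] by (simp add: nn_integral_restrict_space)
    also have "\<dots> = ennreal ((L2_norm (?N n) (U f n))\<^sup>2)"
      by (rule nn_integral_L2_norm[OF U_L2[OF f]])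
    finally show ?thesis .
  qed
  have total: "(\<Sum>n. coeff_energy (\<lambda>l. inner2 f (shift l (v n))))
      = ennreal ((norm2 f)\<^sup>2)" if f: "f \<in> ?V" for f
  proof -
    have s: "summable (\<lambda>n. (L2_norm (?N n) (U f n))\<^sup>2)"
      using U_sum[OF f] by (simp add: L2_sum_def)
    have f2: "f \<in> L2 lebesgue" using f by (simp add: core_space_iff[OF w])
    have "complex_of_real ((norm2 f)\<^sup>2) = (\<Sum>n. complex_of_real ((L2_norm (?N n) (U f n))\<^sup>2))"
      using U_inner[OF f f] unfolding L2_inner_self[OF f2] L2_sum_inner_def L2_inner_self[OF U_L2[OF f]] by (rule sym)
    also have "\<dots> = complex_of_real (\<Sum>n. (L2_norm (?N n) (U f n))\<^sup>2)"
      by (rule suminf_of_real[OF s, symmetric])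
    finally have "(norm2 f)\<^sup>2 = (\<Sum>n. (L2_norm (?N n) (U f n))\<^sup>2)"
      unfolding of_real_eq_iff .
    then show ?thesis
      unfolding level_sum[OF f] using s by (simp only:) (subst suminf_ennreal2, auto)
  qed
  show ?thesis by (rule that[OF v gram total])
qed

text \<open>Both sides are the square of the norm of the projection of \<open>f\<close> to the core space.\<close>

lemma core_frame_identity:
  assumes w: "wavelet \<psi>" and v: "\<And>n. v n \<in> core_space \<psi>"
    and frame: "\<And>f. f \<in> core_space \<psi> \<Longrightarrow>
      (\<Sum>n. coeff_energy (\<lambda>l. inner2 f (shift l (v n))))
      = ennreal ((norm2 f)\<^sup>2)"
    and f: "f \<in> L2 lebesgue"
  shows "(\<Sum>n. coeff_energy (\<lambda>l. inner2 f (shift l (v n))))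
    = (\<Sum>p. coeff_energy (\<lambda>k. inner2 f (wavelet_fn \<psi> (- int (Suc p)) k)))"
proof -
  let ?e = "\<lambda>(j, k). wavelet_fn \<psi> j k"
  from wavelet_basis(2)[OF w] have e: "\<And>i. ?e i \<in> L2 lebesgue"
    and on: "\<And>i j. inner2 (?e i) (?e j) = (if i = j then 1 else 0)"
    unfolding L2_orthonormal_basis_def by blast+
  let ?b = "\<lambda>(p::nat, k::int). (- int (Suc p), k)"
  have b: "bij_betw ?b UNIV coarse"
  proof (rule bij_betwI')
    fix y :: "int \<times> int" assume "y \<in> coarse"
    then obtain j k where "y = (j, k)" "j < 0" by (auto simp: coarse_def)
    then show "\<exists>x\<in>UNIV. y = ?b x" by (intro bexI[of _ "(nat (- j - 1), k)"]) auto
  qed (auto simp: coarse_def)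
  have "infinite coarse" using bij_betw_finite[OF b] by (simp add: finite_prod)
  then obtain h where h: "h \<in> L2_closed_span lebesgue (?e ` coarse)"
    "\<And>i. i \<in> coarse \<Longrightarrow> inner2 h (?e i) = inner2 f (?e i)"
    "(\<integral>\<^sup>+i. ennreal ((cmod (inner2 f (?e i)))\<^sup>2) \<partial>count_space coarse) = ennreal ((norm2 h)\<^sup>2)"
    using L2_orthonormal_projection[of coarse ?e lebesgue f, OF _ _ e on f] by blast
  have hV: "h \<in> core_space \<psi>" using h(1) by (simp add: core_space_eq_span)
  have h2: "h \<in> L2 lebesgue" using hV by (simp add: core_space_iff[OF w])
  have same: "inner2 f (shift l (v n)) = inner2 h (shift l (v n))" for l n
  proof -
    have s: "shift l (v n) \<in> core_space \<psi>" by (rule shift_core_space[OF w v])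
    then have s2: "shift l (v n) \<in> L2 lebesgue" by (simp add: core_space_iff[OF w])
    have "inner2 (shift l (v n)) (\<lambda>x. f x - h x) = 0"
    proof (rule L2_closed_span_orthogonal)
      show "shift l (v n) \<in> L2_closed_span lebesgue (?e ` coarse)" using s by (simp add: core_space_eq_span)
      show "?e ` coarse \<subseteq> L2 lebesgue" using e by blast
      show "(\<lambda>x. f x - h x) \<in> L2 lebesgue" by (rule L2_diff[OF f h2])
      fix b assume "b \<in> ?e ` coarse"
      then obtain i where i: "i \<in> coarse" "b = ?e i" by blast
      have "inner2 (\<lambda>x. f x - h x) (?e i) = 0"
        using h(2)[OF i(1)] by (simp only: L2_inner_diff_left[OF f h2 e]) simp
      then show "inner2 b (\<lambda>x. f x - h x) = 0"
        unfolding i(2) by (subst L2_inner_cnj) simp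
    qed
    then have "inner2 (\<lambda>x. f x - h x) (shift l (v n)) = 0"
      by (subst L2_inner_cnj) simp
    then show ?thesis by (simp add: L2_inner_diff_left[OF f h2 s2])
  qed
  have "(\<Sum>n. coeff_energy (\<lambda>l. inner2 f (shift l (v n)))) = ennreal ((norm2 h)\<^sup>2)"
    unfolding same by (rule frame[OF hV])
  also have "\<dots> = (\<integral>\<^sup>+i. ennreal ((cmod (inner2 f (?e i)))\<^sup>2) \<partial>count_space coarse)"
    by (rule h(3)[symmetric])
  also have "\<dots> = (\<integral>\<^sup>+x. ennreal ((cmod (inner2 f (?e (?b x))))\<^sup>2) \<partial>count_space UNIV)"
    by (rule nn_integral_bij_count_space[OF b, symmetric])
  also have "\<dots> = (\<integral>\<^sup>+p. \<integral>\<^sup>+k. ennreal ((cmod (inner2 f (?e (?b (p, k)))))\<^sup>2) \<partial>count_space UNIV \<partial>count_space UNIV)"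
    by (rule nn_integral_fst_count_space[symmetric])
  also have "\<dots> = (\<Sum>p. \<integral>\<^sup>+k. ennreal ((cmod (inner2 f (?e (?b (p, k)))))\<^sup>2) \<partial>count_space UNIV)"
    by (rule nn_integral_count_space_nat)
  finally show ?thesis by simp
qed

section \<open>Spectral densities and periodization\<close>
definition power_density :: "(real \<Rightarrow> complex) \<Rightarrow> real \<Rightarrow> ennreal" where
  "power_density F \<xi> = ennreal ((cmod (F \<xi>))\<^sup>2)"

lemma power_density_measurable:
  assumes "F \<in> L2 lebesgue"
  shows "power_density F \<in> borel_measurable lebesgue"
proof -
  have "(\<lambda>x. (cmod (F x))\<^sup>2) \<in> borel_measurable lebesgue"
    using L2_integrable_square[OF assms] by auto
  then show ?thesis
    unfolding power_density_def[abs_def] by (rule measurable_compose[OF _ measurable_ennreal])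
qed

lemma nn_integral_power_density:
  "F \<in> L2 lebesgue \<Longrightarrow> (\<integral>\<^sup>+x. power_density F x \<partial>lebesgue) = ennreal ((norm2 F)\<^sup>2)"
  unfolding power_density_def by (rule nn_integral_L2_norm)

lemma measurable_compose_affine:
  fixes c t :: real
  assumes "h \<in> borel_measurable lebesgue" "c \<noteq> 0"
  shows "(\<lambda>x. h (t + c * x)) \<in> borel_measurable lebesgue"
  by (rule measurable_compose[OF measurable_lebesgue_affine[OF assms(2)] assms(1)])

lemma AE_lebesgue_translate:
  fixes c :: real
  assumes "AE x in lebesgue. P x"
  shows "AE x in lebesgue. P (x + c)"
proof -
  let ?D = "distr lebesgue lebesgue (\<lambda>x::real. c + 1 * x)"
  have "lebesgue = density ?D (\<lambda>_. ennreal \<bar>1\<bar>)"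
    by (rule lebesgue_real_affine) simp
  then have "AE x in density ?D (\<lambda>_. ennreal \<bar>1\<bar>). P x" using assms by (simp only:)
  then have "AE x in ?D. P x"
    by (subst (asm) AE_density) simp_all
  then have "AE x in lebesgue. P (c + 1 * x)"
    by (rule AE_distrD[rotated]) (rule measurable_lebesgue_affine, simp)
  then show ?thesis by (simp add: add.commute)
qed

lemma indicator_L2:
  assumes "A \<in> sets lebesgue" "emeasure lebesgue A < \<infinity>"
  shows "(indicator A :: real \<Rightarrow> complex) \<in> L2 lebesgue" "integrable lebesgue (indicator A :: real \<Rightarrow> complex)"
proof -
  have "(cmod (indicator A x))\<^sup>2 = indicator A x" for x :: real by (simp add: indicator_def)
  then show *: "(indicator A :: real \<Rightarrow> complex) \<in> L2 lebesgue" using assms by (simp add: L2_def)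
  show "integrable lebesgue (indicator A :: real \<Rightarrow> complex)"
    by (rule L2_finite_support_integrable[OF * assms]) simp
qed

text \<open>The periodization \<open>W\<close> may be infinite on a null set, so its real version \<open>w\<close> is used in integrals.
  Nonnegative \<open>q\<close> allow a computation with nonnegative integrals only.\<close>
lemma integral_periodize:
  fixes h q :: "real \<Rightarrow> real" and a p :: real
  defines "W \<equiv> \<lambda>x. (\<integral>\<^sup>+k. ennreal (h (x + p * of_int k)) \<partial>count_space (UNIV :: int set))"
  defines "w \<equiv> \<lambda>x. indicator {a..<a + p} x * enn2real (W x)"
  assumes h: "integrable lebesgue h" and h0: "\<And>x. 0 \<le> h x" and p: "p > 0"
  shows "integrable lebesgue w" and "AE x in lebesgue. x \<in> {a..<a + p} \<longrightarrow> W x = ennreal (w x)"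
    and "\<lbrakk>q \<in> borel_measurable lebesgue; \<And>x. 0 \<le> q x; \<And>x (k::int). q (x + p * of_int k) = q x\<rbrakk>
      \<Longrightarrow> (LINT x|lebesgue. w x * q x) = (LINT x|lebesgue. h x * q x)"
proof -
  have hm: "h \<in> borel_measurable lebesgue" using h by auto
  have Wm: "W \<in> borel_measurable lebesgue"
  proof -
    have "W = (\<lambda>x. \<Sum>n. ennreal (h (x + p * of_int (int_decode n))))"
    proof
      fix x
      show "W x = (\<Sum>n. ennreal (h (x + p * of_int (int_decode n))))"
        unfolding W_def
        by (subst nn_integral_bij_count_space[OF bij_int_decode, symmetric]) (rule nn_integral_count_space_nat)
    qed
    moreover have "(\<lambda>x. \<Sum>n. ennreal (h (x + p * of_int (int_decode n)))) \<in> borel_measurable lebesgue"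
    proof (intro borel_measurable_suminf_order measurable_compose[OF _ measurable_ennreal])
      show "(\<lambda>x. h (x + p * of_int (int_decode n))) \<in> borel_measurable lebesgue" for n
        using measurable_compose_affine[OF hm, of 1 "p * of_int (int_decode n)"] by (simp add: add.commute)
    qed
    ultimately show ?thesis by (simp only:)
  qed
  have Im: "(\<lambda>x. indicator {a..<a + p} x) \<in> borel_measurable lebesgue" for a :: real
    by (rule borel_measurable_indicator) simp
  have wm: "w \<in> borel_measurable lebesgue"
    unfolding w_def by (intro borel_measurable_times borel_measurable_indicator measurable_compose[OF Wm]) auto
  have w0: "0 \<le> w x" for x by (simp add: w_def)
  have total: "(\<integral>\<^sup>+x. indicator {a..<a + p} x * W x \<partial>lebesgue) = (\<integral>\<^sup>+x. ennreal (h x) \<partial>lebesgue)"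
    unfolding W_def
    by (rule nn_integral_periodize[OF _ p, symmetric]) (rule measurable_compose[OF hm measurable_ennreal])
  also have fin: "\<dots> < \<infinity>"
    using h h0 by (simp add: nn_integral_eq_integral)
  finally have "AE x in lebesgue. indicator {a..<a + p} x * W x \<noteq> \<infinity>"
    by (intro nn_integral_PInf_AE borel_measurable_times_ennreal Wm borel_measurable_indicator) auto
  then have Ww: "AE x in lebesgue. indicator {a..<a + p} x * W x = ennreal (w x)"
    by eventually_elim (auto simp: w_def indicator_def top.not_eq_extremum)
  then show "AE x in lebesgue. x \<in> {a..<a + p} \<longrightarrow> W x = ennreal (w x)"
    by eventually_elim auto
  have "(\<integral>\<^sup>+x. ennreal (w x) \<partial>lebesgue) = (\<integral>\<^sup>+x. ennreal (h x) \<partial>lebesgue)"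
    unfolding total[symmetric] by (rule nn_integral_cong_AE) (use Ww in eventually_elim, simp)
  then show "integrable lebesgue w"
    using wm w0 fin by (simp add: integrable_iff_bounded)
  assume q: "q \<in> borel_measurable lebesgue" and q0: "\<And>x. 0 \<le> q x" and qp: "\<And>x (k::int). q (x + p * of_int k) = q x"
  have "(\<integral>\<^sup>+x. ennreal (h x * q x) \<partial>lebesgue)
      = (\<integral>\<^sup>+x. indicator {a..<a + p} x * (\<integral>\<^sup>+k. ennreal (h (x + p * of_int k) * q (x + p * of_int k)) \<partial>count_space (UNIV :: int set)) \<partial>lebesgue)"
    by (rule nn_integral_periodize[OF _ p])
      (intro measurable_compose[OF _ measurable_ennreal] borel_measurable_times hm q)
  also have "\<dots> = (\<integral>\<^sup>+x. (indicator {a..<a + p} x * W x) * ennreal (q x) \<partial>lebesgue)"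
    unfolding qp W_def by (simp add: ennreal_mult'' q0 nn_integral_multc mult.assoc)
  also have "\<dots> = (\<integral>\<^sup>+x. ennreal (w x * q x) \<partial>lebesgue)"
  proof (rule nn_integral_cong_AE)
    show "AE x in lebesgue. (indicator {a..<a + p} x * W x) * ennreal (q x) = ennreal (w x * q x)"
      using Ww by eventually_elim (simp only: ennreal_mult[OF w0 q0])
  qed
  finally have eq: "(\<integral>\<^sup>+x. ennreal (h x * q x) \<partial>lebesgue) = (\<integral>\<^sup>+x. ennreal (w x * q x) \<partial>lebesgue)" .
  show "(LINT x|lebesgue. w x * q x) = (LINT x|lebesgue. h x * q x)"
    by (subst (1 2) integral_eq_nn_integral)
      (use wm hm q w0 h0 q0 eq in \<open>auto intro!: borel_measurable_times\<close>)
qed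

text \<open>By Plancherel's theorem the Fourier coefficients of the periodization are \<open>2 \<pi>\<close> times the inner
  products of \<open>v\<close> with its translates, and by assumption these are the coefficients of the indicator of \<open>E\<close>.\<close>
lemma periodized_power_density:
  assumes vV: "is_fourier v V" and E: "E \<in> sets lebesgue" "E \<subseteq> {-pi..pi}"
    and gram: "\<And>l. inner2 (shift l v) v = (LINT \<xi>|lebesgue. indicator E \<xi> * cis (of_int l * \<xi>)) / of_real (2 * pi)"
  shows "AE \<xi> in lebesgue. \<xi> \<in> {-pi..<pi} \<longrightarrow>
    (\<integral>\<^sup>+k. power_density V (\<xi> + 2 * pi * of_int k) \<partial>count_space (UNIV :: int set)) = indicator E \<xi>"
proof -
  define h where "h \<xi> = (cmod (V \<xi>))\<^sup>2" for \<xi>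
  note v = is_fourierD(1)[OF vV] and V = is_fourierD(2)[OF vV]
  have h: "integrable lebesgue h" unfolding h_def[abs_def] by (rule L2_integrable_square[OF V])
  have h0: "0 \<le> h \<xi>" for \<xi> by (simp add: h_def)
  have pi2: "(0::real) < 2 * pi" by simp
  have iv: "{-pi..<-pi + 2 * pi} = {-pi..<pi}" by simp
  define w where "w x = indicator {-pi..<-pi + 2 * pi} x * enn2real (\<integral>\<^sup>+k. ennreal (h (x + 2 * pi * of_int k)) \<partial>count_space (UNIV :: int set))" for x
  note per = integral_periodize[OF h h0 pi2, where a="-pi", folded w_def]
  have w: "integrable lebesgue w" by (rule per(1))
  have bounded_int: "integrable lebesgue (\<lambda>x. f x * q x)"
    if f: "integrable lebesgue f" and q: "q \<in> borel_measurable lebesgue" "\<And>x. \<bar>q x\<bar> \<le> 1" for f q :: "real \<Rightarrow> real"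
  proof (rule Bochner_Integration.integrable_bound[OF f])
    show "(\<lambda>x. f x * q x) \<in> borel_measurable lebesgue"
      by (intro borel_measurable_times borel_measurable_integrable[OF f] q)
    show "AE x in lebesgue. norm (f x * q x) \<le> norm (f x)"
      by (intro AE_I2) (use q(2) in \<open>auto simp: abs_mult intro!: mult_left_le\<close>)
  qed
  \<comment> \<open>Adding \<open>1\<close> makes the test function nonnegative.\<close>
  have test: "(LINT x|lebesgue. w x * q x) = (LINT x|lebesgue. h x * q x)"
    if q: "q \<in> borel_measurable lebesgue" "\<And>x. \<bar>q x\<bar> \<le> 1" and qp: "\<And>x (k::int). q (x + 2 * pi * of_int k) = q x" for q :: "real \<Rightarrow> real"
  proof -
    have "(LINT x|lebesgue. w x * 1) = (LINT x|lebesgue. h x * 1)"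
      by (rule per(3)) simp_all
    moreover have "(LINT x|lebesgue. w x * (1 + q x)) = (LINT x|lebesgue. h x * (1 + q x))"
    proof (rule per(3))
      show "(\<lambda>x. 1 + q x) \<in> borel_measurable lebesgue" using q(1) by simp
      show "0 \<le> 1 + q x" for x using q(2)[of x] by linarith
      show "1 + q (x + 2 * pi * of_int k) = 1 + q x" for x and k :: int by (simp only: qp)
    qed
    ultimately show ?thesis
      using w h bounded_int[OF w q] bounded_int[OF h q] by (simp add: distrib_left)
  qed
  have coef: "(LINT x|lebesgue. of_real (w x) * cis (of_int l * x)) = (LINT x|lebesgue. indicator E x * cis (of_int l * x))" for l :: int
  proof -
    have per_arg: "of_int l * (x + 2 * pi * of_int k) = of_int l * x + 2 * pi * of_int (l * k)" for x and k :: int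
      by (simp add: algebra_simps)
    have cis_per: "cis (of_int l * (x + 2 * pi * of_int k)) = cis (of_int l * x)" for x and k :: int
      unfolding per_arg cis_mult[symmetric] by simp
    have cm: "(\<lambda>x::real. cos (of_int l * x)) \<in> borel_measurable lebesgue" "(\<lambda>x::real. sin (of_int l * x)) \<in> borel_measurable lebesgue"
      by (rule measurable_compose[OF borel_measurable_lebesgue_linear(1)]; intro borel_measurable_continuous_onI continuous_intros)+
    have c: "(LINT x|lebesgue. w x * cos (of_int l * x)) = (LINT x|lebesgue. h x * cos (of_int l * x))"
    proof (rule test[OF cm(1)])
      show "cos (of_int l * (x + 2 * pi * of_int k)) = cos (of_int l * x)" for x and k :: int
        using arg_cong[OF cis_per, of Re] by simp
    qed simp
    have s: "(LINT x|lebesgue. w x * sin (of_int l * x)) = (LINT x|lebesgue. h x * sin (of_int l * x))"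
    proof (rule test[OF cm(2)])
      show "sin (of_int l * (x + 2 * pi * of_int k)) = sin (of_int l * x)" for x and k :: int
        using arg_cong[OF cis_per, of Im] by simp
    qed simp
    have cint: "integrable lebesgue (\<lambda>x. of_real (f x) * cis (of_int l * x))" if "integrable lebesgue f" for f :: "real \<Rightarrow> real"
      using that by (intro integrable_mult_cis borel_measurable_lebesgue_linear) simp
    have "(LINT x|lebesgue. of_real (w x) * cis (of_int l * x)) = (LINT x|lebesgue. of_real (h x) * cis (of_int l * x))"
    proof (rule complex_eqI)
      show "Re (LINT x|lebesgue. of_real (w x) * cis (of_int l * x)) = Re (LINT x|lebesgue. of_real (h x) * cis (of_int l * x))"
        unfolding integral_Re[OF cint[OF w], symmetric] integral_Re[OF cint[OF h], symmetric] using c by simp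
      show "Im (LINT x|lebesgue. of_real (w x) * cis (of_int l * x)) = Im (LINT x|lebesgue. of_real (h x) * cis (of_int l * x))"
        unfolding integral_Im[OF cint[OF w], symmetric] integral_Im[OF cint[OF h], symmetric] using s by simp
    qed
    also have "\<dots> = inner2 (\<lambda>\<xi>. cis (of_int l * \<xi>) * V \<xi>) V"
      unfolding L2_inner_def
      by (intro Bochner_Integration.integral_cong refl) (simp add: h_def complex_norm_square mult_ac del: of_real_power)
    also have "\<dots> = of_real (2 * pi) * inner2 (shift l v) v"
      using is_fourier_inner[OF is_fourier_translation[OF vV, of "of_int l"] vV] by (simp only: shift_def[abs_def])
    also have "\<dots> = (LINT x|lebesgue. indicator E x * cis (of_int l * x))"
      unfolding gram by simp
    finally show ?thesis .
  qed
  let ?E' = "E \<inter> {-pi..<pi}"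
  have E': "?E' \<in> sets lebesgue" using E by simp
  have E'fin: "emeasure lebesgue ?E' < \<infinity>"
  proof -
    have "emeasure lebesgue ?E' \<le> emeasure lebesgue {-pi..<pi}" by (rule emeasure_mono) auto
    then show ?thesis by (rule le_less_trans) simp
  qed
  let ?g = "\<lambda>x. complex_of_real (w x) - indicator ?E' x"
  have i1: "integrable lebesgue (\<lambda>x. complex_of_real (w x))" using w by simp
  have i2: "integrable lebesgue (\<lambda>x. indicator ?E' x :: complex)" by (rule indicator_L2(2)[OF E' E'fin])
  have "AE x in lebesgue. ?g x = 0"
  proof (rule Fourier_coefficients_unique[OF zero_less_one])
    show "integrable lebesgue ?g" using i1 i2 by simp
    show "?g x = 0" if "x \<notin> {-pi..<-pi + 2 * pi / 1}" for x
      using that by (auto simp: w_def indicator_def)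
    fix l :: int
    have "(LINT x|lebesgue. indicator ?E' x * cis (of_int l * x)) = (LINT x|lebesgue. indicator E x * cis (of_int l * x))"
    proof (rule integral_cong_AE)
      have "AE x in lebesgue. x \<notin> {pi}"
        by (rule AE_not_in) (simp add: negligible_iff_null_sets[symmetric])
      then show "AE x in lebesgue. indicator ?E' x * cis (of_int l * x) = indicator E x * cis (of_int l * x)"
        by eventually_elim (use E(2) in \<open>auto simp: indicator_def\<close>)
    qed (intro borel_measurable_times borel_measurable_indicator borel_measurable_cis borel_measurable_lebesgue_linear E E')+
    then have "(LINT x|lebesgue. of_real (w x) * cis (of_int l * x)) - (LINT x|lebesgue. indicator ?E' x * cis (of_int l * x)) = 0"
      by (simp only: coef) simp
    then show "(LINT x|lebesgue. ?g x * cis (of_int l * 1 * x)) = 0"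
      using integrable_mult_cis[OF i1 borel_measurable_lebesgue_linear(1), of "of_int l"]
        integrable_mult_cis[OF i2 borel_measurable_lebesgue_linear(1), of "of_int l"]
      by (simp add: left_diff_distrib)
  qed
  with per(2) show ?thesis
  proof eventually_elim
    case (elim x)
    show ?case
    proof
      assume x: "x \<in> {-pi..<pi}"
      have "complex_of_real (w x) = of_real (indicator E x)"
        using elim(2) x by (simp add: indicator_def split: if_splits)
      then have "w x = indicator E x" by (simp only: of_real_eq_iff)
      then show "(\<integral>\<^sup>+k. power_density V (x + 2 * pi * of_int k) \<partial>count_space (UNIV :: int set)) = indicator E x"
        using elim(1) x unfolding iv power_density_def h_def w_def[symmetric] by (simp add: indicator_def)
    qed
  qed
qed

section \<open>Testing with band limited functions\<close>

text \<open>The function whose Fourier transform is the indicator of \<open>A\<close>.\<close>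
definition band :: "real set \<Rightarrow> real \<Rightarrow> complex" where
  "band A = inverse_fourier (indicator A)"

lemma band_L2: "A \<in> sets lebesgue \<Longrightarrow> emeasure lebesgue A < \<infinity> \<Longrightarrow> band A \<in> L2 lebesgue"
  unfolding band_def by (rule inverse_fourier_L2) (rule indicator_L2; assumption)+

lemma band_inner:
  assumes A: "A \<in> sets lebesgue" "emeasure lebesgue A < \<infinity>" and fF: "is_fourier f F"
  shows "cmod (inner2 (band A) f) = cmod (LINT x|lebesgue. indicator A x * F x) / (2 * pi)"
proof -
  have "(LINT x|lebesgue. indicator A x * F x) = inner2 F (indicator A)"
    unfolding L2_inner_def by (intro Bochner_Integration.integral_cong refl) (simp add: indicator_def)
  also have "\<dots> = of_real (2 * pi) * inner2 f (band A)"
    unfolding band_def by (rule fourier_duality[OF fF indicator_L2[OF A]])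
  also have "inner2 f (band A) = cnj (inner2 (band A) f)"
    by (rule L2_inner_cnj)
  finally show ?thesis by (simp add: norm_mult)
qed

lemma Parseval_on_set:
  fixes F :: "real \<Rightarrow> complex" and w a :: real
  assumes w: "w > 0" and F: "F \<in> L2 lebesgue" and A: "A \<in> sets lebesgue" "A \<subseteq> {a..<a + 2 * pi / w}"
  shows "coeff_energy (\<lambda>k. LINT x|lebesgue. indicator A x * F x * cis (of_int k * w * x))
    = ennreal (2 * pi / w) * (\<integral>\<^sup>+x. indicator A x * power_density F x \<partial>lebesgue)"
proof -
  let ?G = "\<lambda>x. cnj (indicator A x * F x)"
  have Gm: "?G \<in> borel_measurable lebesgue"
    by (intro borel_measurable_cnj borel_measurable_times borel_measurable_indicator A(1) L2_measurable[OF F])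
  have G: "?G \<in> L2 lebesgue"
    by (rule L2_dominated[OF Gm F]) (simp add: indicator_def)
  have "cmod (LINT x|lebesgue. indicator A x * F x * cis (of_int k * w * x)) = cmod (LINT x|lebesgue. ?G x * cis (- (of_int k * w * x)))" for k :: int
  proof -
    have "(LINT x|lebesgue. ?G x * cis (- (of_int k * w * x))) = (LINT x|lebesgue. cnj (indicator A x * F x * cis (of_int k * w * x)))"
      by (simp add: cis_cnj)
    then show ?thesis by (simp only: Bochner_Integration.integral_cnj complex_mod_cnj)
  qed
  moreover have "(\<integral>\<^sup>+x. ennreal ((cmod (?G x))\<^sup>2) \<partial>lebesgue) = (\<integral>\<^sup>+x. indicator A x * power_density F x \<partial>lebesgue)"
    by (intro nn_integral_cong) (simp add: power_density_def indicator_def)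
  moreover have supp: "?G x = 0" if "x \<notin> {a..<a + 2 * pi / w}" for x
  proof -
    have "x \<notin> A" using that A(2) by blast
    then show ?thesis by simp
  qed
  ultimately show ?thesis
    using Parseval[OF w G supp] by (simp only:)
qed

lemma shift_coefficients:
  assumes vV: "is_fourier v V" and A: "A \<in> sets lebesgue" "A \<subseteq> {a..<a + 2 * pi}"
  shows "coeff_energy (\<lambda>l. inner2 (band A) (shift l v))
    = ennreal (1 / (2 * pi)) * (\<integral>\<^sup>+x. indicator A x * power_density V x \<partial>lebesgue)"
proof -
  have fin: "emeasure lebesgue A < \<infinity>"
    by (rule le_less_trans[OF emeasure_mono[OF A(2)]]) auto
  have "ennreal ((cmod (inner2 (band A) (shift l v)))\<^sup>2)
      = ennreal (1 / (2 * pi)\<^sup>2) * ennreal ((cmod (LINT x|lebesgue. indicator A x * V x * cis (of_int l * 1 * x)))\<^sup>2)" for l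
  proof -
    have "is_fourier (shift l v) (\<lambda>\<xi>. cis (of_int l * \<xi>) * V \<xi>)"
      using is_fourier_translation[OF vV, of "of_int l"] by (simp only: shift_def[abs_def])
    then have "cmod (inner2 (band A) (shift l v)) = cmod (LINT x|lebesgue. indicator A x * (cis (of_int l * x) * V x)) / (2 * pi)"
      by (rule band_inner[OF A(1) fin])
    also have "(LINT x|lebesgue. indicator A x * (cis (of_int l * x) * V x)) = (LINT x|lebesgue. indicator A x * V x * cis (of_int l * 1 * x))"
      by (simp add: mult_ac)
    finally have "(cmod (inner2 (band A) (shift l v)))\<^sup>2
        = 1 / (2 * pi)\<^sup>2 * (cmod (LINT x|lebesgue. indicator A x * V x * cis (of_int l * 1 * x)))\<^sup>2"
      by (simp only: power_divide) simp
    then show ?thesis by (simp only: ennreal_mult[of "1 / (2 * pi)\<^sup>2", OF _ zero_le_power2] zero_le_divide_1_iff zero_le_power2)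
  qed
  then have "coeff_energy (\<lambda>l. inner2 (band A) (shift l v))
      = ennreal (1 / (2 * pi)\<^sup>2) * coeff_energy (\<lambda>l. LINT x|lebesgue. indicator A x * V x * cis (of_int l * 1 * x))"
    by (simp only: nn_integral_cmult borel_measurable_count_space)
  also have "\<dots> = ennreal (1 / (2 * pi)\<^sup>2) * (ennreal (2 * pi / 1) * (\<integral>\<^sup>+x. indicator A x * power_density V x \<partial>lebesgue))"
    by (subst Parseval_on_set[OF zero_less_one is_fourierD(2)[OF vV] A(1), of a]) (use A(2) in simp_all)
  also have "\<dots> = ennreal (1 / (2 * pi)\<^sup>2 * (2 * pi / 1)) * (\<integral>\<^sup>+x. indicator A x * power_density V x \<partial>lebesgue)"
    by (simp only: mult.assoc[symmetric] ennreal_mult[symmetric] zero_le_divide_1_iff zero_le_power2 div_by_1 pi_ge_zero mult_nonneg_nonneg zero_le_numeral)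
  also have "1 / (2 * pi)\<^sup>2 * (2 * pi / 1) = 1 / (2 * pi)" by (simp add: power2_eq_square)
  finally show ?thesis .
qed

lemma is_fourier_wavelet_fn:
  assumes fF: "is_fourier \<psi> \<Psi>"
  shows "is_fourier (wavelet_fn \<psi> (- int P) k)
    (\<lambda>\<xi>. of_real (sqrt 2 ^ P) * (\<Psi> (2 ^ P * \<xi>) * cis (of_int k * 2 ^ P * \<xi>)))"
proof -
  have c: "(0::real) < 1 / 2 ^ P" by simp
  have sq: "sqrt (1 / 2 ^ P) = 1 / sqrt 2 ^ P"
    by (simp add: real_sqrt_divide real_sqrt_power)
  have "is_fourier (\<lambda>x. of_real (sqrt (1 / 2 ^ P)) * \<psi> (1 / 2 ^ P * x + of_int k))
      (\<lambda>\<xi>. cis (of_int k * (\<xi> / (1 / 2 ^ P))) * \<Psi> (\<xi> / (1 / 2 ^ P)) / of_real (sqrt (1 / 2 ^ P)))"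
    by (rule is_fourier_dilation[OF is_fourier_translation[OF fF, of "of_int k"] c])
  also have "(\<lambda>x. of_real (sqrt (1 / 2 ^ P)) * \<psi> (1 / 2 ^ P * x + of_int k)) = wavelet_fn \<psi> (- int P) k"
    by (simp add: fun_eq_iff wavelet_fn_def powr_half_int[simplified] sq power_int_minus field_simps)
  also have "(\<lambda>\<xi>. cis (of_int k * (\<xi> / (1 / 2 ^ P))) * \<Psi> (\<xi> / (1 / 2 ^ P)) / of_real (sqrt (1 / 2 ^ P)))
      = (\<lambda>\<xi>. of_real (sqrt 2 ^ P) * (\<Psi> (2 ^ P * \<xi>) * cis (of_int k * 2 ^ P * \<xi>)))"
    by (simp add: fun_eq_iff sq mult_ac)
  finally show ?thesis .
qed

lemma wavelet_coefficients_norm: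
  assumes fF: "is_fourier \<psi> \<Psi>" and A: "A \<in> sets lebesgue" "emeasure lebesgue A < \<infinity>"
  shows "ennreal ((cmod (inner2 (band A) (wavelet_fn \<psi> (- int P) k)))\<^sup>2)
    = ennreal (2 ^ P / (2 * pi)\<^sup>2) * ennreal ((cmod (LINT x|lebesgue. indicator A x * \<Psi> (2 ^ P * x) * cis (of_int k * 2 ^ P * x)))\<^sup>2)"
proof -
  let ?I = "LINT x|lebesgue. indicator A x * \<Psi> (2 ^ P * x) * cis (of_int k * 2 ^ P * x)"
  have "(LINT x|lebesgue. indicator A x * (of_real (sqrt 2 ^ P) * (\<Psi> (2 ^ P * x) * cis (of_int k * 2 ^ P * x))))
      = (LINT x|lebesgue. of_real (sqrt 2 ^ P) * (indicator A x * \<Psi> (2 ^ P * x) * cis (of_int k * 2 ^ P * x)))"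
    by (intro Bochner_Integration.integral_cong refl) (simp only: mult_ac)
  also have "\<dots> = of_real (sqrt 2 ^ P) * ?I"
    by (rule Bochner_Integration.integral_mult_right_zero)
  finally have "cmod (inner2 (band A) (wavelet_fn \<psi> (- int P) k)) = sqrt 2 ^ P * cmod ?I / (2 * pi)"
    using band_inner[OF A is_fourier_wavelet_fn[OF fF]] by (simp only: norm_mult norm_of_real) simp
  moreover have "(sqrt 2 ^ P)\<^sup>2 = (2 :: real) ^ P"
    by (simp add: power_mult[symmetric] mult.commute[of P]) (simp add: power_mult)
  ultimately have "(cmod (inner2 (band A) (wavelet_fn \<psi> (- int P) k)))\<^sup>2 = 2 ^ P / (2 * pi)\<^sup>2 * (cmod ?I)\<^sup>2"
    by (simp only: power_divide power_mult_distrib) simp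
  moreover have "0 \<le> 2 ^ P / (2 * pi)\<^sup>2" by simp
  ultimately show ?thesis by (simp only: ennreal_mult[of "2 ^ P / (2 * pi)\<^sup>2", OF _ zero_le_power2])
qed

lemma dilated_L2:
  fixes \<Psi> :: "real \<Rightarrow> complex"
  assumes "\<Psi> \<in> L2 lebesgue"
  shows "(\<lambda>x. \<Psi> (2 ^ P * x)) \<in> L2 lebesgue"
  using L2_lebesgue_affine(1)[OF assms, of "2 ^ P" 0] by simp

text \<open>The transforms of the wavelets of scale \<open>- P\<close> are multiples of \<open>\<Psi> (2\<^sup>P \<xi>)\<close> by exponentials with
  frequency step \<open>2\<^sup>P\<close>, and such exponentials are a complete orthogonal system on an interval of length \<open>2 \<pi> / 2\<^sup>P\<close>.\<close>
lemma wavelet_coefficients_short: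
  assumes fF: "is_fourier \<psi> \<Psi>" and A: "A \<in> sets lebesgue" "A \<subseteq> {a..<a + 2 * pi / 2 ^ P}"
  shows "coeff_energy (\<lambda>k. inner2 (band A) (wavelet_fn \<psi> (- int P) k))
    = ennreal (1 / (2 * pi)) * (\<integral>\<^sup>+x. indicator A x * power_density \<Psi> (2 ^ P * x) \<partial>lebesgue)"
proof -
  have fin: "emeasure lebesgue A < \<infinity>"
    by (rule le_less_trans[OF emeasure_mono[OF A(2)]]) auto
  have P0: "(0::real) < 2 ^ P" by simp
  let ?S = "\<integral>\<^sup>+x. indicator A x * power_density (\<lambda>x. \<Psi> (2 ^ P * x)) x \<partial>lebesgue"
  have "coeff_energy (\<lambda>k. inner2 (band A) (wavelet_fn \<psi> (- int P) k))
      = ennreal (2 ^ P / (2 * pi)\<^sup>2) * (ennreal (2 * pi / 2 ^ P) * ?S)"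
    unfolding wavelet_coefficients_norm[OF fF A(1) fin]
    by (subst nn_integral_cmult) (simp_all only: Parseval_on_set[OF P0 dilated_L2[OF is_fourierD(2)[OF fF]] A] borel_measurable_count_space)
  also have "\<dots> = ennreal (2 ^ P / (2 * pi)\<^sup>2 * (2 * pi / 2 ^ P)) * ?S"
    by (subst ennreal_mult) (simp_all add: mult.assoc)
  also have "2 ^ P / (2 * pi)\<^sup>2 * (2 * pi / 2 ^ P) = 1 / (2 * pi)" by (simp add: power2_eq_square)
  finally show ?thesis by (simp only: power_density_def)
qed

text \<open>A longer interval is cut into \<open>M\<close> pieces of the length that matches the frequency step; the
  Cauchy-Schwarz inequality for the sum of \<open>M\<close> terms accounts for the factor \<open>M\<close>.\<close>

lemma wavelet_coefficients_long:
  assumes fF: "is_fourier \<psi> \<Psi>" and A: "A \<in> sets lebesgue" "A \<subseteq> {a..<a + real M * (2 * pi / 2 ^ P)}"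
  shows "coeff_energy (\<lambda>k. inner2 (band A) (wavelet_fn \<psi> (- int P) k))
    \<le> ennreal (1 / (2 * pi)) * (of_nat M * (\<integral>\<^sup>+x. indicator A x * power_density \<Psi> (2 ^ P * x) \<partial>lebesgue))"
proof -
  define d where "d = 2 * pi / 2 ^ P"
  have d: "d > 0" by (simp add: d_def)
  have fin: "emeasure lebesgue A < \<infinity>"
    by (rule le_less_trans[OF emeasure_mono[OF A(2)]]) auto
  define B where "B i = A \<inter> {a + real i * d..<a + real i * d + d}" for i
  have B: "B i \<in> sets lebesgue" "B i \<subseteq> {a + real i * d..<a + real i * d + 2 * pi / 2 ^ P}" for i
    using A(1) by (auto simp: B_def d_def)
  have Bfin: "emeasure lebesgue (B i) < \<infinity>" for i
    by (rule le_less_trans[OF emeasure_mono[OF B(2)]]) auto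
  have split: "(\<Sum>i<M. indicator (B i) x) = (indicator A x :: 'c :: semiring_1)" for x
  proof (cases "x \<in> A")
    case False
    then show ?thesis by (simp add: B_def)
  next
    case True
    define i0 where "i0 = nat \<lfloor>(x - a) / d\<rfloor>"
    from True A(2) have x: "a \<le> x" "x < a + real M * d" by (auto simp: d_def)
    have y: "0 \<le> (x - a) / d" using x(1) d by simp
    have in_iff: "x \<in> B i \<longleftrightarrow> i = i0" for i
    proof -
      have "x \<in> B i \<longleftrightarrow> real i \<le> (x - a) / d \<and> (x - a) / d < real i + 1"
        using True d by (auto simp: B_def pos_le_divide_eq pos_divide_less_eq algebra_simps)
      also have "\<dots> \<longleftrightarrow> \<lfloor>(x - a) / d\<rfloor> = int i"
        by (simp add: floor_eq_iff)
      also have "\<dots> \<longleftrightarrow> i = i0"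
        using y unfolding i0_def by auto
      finally show ?thesis .
    qed
    have "real i0 \<le> (x - a) / d" using y by (simp add: i0_def)
    also have "\<dots> < real M" using x(2) d by (simp add: pos_divide_less_eq)
    finally have "i0 < M" by simp
    then show ?thesis using True by (simp add: indicator_def in_iff)
  qed
  let ?F = "\<lambda>x. \<Psi> (2 ^ P * x)"
  have F: "?F \<in> L2 lebesgue" by (rule dilated_L2[OF is_fourierD(2)[OF fF]])
  define c where "c C k = (LINT x|lebesgue. indicator C x * \<Psi> (2 ^ P * x) * cis (of_int k * 2 ^ P * x))" for C and k :: int
  have cint: "integrable lebesgue (\<lambda>x. indicator (B i) x * \<Psi> (2 ^ P * x) * cis (of_int k * 2 ^ P * x))" for i and k :: int
  proof (rule integrable_mult_cis)
    have "(\<lambda>x. indicator (B i) x * \<Psi> (2 ^ P * x)) \<in> L2 lebesgue"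
      by (rule L2_dominated[OF _ F], intro borel_measurable_times borel_measurable_indicator B L2_measurable[OF F])
        (simp add: indicator_def)
    then show "integrable lebesgue (\<lambda>x. indicator (B i) x * \<Psi> (2 ^ P * x))"
      by (rule L2_finite_support_integrable[OF _ B(1) Bfin[of i]]) simp
    show "(\<lambda>x::real. of_int k * 2 ^ P * x) \<in> borel_measurable lebesgue" by (rule borel_measurable_lebesgue_linear)
  qed
  have csum: "c A k = (\<Sum>i<M. c (B i) k)" for k
  proof -
    have "c A k = (LINT x|lebesgue. (\<Sum>i<M. indicator (B i) x * \<Psi> (2 ^ P * x) * cis (of_int k * 2 ^ P * x)))"
      unfolding c_def split[symmetric] by (simp only: sum_distrib_right)
    also have "\<dots> = (\<Sum>i<M. c (B i) k)"
      unfolding c_def by (rule Bochner_Integration.integral_sum) (rule cint)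
    finally show ?thesis .
  qed
  have cs: "(cmod (c A k))\<^sup>2 \<le> real M * (\<Sum>i<M. (cmod (c (B i) k))\<^sup>2)" for k
  proof -
    have "(cmod (c A k))\<^sup>2 \<le> (\<Sum>i<M. cmod (c (B i) k))\<^sup>2"
      unfolding csum by (intro power_mono norm_sum) simp
    also have "\<dots> = (\<Sum>i<M. 1 * cmod (c (B i) k))\<^sup>2" by simp
    also have "\<dots> \<le> (\<Sum>i<M. 1\<^sup>2) * (\<Sum>i<M. (cmod (c (B i) k))\<^sup>2)"
      by (rule Cauchy_Schwarz_ineq_sum)
    finally show ?thesis by simp
  qed
  let ?G = "\<lambda>C k. ennreal ((cmod (inner2 (band C) (wavelet_fn \<psi> (- int P) k)))\<^sup>2)"
  have G: "?G C k = ennreal (2 ^ P / (2 * pi)\<^sup>2) * ennreal ((cmod (c C k))\<^sup>2)"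
    if "C \<in> sets lebesgue" "emeasure lebesgue C < \<infinity>" for C k
    unfolding c_def by (rule wavelet_coefficients_norm[OF fF that])
  have le: "?G A k \<le> of_nat M * (\<Sum>i<M. ?G (B i) k)" for k
  proof -
    have "?G A k \<le> ennreal (2 ^ P / (2 * pi)\<^sup>2) * ennreal (real M * (\<Sum>i<M. (cmod (c (B i) k))\<^sup>2))"
      unfolding G[OF A(1) fin] by (intro mult_left_mono ennreal_leI cs) simp
    also have "ennreal (real M * (\<Sum>i<M. (cmod (c (B i) k))\<^sup>2)) = of_nat M * (\<Sum>i<M. ennreal ((cmod (c (B i) k))\<^sup>2))"
      by (simp add: ennreal_mult sum_nonneg ennreal_of_nat_eq_real_of_nat)
    also have "ennreal (2 ^ P / (2 * pi)\<^sup>2) * \<dots> = of_nat M * (\<Sum>i<M. ?G (B i) k)"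
      unfolding G[OF B(1) Bfin] sum_distrib_left[symmetric] by (rule mult.left_commute)
    finally show ?thesis .
  qed
  have Fm: "(\<lambda>x. power_density \<Psi> (2 ^ P * x)) \<in> borel_measurable lebesgue"
    using power_density_measurable[OF F] by (simp add: power_density_def[abs_def])
  have "(\<integral>\<^sup>+k. ?G A k \<partial>count_space UNIV) \<le> (\<integral>\<^sup>+k. of_nat M * (\<Sum>i<M. ?G (B i) k) \<partial>count_space UNIV)"
    by (intro nn_integral_mono le)
  also have "\<dots> = of_nat M * (\<Sum>i<M. \<integral>\<^sup>+k. ?G (B i) k \<partial>count_space UNIV)"
    by (simp only: nn_integral_cmult nn_integral_sum borel_measurable_count_space)
  also have "\<dots> = of_nat M * (\<Sum>i<M. ennreal (1 / (2 * pi)) * (\<integral>\<^sup>+x. indicator (B i) x * power_density \<Psi> (2 ^ P * x) \<partial>lebesgue))"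
    unfolding wavelet_coefficients_short[OF fF B] ..
  also have "\<dots> = ennreal (1 / (2 * pi)) * (of_nat M * (\<Sum>i<M. \<integral>\<^sup>+x. indicator (B i) x * power_density \<Psi> (2 ^ P * x) \<partial>lebesgue))"
    unfolding sum_distrib_left[symmetric] by (rule mult.left_commute)
  also have "(\<Sum>i<M. \<integral>\<^sup>+x. indicator (B i) x * power_density \<Psi> (2 ^ P * x) \<partial>lebesgue)
      = (\<integral>\<^sup>+x. (\<Sum>i<M. indicator (B i) x * power_density \<Psi> (2 ^ P * x)) \<partial>lebesgue)"
    by (rule nn_integral_sum[symmetric]) (intro borel_measurable_times_ennreal borel_measurable_indicator B Fm)
  also have "\<dots> = (\<integral>\<^sup>+x. indicator A x * power_density \<Psi> (2 ^ P * x) \<partial>lebesgue)"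
    unfolding sum_distrib_right[symmetric] split ..
  finally show ?thesis .
qed

section \<open>Equality of the spectral densities\<close>
definition shell :: "int \<Rightarrow> real set" where
  "shell s = {x. 2 powi s \<le> \<bar>x\<bar> \<and> \<bar>x\<bar> < 2 powi (s + 1)}"

lemma shell_measurable: "shell s \<in> sets lebesgue"
proof -
  have "(\<lambda>x::real. \<bar>x\<bar>) \<in> borel_measurable lebesgue"
    by (rule borel_measurable_abs[OF borel_measurable_lebesgue_ident])
  then have "(\<lambda>x::real. \<bar>x\<bar>) -` {2 powi s..<2 powi (s + 1)} \<inter> space lebesgue \<in> sets lebesgue"
    by (rule measurable_sets) simp
  also have "(\<lambda>x::real. \<bar>x\<bar>) -` {2 powi s..<2 powi (s + 1)} \<inter> space lebesgue = shell s"
    by (auto simp: shell_def)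
  finally show ?thesis .
qed

lemma shell_finite: "emeasure lebesgue (shell s) < \<infinity>"
proof -
  have "shell s \<subseteq> {- (2 powi (s + 1))..2 powi (s + 1)}" by (auto simp: shell_def)
  then have "emeasure lebesgue (shell s) \<le> emeasure lebesgue {- (2 powi (s + 1))..(2::real) powi (s + 1)}"
    by (rule emeasure_mono) simp
  then show ?thesis by (rule le_less_trans) simp
qed

lemma shells_cover:
  assumes "x \<noteq> 0"
  shows "\<exists>s. x \<in> shell s"
proof -
  have "2 powr of_int \<lfloor>log 2 \<bar>x\<bar>\<rfloor> \<le> \<bar>x\<bar> \<and> \<bar>x\<bar> < 2 powr (of_int \<lfloor>log 2 \<bar>x\<bar>\<rfloor> + 1)"
    using floor_log_eq_powr_iff[of "\<bar>x\<bar>" 2 "\<lfloor>log 2 \<bar>x\<bar>\<rfloor>"] assms by simp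
  moreover have "of_int \<lfloor>log 2 \<bar>x\<bar>\<rfloor> + 1 = real_of_int (\<lfloor>log 2 \<bar>x\<bar>\<rfloor> + 1)" by simp
  ultimately have "2 powi \<lfloor>log 2 \<bar>x\<bar>\<rfloor> \<le> \<bar>x\<bar> \<and> \<bar>x\<bar> < 2 powi (\<lfloor>log 2 \<bar>x\<bar>\<rfloor> + 1)"
    by (simp only: powr_real_of_int' zero_le_numeral simp_thms zero_neq_numeral[symmetric])
  then show ?thesis by (auto simp only: shell_def mem_Collect_eq)
qed

lemma shell_dilates_disjoint:
  assumes "x / 2 ^ p \<in> shell s" "x / 2 ^ q \<in> shell s"
  shows "p = q"
proof -
  have False if lt: "p < q" and p: "x / 2 ^ p \<in> shell s" and q: "x / 2 ^ q \<in> shell s" for p q :: nat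
  proof -
    obtain r where r: "q = Suc p + r" using lt less_iff_Suc_add by auto
    have "2 * (2 powi s :: real) \<le> 2 * \<bar>x / 2 ^ q\<bar>" using q by (simp add: shell_def)
    also have "\<dots> = \<bar>x / 2 ^ p\<bar> / 2 ^ r" by (simp add: r power_add abs_divide)
    also have "\<dots> \<le> \<bar>x / 2 ^ p\<bar> / 1" by (intro divide_left_mono) auto
    also have "\<dots> < 2 powi (s + 1)" using p by (simp add: shell_def)
    also have "\<dots> = 2 * 2 powi s" by (simp add: power_int_add)
    finally show False by simp
  qed
  then show ?thesis using assms by (metis linorder_neqE_nat)
qed

lemma at_most_one_term_le_1:
  fixes P :: "nat \<Rightarrow> bool"
  assumes "\<And>p q. P p \<Longrightarrow> P q \<Longrightarrow> p = q"
  shows "(\<Sum>p. if P p then 1 else 0 :: ennreal) \<le> 1"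
proof (cases "\<exists>p. P p")
  case True
  then obtain p where p: "P p" by blast
  have "(\<Sum>q. if P q then 1 else 0 :: ennreal) = (\<Sum>q\<in>{p}. if P q then 1 else 0)"
    by (rule suminf_finite) (use assms p in auto)
  then show ?thesis using p by simp
qed simp

text \<open>A substitution turns the \<open>p\<close>-th term into the integral of the power density over the dilate of \<open>J\<close>
  by \<open>2\<^sup>p\<^sup>+\<^sup>1\<close>, and these dilates are disjoint.\<close>
lemma sum_dilated_over_shell_subset:
  assumes \<Psi>: "\<Psi> \<in> L2 lebesgue" and J: "J \<in> sets lebesgue" "J \<subseteq> shell s"
  shows "(\<Sum>p. ennreal (2 ^ Suc p) * (\<integral>\<^sup>+x. indicator J x * power_density \<Psi> (2 ^ Suc p * x) \<partial>lebesgue))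
    \<le> ennreal ((norm2 \<Psi>)\<^sup>2)"
proof -
  have m: "power_density \<Psi> \<in> borel_measurable lebesgue" by (rule power_density_measurable[OF \<Psi>])
  have Jm: "(\<lambda>x. indicator J (x / 2 ^ Suc p) :: ennreal) \<in> borel_measurable lebesgue" for p
    using measurable_compose_affine[OF borel_measurable_indicator[OF J(1)], of "1 / 2 ^ Suc p" 0] by simp
  have "ennreal (2 ^ Suc p) * (\<integral>\<^sup>+x. indicator J x * power_density \<Psi> (2 ^ Suc p * x) \<partial>lebesgue)
      = (\<integral>\<^sup>+x. indicator J (x / 2 ^ Suc p) * power_density \<Psi> x \<partial>lebesgue)" for p
    by (subst nn_integral_real_affine_lebesgue[OF borel_measurable_times_ennreal[OF Jm m], of "2 ^ Suc p" _ 0]) simp_all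
  then have "(\<Sum>p. ennreal (2 ^ Suc p) * (\<integral>\<^sup>+x. indicator J x * power_density \<Psi> (2 ^ Suc p * x) \<partial>lebesgue))
      = (\<Sum>p. \<integral>\<^sup>+x. indicator J (x / 2 ^ Suc p) * power_density \<Psi> x \<partial>lebesgue)"
    by (simp only:)
  also have "\<dots> = (\<integral>\<^sup>+x. (\<Sum>p. indicator J (x / 2 ^ Suc p) * power_density \<Psi> x) \<partial>lebesgue)"
    by (rule nn_integral_suminf[symmetric]) (rule borel_measurable_times_ennreal[OF Jm m])
  also have "\<dots> \<le> (\<integral>\<^sup>+x. power_density \<Psi> x \<partial>lebesgue)"
  proof (rule nn_integral_mono)
    fix x :: real
    have "(\<Sum>p. if x / 2 ^ Suc p \<in> J then 1 else 0 :: ennreal) \<le> 1"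
    proof (rule at_most_one_term_le_1)
      fix p q assume "x / 2 ^ Suc p \<in> J" "x / 2 ^ Suc q \<in> J"
      then have "Suc p = Suc q" using J(2) by (intro shell_dilates_disjoint) auto
      then show "p = q" by simp
    qed
    then have "(\<Sum>p. indicator J (x / 2 ^ Suc p)) \<le> (1 :: ennreal)"
      by (simp only: indicator_def of_bool_def)
    then have "(\<Sum>p. indicator J (x / 2 ^ Suc p)) * power_density \<Psi> x \<le> 1 * power_density \<Psi> x"
      by (rule mult_right_mono) simp
    then show "(\<Sum>p. indicator J (x / 2 ^ Suc p) * power_density \<Psi> x) \<le> power_density \<Psi> x"
      by simp
  qed
  also have "\<dots> = ennreal ((norm2 \<Psi>)\<^sup>2)" by (rule nn_integral_power_density[OF \<Psi>])
  finally show ?thesis .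
qed

lemma nn_integral_grid:
  fixes h :: "real \<Rightarrow> ennreal" and d :: real
  assumes h: "h \<in> borel_measurable lebesgue" and J: "J \<in> sets lebesgue" and d: "d > 0"
  shows "(\<integral>\<^sup>+i. \<integral>\<^sup>+x. indicator (J \<inter> {d * of_int i..<d * of_int i + d}) x * h x \<partial>lebesgue \<partial>count_space (UNIV :: int set))
    = (\<integral>\<^sup>+x. indicator J x * h x \<partial>lebesgue)"
proof -
  let ?A = "\<lambda>i::int. J \<inter> {d * of_int i..<d * of_int i + d}"
  have A: "?A i \<in> sets lebesgue" for i using J by simp
  have "(\<integral>\<^sup>+i. \<integral>\<^sup>+x. indicator (?A i) x * h x \<partial>lebesgue \<partial>count_space (UNIV :: int set))
      = (\<integral>\<^sup>+x. \<integral>\<^sup>+i. indicator (?A i) x * h x \<partial>count_space (UNIV :: int set) \<partial>lebesgue)"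
    by (rule nn_integral_count_space_nn_integral[symmetric])
      (auto intro!: borel_measurable_times_ennreal borel_measurable_indicator A h)
  also have "\<dots> = (\<integral>\<^sup>+x. indicator J x * h x \<partial>lebesgue)"
  proof (rule nn_integral_cong)
    fix x :: real
    have "(indicator (?A i) x :: ennreal) = indicator J x * indicator {0..<0 + d} (x - d * of_int i)" for i
      by (auto simp: indicator_def)
    then have "(\<integral>\<^sup>+i. indicator (?A i) x * h x \<partial>count_space (UNIV :: int set))
        = (\<integral>\<^sup>+i. indicator J x * indicator {0..<0 + d} (x - d * of_int i) * h x \<partial>count_space (UNIV :: int set))"
      by (simp only:)
    also have "\<dots> = indicator J x * (\<integral>\<^sup>+i. indicator {0..<0 + d} (x - d * of_int i) \<partial>count_space (UNIV :: int set)) * h x"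
      by (simp only: nn_integral_cmult nn_integral_multc borel_measurable_count_space)
    finally show "(\<integral>\<^sup>+i. indicator (?A i) x * h x \<partial>count_space (UNIV :: int set)) = indicator J x * h x"
      by (simp only: nn_integral_indicator_translates[OF d] mult_1_right)
  qed
  finally show ?thesis .
qed

text \<open>The frame identity is applied to the functions \<open>band (A i)\<close>, where the sets \<open>A i\<close> are the pieces of
  \<open>J\<close> in a grid of mesh \<open>2 \<pi> / 2\<^sup>N\<close>, and summed over \<open>i\<close>. Scales up to \<open>N\<close> contribute the exact
  integrals; at the other scales the bound for long intervals is summed, which costs at most
  \<open>2\<^sup>-\<^sup>N\<close> times the squared norm of \<open>\<Psi>\<close> because the dilates of a part of a shell are disjoint.\<close>

lemma spectral_identity_on_shell:
  assumes fF: "is_fourier \<psi> \<Psi>" and vV: "\<And>n::nat. is_fourier (v n) (V n)"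
    and frame: "\<And>f. f \<in> L2 lebesgue \<Longrightarrow>
      (\<Sum>n. coeff_energy (\<lambda>l. inner2 f (shift l (v n))))
      = (\<Sum>p. coeff_energy (\<lambda>k. inner2 f (wavelet_fn \<psi> (- int (Suc p)) k)))"
    and J: "J \<in> sets lebesgue" "J \<subseteq> shell s"
  shows "(\<Sum>n. \<integral>\<^sup>+x. indicator J x * power_density (V n) x \<partial>lebesgue)
    = (\<Sum>p. \<integral>\<^sup>+x. indicator J x * power_density \<Psi> (2 ^ Suc p * x) \<partial>lebesgue)"
proof -
  note \<Psi> = is_fourierD(2)[OF fF]
  define T where "T p = (\<integral>\<^sup>+x. indicator J x * power_density \<Psi> (2 ^ Suc p * x) \<partial>lebesgue)" for p
  define S where "S = (\<Sum>n. \<integral>\<^sup>+x. indicator J x * power_density (V n) x \<partial>lebesgue)"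
  have Vm: "power_density (V n) \<in> borel_measurable lebesgue" for n
    by (rule power_density_measurable[OF is_fourierD(2)[OF vV]])
  have \<Psi>m: "(\<lambda>x. power_density \<Psi> (2 ^ Suc p * x)) \<in> borel_measurable lebesgue" for p
    using measurable_compose_affine[OF power_density_measurable[OF \<Psi>], of "2 ^ Suc p" 0] by simp
  have pi0: "(0::real) \<le> 1 / (2 * pi)" by simp
  let ?c = "ennreal (1 / (2 * pi))"
  have cnz: "?c \<noteq> 0" "?c \<noteq> top" by simp_all
  have bounds: "(\<Sum>p<N. T p) \<le> S \<and> S \<le> (\<Sum>p. T p) + ennreal ((1/2) ^ N * (norm2 \<Psi>)\<^sup>2)" for N :: nat
  proof -
    define d where "d = 2 * pi / 2 ^ N"
    have d: "d > 0" by (simp add: d_def)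
    define A where "A i = J \<inter> {d * of_int i..<d * of_int i + d}" for i :: int
    have A: "A i \<in> sets lebesgue" for i using J by (simp add: A_def)
    have Afin: "emeasure lebesgue (A i) < \<infinity>" for i
      by (rule le_less_trans[OF emeasure_mono shell_finite[of s]]) (use J(2) shell_measurable in \<open>auto simp: A_def\<close>)
    have d2pi: "d \<le> 2 * pi"
      unfolding d_def by (simp add: divide_le_eq)
    have A_2pi: "A i \<subseteq> {d * of_int i..<d * of_int i + 2 * pi}" for i
      using d2pi by (auto simp: A_def)
    \<comment> \<open>\<open>R i p\<close> is the squared norm of the component of scale \<open>- (p + 1)\<close> of \<open>band (A i)\<close>, and \<open>Q p\<close> its
        total over the grid.\<close>
    define R where "R i p = coeff_energy (\<lambda>k. inner2 (band (A i)) (wavelet_fn \<psi> (- int (Suc p)) k))" for i p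
    define Q where "Q p = (\<integral>\<^sup>+i. R i p \<partial>count_space UNIV)" for p
    have grid: "(\<integral>\<^sup>+i. \<integral>\<^sup>+x. indicator (A i) x * h x \<partial>lebesgue \<partial>count_space UNIV) = (\<integral>\<^sup>+x. indicator J x * h x \<partial>lebesgue)"
      if "h \<in> borel_measurable lebesgue" for h :: "real \<Rightarrow> ennreal"
      unfolding A_def by (rule nn_integral_grid[OF that J(1) d])
    have piece: "(\<Sum>n. ?c * (\<integral>\<^sup>+x. indicator (A i) x * power_density (V n) x \<partial>lebesgue)) = (\<Sum>p. R i p)" for i
      using frame[OF band_L2[OF A Afin], of i] unfolding R_def shift_coefficients[OF vV A A_2pi] .
    have "?c * S = (\<Sum>n. ?c * (\<integral>\<^sup>+i. \<integral>\<^sup>+x. indicator (A i) x * power_density (V n) x \<partial>lebesgue \<partial>count_space UNIV))"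
      unfolding S_def grid[OF Vm] by simp
    also have "\<dots> = (\<integral>\<^sup>+i. (\<Sum>n. ?c * (\<integral>\<^sup>+x. indicator (A i) x * power_density (V n) x \<partial>lebesgue)) \<partial>count_space UNIV)"
      by (simp only: nn_integral_suminf nn_integral_cmult borel_measurable_count_space)
    also have "\<dots> = (\<Sum>p. Q p)"
      unfolding piece Q_def by (simp only: nn_integral_suminf borel_measurable_count_space)
    finally have SQ: "?c * S = (\<Sum>p. Q p)" .
    have Q_low: "Q p = ?c * T p" if "p < N" for p
    proof -
      have le: "d \<le> 2 * pi / 2 ^ Suc p"
        unfolding d_def using that by (intro divide_left_mono power_increasing) auto
      then have sub: "A i \<subseteq> {d * of_int i..<d * of_int i + 2 * pi / 2 ^ Suc p}" for i
        by (auto simp: A_def)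
      have "Q p = (\<integral>\<^sup>+i. ?c * (\<integral>\<^sup>+x. indicator (A i) x * power_density \<Psi> (2 ^ Suc p * x) \<partial>lebesgue) \<partial>count_space UNIV)"
        unfolding Q_def R_def wavelet_coefficients_short[OF fF A sub] ..
      also have "\<dots> = ?c * T p"
        unfolding T_def grid[OF \<Psi>m, symmetric] by (simp only: nn_integral_cmult borel_measurable_count_space)
      finally show ?thesis .
    qed
    have Q_high: "Q p \<le> ?c * (ennreal ((1/2) ^ N) * (ennreal (2 ^ Suc p) * T p))" if "N \<le> p" for p
    proof -
      \<comment> \<open>The number of intervals of length \<open>2 \<pi> / 2\<^sup>p\<^sup>+\<^sup>1\<close> in one grid interval.\<close>
      define M where "M = (2::nat) ^ (Suc p - N)"
      have M: "real M = (1/2) ^ N * 2 ^ Suc p"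
      proof -
        have "real M = 2 ^ (Suc p - N)" by (simp only: M_def of_nat_power of_nat_numeral)
        also have "\<dots> = 2 ^ Suc p / 2 ^ N" using that by (intro power_diff) simp_all
        also have "\<dots> = (1/2) ^ N * 2 ^ Suc p" by (simp only: power_one_over) simp
        finally show ?thesis .
      qed
      have dM: "d = real M * (2 * pi / 2 ^ Suc p)"
        unfolding M d_def by (simp add: power_one_over)
      have sub: "A i \<subseteq> {d * of_int i..<d * of_int i + real M * (2 * pi / 2 ^ Suc p)}" for i
        unfolding dM[symmetric] by (auto simp: A_def)
      have "Q p \<le> (\<integral>\<^sup>+i. ?c * (of_nat M * (\<integral>\<^sup>+x. indicator (A i) x * power_density \<Psi> (2 ^ Suc p * x) \<partial>lebesgue)) \<partial>count_space UNIV)"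
        unfolding Q_def R_def by (rule nn_integral_mono) (rule wavelet_coefficients_long[OF fF A sub])
      also have "\<dots> = ?c * (of_nat M * T p)"
        unfolding T_def grid[OF \<Psi>m, symmetric] by (simp only: nn_integral_cmult borel_measurable_count_space)
      also have "(of_nat M :: ennreal) = ennreal ((1/2) ^ N) * ennreal (2 ^ Suc p)"
        unfolding ennreal_of_nat_eq_real_of_nat M by (rule ennreal_mult) simp_all
      finally show ?thesis by (simp only: mult.assoc)
    qed
    have Q_le: "Q p \<le> ?c * (T p + ennreal ((1/2) ^ N) * (ennreal (2 ^ Suc p) * T p))" for p
    proof (cases "p < N")
      case True
      then show ?thesis unfolding Q_low[OF True] by (intro mult_left_mono) simp_all
    next
      case False
      then have "Q p \<le> ?c * (ennreal ((1/2) ^ N) * (ennreal (2 ^ Suc p) * T p))" by (intro Q_high) simp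
      also have "\<dots> \<le> ?c * (T p + ennreal ((1/2) ^ N) * (ennreal (2 ^ Suc p) * T p))"
        by (intro mult_left_mono) simp_all
      finally show ?thesis .
    qed
    have "?c * (\<Sum>p<N. T p) = (\<Sum>p<N. Q p)"
      unfolding sum_distrib_left by (rule sum.cong) (simp_all add: Q_low)
    also have "\<dots> \<le> (\<Sum>p. Q p)" by (rule sum_le_suminf) auto
    finally have "?c * (\<Sum>p<N. T p) \<le> ?c * S" by (simp only: SQ)
    then have lower: "(\<Sum>p<N. T p) \<le> S"
      using cnz by (simp add: ennreal_mult_le_mult_iff)
    have "?c * S \<le> (\<Sum>p. ?c * (T p + ennreal ((1/2) ^ N) * (ennreal (2 ^ Suc p) * T p)))"
      unfolding SQ by (intro suminf_le Q_le summableI)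
    also have "\<dots> = ?c * ((\<Sum>p. T p) + ennreal ((1/2) ^ N) * (\<Sum>p. ennreal (2 ^ Suc p) * T p))"
      by (simp only: ennreal_suminf_cmult suminf_add[OF summableI summableI, symmetric])
    finally have "?c * S \<le> ?c * ((\<Sum>p. T p) + ennreal ((1/2) ^ N) * (\<Sum>p. ennreal (2 ^ Suc p) * T p))" .
    then have "S \<le> (\<Sum>p. T p) + ennreal ((1/2) ^ N) * (\<Sum>p. ennreal (2 ^ Suc p) * T p)"
      using cnz by (simp add: ennreal_mult_le_mult_iff)
    also have "\<dots> \<le> (\<Sum>p. T p) + ennreal ((1/2) ^ N) * ennreal ((norm2 \<Psi>)\<^sup>2)"
      unfolding T_def by (intro add_left_mono mult_left_mono sum_dilated_over_shell_subset[OF \<Psi> J]) simp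
    also have "ennreal ((1/2) ^ N) * ennreal ((norm2 \<Psi>)\<^sup>2) = ennreal ((1/2) ^ N * (norm2 \<Psi>)\<^sup>2)"
      by (rule ennreal_mult[symmetric]) simp_all
    finally show ?thesis using lower by blast
  qed
  have "(\<Sum>p. T p) \<le> S"
    by (rule suminf_le_const) (use bounds in auto)
  moreover have "S \<le> (\<Sum>p. T p)"
  proof (rule LIMSEQ_le_const)
    have "(\<lambda>N. (1/2) ^ N * (norm2 \<Psi>)\<^sup>2) \<longlonglongrightarrow> 0 * (norm2 \<Psi>)\<^sup>2"
      by (intro tendsto_mult tendsto_const LIMSEQ_power_zero) simp
    then have "(\<lambda>N. ennreal ((1/2) ^ N * (norm2 \<Psi>)\<^sup>2)) \<longlonglongrightarrow> ennreal (0 * (norm2 \<Psi>)\<^sup>2)"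
      by (rule tendsto_ennrealI)
    then have "(\<lambda>N. (\<Sum>p. T p) + ennreal ((1/2) ^ N * (norm2 \<Psi>)\<^sup>2)) \<longlonglongrightarrow> (\<Sum>p. T p) + ennreal (0 * (norm2 \<Psi>)\<^sup>2)"
      by (intro tendsto_add tendsto_const)
    then show "(\<lambda>N. (\<Sum>p. T p) + ennreal ((1/2) ^ N * (norm2 \<Psi>)\<^sup>2)) \<longlonglongrightarrow> (\<Sum>p. T p)"
      by simp
    show "\<exists>N. \<forall>n\<ge>N. S \<le> (\<Sum>p. T p) + ennreal ((1/2) ^ n * (norm2 \<Psi>)\<^sup>2)"
      using bounds by blast
  qed
  ultimately show ?thesis unfolding S_def T_def by (rule order_antisym[rotated])
qed

text \<open>The shells exhaust the line up to the origin, and on each of them the two densities have the same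
  integrals.\<close>
lemma spectral_identity:
  assumes fF: "is_fourier \<psi> \<Psi>" and vV: "\<And>n::nat. is_fourier (v n) (V n)"
    and frame: "\<And>f. f \<in> L2 lebesgue \<Longrightarrow>
      (\<Sum>n. coeff_energy (\<lambda>l. inner2 f (shift l (v n))))
      = (\<Sum>p. coeff_energy (\<lambda>k. inner2 f (wavelet_fn \<psi> (- int (Suc p)) k)))"
  shows "AE x in lebesgue. (\<Sum>n. power_density (V n) x) = (\<Sum>p. power_density \<Psi> (2 ^ Suc p * x))"
proof -
  note \<Psi> = is_fourierD(2)[OF fF]
  have Vm: "power_density (V n) \<in> borel_measurable lebesgue" for n
    by (rule power_density_measurable[OF is_fourierD(2)[OF vV]])
  have \<Psi>m: "(\<lambda>x. power_density \<Psi> (2 ^ Suc p * x)) \<in> borel_measurable lebesgue" for p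
    using measurable_compose_affine[OF power_density_measurable[OF \<Psi>], of "2 ^ Suc p" 0] by simp
  have on_shell: "AE x in lebesgue. indicator (shell s) x * (\<Sum>n. power_density (V n) x)
      = indicator (shell s) x * (\<Sum>p. power_density \<Psi> (2 ^ Suc p * x))" for s
  proof (rule lebesgue.density_unique2)
    show "(\<lambda>x. indicator (shell s) x * (\<Sum>n. power_density (V n) x)) \<in> borel_measurable lebesgue"
      "(\<lambda>x. indicator (shell s) x * (\<Sum>p. power_density \<Psi> (2 ^ Suc p * x))) \<in> borel_measurable lebesgue"
      by (intro borel_measurable_times_ennreal borel_measurable_indicator shell_measurable borel_measurable_suminf_order Vm \<Psi>m)+
    fix B :: "real set" assume B: "B \<in> sets lebesgue"
    let ?J = "B \<inter> shell s"
    have J: "?J \<in> sets lebesgue" "?J \<subseteq> shell s" using B shell_measurable[of s] by auto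
    have set_eq: "(\<integral>\<^sup>+x\<in>B. indicator (shell s) x * (\<Sum>n. h n x) \<partial>lebesgue) = (\<Sum>n. \<integral>\<^sup>+x. indicator ?J x * h n x \<partial>lebesgue)"
      if h: "\<And>n. h n \<in> borel_measurable lebesgue" for h :: "nat \<Rightarrow> real \<Rightarrow> ennreal"
    proof -
      have "(\<integral>\<^sup>+x\<in>B. indicator (shell s) x * (\<Sum>n. h n x) \<partial>lebesgue) = (\<integral>\<^sup>+x. (\<Sum>n. indicator ?J x * h n x) \<partial>lebesgue)"
      proof (rule nn_integral_cong)
        fix x
        show "indicator (shell s) x * (\<Sum>n. h n x) * indicator B x = (\<Sum>n. indicator ?J x * h n x)"
          by (cases "x \<in> B"; cases "x \<in> shell s") simp_all
      qed
      also have "\<dots> = (\<Sum>n. \<integral>\<^sup>+x. indicator ?J x * h n x \<partial>lebesgue)"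
        by (rule nn_integral_suminf) (intro borel_measurable_times_ennreal borel_measurable_indicator J h)
      finally show ?thesis .
    qed
    show "(\<integral>\<^sup>+x\<in>B. indicator (shell s) x * (\<Sum>n. power_density (V n) x) \<partial>lebesgue)
        = (\<integral>\<^sup>+x\<in>B. indicator (shell s) x * (\<Sum>p. power_density \<Psi> (2 ^ Suc p * x)) \<partial>lebesgue)"
      unfolding set_eq[OF Vm] set_eq[OF \<Psi>m] by (rule spectral_identity_on_shell[OF fF vV frame J])
  qed
  then have "AE x in lebesgue. \<forall>s. indicator (shell s) x * (\<Sum>n. power_density (V n) x)
      = indicator (shell s) x * (\<Sum>p. power_density \<Psi> (2 ^ Suc p * x))"
    by (simp only: AE_all_countable) blast
  moreover have "AE x in lebesgue. x \<notin> {0::real}"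
    by (rule AE_not_in) (simp add: negligible_iff_null_sets[symmetric])
  ultimately show ?thesis
  proof eventually_elim
    case (elim x)
    then obtain s where "x \<in> shell s" using shells_cover[of x] by blast
    then show ?case using elim(1) by (auto dest!: spec[of _ s])
  qed
qed

section \<open>The wavelet dimension function\<close>
lemma infsum_ennreal_nat: "(\<Sum>\<^sub>\<infinity>n\<in>(UNIV :: nat set). f n) = (\<Sum>n. f n :: ennreal)"
  by (rule sums_unique[OF has_sum_imp_sums[OF has_sum_infsum[OF nonneg_summable_on_complete]]]) simp

lemma infsum_ennreal_from_1: "(\<Sum>\<^sub>\<infinity>j\<in>{1::nat..}. f j) = (\<Sum>n. f (Suc n) :: ennreal)"
proof -
  have "bij_betw Suc UNIV {1..}"
    by (rule bij_betwI[where g="\<lambda>n. n - 1"]) auto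
  from infsum_reindex_bij_betw[OF this, of f] show ?thesis
    by (simp only: infsum_ennreal_nat)
qed

lemma infsum_ennreal_int:
  fixes f :: "int \<Rightarrow> ennreal"
  shows "(\<Sum>\<^sub>\<infinity>k\<in>UNIV. f k) = (\<integral>\<^sup>+k. f k \<partial>count_space UNIV)"
  using infsum_reindex_bij_betw[OF bij_int_decode, of f] nn_integral_bij_count_space[OF bij_int_decode, of f]
  by (simp only: infsum_ennreal_nat nn_integral_count_space_nat)

lemma wavelet_dimension_eq:
  "wavelet_dimension \<psi> \<xi> = (\<Sum>p. \<integral>\<^sup>+k. power_density (fourier_L2 \<psi>) (2 ^ Suc p * (\<xi> + 2 * pi * of_int k)) \<partial>count_space (UNIV :: int set))"
  unfolding wavelet_dimension_def infsum_ennreal_from_1 infsum_ennreal_int power_density_def ..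

lemma wavelet_dimension_eq':
  "wavelet_dimension \<psi> \<xi> = (\<integral>\<^sup>+k. (\<Sum>p. power_density (fourier_L2 \<psi>) (2 ^ Suc p * (\<xi> + 2 * pi * of_int k))) \<partial>count_space (UNIV :: int set))"
  unfolding wavelet_dimension_eq by (rule nn_integral_suminf[symmetric]) simp

text \<open>The integral over a period is the integral over the line of the unperiodized sum, whose \<open>p\<close>-th term
  has integral \<open>2\<^sup>-\<^sup>p\<^sup>-\<^sup>1\<close> times the squared norm of the transform.\<close>
lemma wavelet_dimension_finite:
  assumes \<psi>: "\<psi> \<in> L2 lebesgue"
  shows "AE \<xi> in lebesgue. \<xi> \<in> {-pi..<pi} \<longrightarrow> wavelet_dimension \<psi> \<xi> < \<infinity>"
proof -
  let ?\<Psi> = "fourier_L2 \<psi>"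
  have \<Psi>: "?\<Psi> \<in> L2 lebesgue" by (rule is_fourierD(2)[OF is_fourier_fourier_L2[OF \<psi>]])
  have m: "power_density ?\<Psi> \<in> borel_measurable lebesgue" by (rule power_density_measurable[OF \<Psi>])
  have \<Psi>m: "(\<lambda>x. power_density ?\<Psi> (2 ^ Suc p * x)) \<in> borel_measurable lebesgue" for p
    using measurable_compose_affine[OF m, of "2 ^ Suc p" 0] by simp
  let ?h = "\<lambda>x. \<Sum>p. power_density ?\<Psi> (2 ^ Suc p * x)"
  have hm: "?h \<in> borel_measurable lebesgue" by (rule borel_measurable_suminf_order[OF \<Psi>m])
  have "wavelet_dimension \<psi> = (\<lambda>\<xi>. \<Sum>n. ?h (\<xi> + 2 * pi * of_int (int_decode n)))"
  proof
    fix \<xi>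
    show "wavelet_dimension \<psi> \<xi> = (\<Sum>n. ?h (\<xi> + 2 * pi * of_int (int_decode n)))"
      unfolding wavelet_dimension_eq'
      by (subst nn_integral_bij_count_space[OF bij_int_decode, symmetric]) (rule nn_integral_count_space_nat)
  qed
  moreover have "(\<lambda>\<xi>. \<Sum>n. ?h (\<xi> + 2 * pi * of_int (int_decode n))) \<in> borel_measurable lebesgue"
  proof (rule borel_measurable_suminf_order)
    show "(\<lambda>\<xi>. ?h (\<xi> + 2 * pi * of_int (int_decode n))) \<in> borel_measurable lebesgue" for n
      using measurable_compose_affine[OF hm, of 1 "2 * pi * of_int (int_decode n)"] by (simp only: mult_1 add.commute)
  qed
  ultimately have Dm: "wavelet_dimension \<psi> \<in> borel_measurable lebesgue" by (simp only:)
  have T: "(\<integral>\<^sup>+x. power_density ?\<Psi> (2 ^ Suc p * x) \<partial>lebesgue) = ennreal ((norm2 ?\<Psi>)\<^sup>2 * (1/2) ^ Suc p)" for p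
  proof -
    let ?I = "\<integral>\<^sup>+x. power_density ?\<Psi> (2 ^ Suc p * x) \<partial>lebesgue"
    have "ennreal (2 ^ Suc p) * ?I = ennreal ((norm2 ?\<Psi>)\<^sup>2)"
      using nn_integral_real_affine_lebesgue[OF m, of "2 ^ Suc p" 0] nn_integral_power_density[OF \<Psi>] by simp
    then have "ennreal ((1/2) ^ Suc p) * (ennreal (2 ^ Suc p) * ?I) = ennreal ((1/2) ^ Suc p) * ennreal ((norm2 ?\<Psi>)\<^sup>2)"
      by (simp only:)
    moreover have "ennreal ((1/2) ^ Suc p) * ennreal (2 ^ Suc p) = 1"
      by (subst ennreal_mult[symmetric]) (simp_all add: power_one_over)
    ultimately have "?I = ennreal ((1/2) ^ Suc p) * ennreal ((norm2 ?\<Psi>)\<^sup>2)"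
      by (simp only: mult.assoc[symmetric] mult_1)
    also have "\<dots> = ennreal ((norm2 ?\<Psi>)\<^sup>2 * (1/2) ^ Suc p)"
      by (subst ennreal_mult[symmetric]) (simp_all add: mult.commute)
    finally show ?thesis .
  qed
  have pi2: "(0::real) < 2 * pi" by simp
  have "(\<integral>\<^sup>+\<xi>. indicator {-pi..<-pi + 2 * pi} \<xi> * wavelet_dimension \<psi> \<xi> \<partial>lebesgue) = (\<integral>\<^sup>+x. ?h x \<partial>lebesgue)"
    unfolding wavelet_dimension_eq' by (rule nn_integral_periodize[OF hm pi2, symmetric])
  also have "\<dots> = (\<Sum>p. \<integral>\<^sup>+x. power_density ?\<Psi> (2 ^ Suc p * x) \<partial>lebesgue)"
    by (rule nn_integral_suminf[OF \<Psi>m])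
  also have "\<dots> < \<infinity>"
  proof -
    have "summable (\<lambda>p. (norm2 ?\<Psi>)\<^sup>2 * (1/2) ^ Suc p)"
      by (intro summable_mult summable_ignore_initial_segment[where k=1, simplified]) simp
    then show ?thesis unfolding T by (subst suminf_ennreal2) auto
  qed
  finally have "AE \<xi> in lebesgue. indicator {-pi..<-pi + 2 * pi} \<xi> * wavelet_dimension \<psi> \<xi> \<noteq> \<infinity>"
    by (intro nn_integral_PInf_AE borel_measurable_times_ennreal borel_measurable_indicator Dm) auto
  then show ?thesis
    by eventually_elim (auto simp: indicator_def top.not_eq_extremum)
qed

lemma count_levels:
  "(\<Sum>n. if enat (Suc n) \<le> M then 1 else 0 :: ennreal) = ennreal_of_enat M"
proof (cases M)
  case (enat N)
  have "(\<Sum>n. if enat (Suc n) \<le> M then 1 else 0 :: ennreal) = (\<Sum>n\<in>{..<N}. if enat (Suc n) \<le> M then 1 else 0)"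
    by (rule suminf_finite) (auto simp: enat)
  also have "\<dots> = (\<Sum>n\<in>{..<N}. 1)"
    by (rule sum.cong) (auto simp: enat)
  finally show ?thesis by (simp add: enat)
next
  case infinity
  have "of_nat N \<le> (\<Sum>n. 1 :: ennreal)" for N
    using sum_le_suminf[of "\<lambda>n. 1 :: ennreal" "{..<N}"] by simp
  then have "\<not> (\<Sum>n. 1 :: ennreal) < top"
    using ennreal_Ex_less_of_nat leD by blast
  then have "(\<Sum>n. 1 :: ennreal) = top"
    by (simp only: not_less top_unique)
  then show ?thesis by (simp add: infinity)
qed

theorem theorem1:
  fixes \<psi> :: "real \<Rightarrow> complex" and m :: "real \<Rightarrow> enat"
  assumes "wavelet \<psi>"
    and "core_multiplicity \<psi> m"
  shows "AE \<xi> in lebesgue_on {-pi..pi}.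
    m \<xi> \<noteq> \<infinity> \<and> ennreal_of_enat (m \<xi>) = wavelet_dimension \<psi> \<xi>"
proof -
  note w = assms(1)
  from assms(2) have mm: "m \<in> lebesgue_on {-pi..pi} \<rightarrow>\<^sub>M count_space UNIV"
    by (simp add: core_multiplicity_def)
  obtain v :: "nat \<Rightarrow> real \<Rightarrow> complex" where v: "\<And>n. v n \<in> core_space \<psi>"
    and gram: "\<And>n l. inner2 (shift l (v n)) (v n)
      = (LINT \<xi>|lebesgue. indicator (level_set m n) \<xi> * cis (of_int l * \<xi>)) / of_real (2 * pi)"
    and frame: "\<And>f. f \<in> core_space \<psi> \<Longrightarrow>
      (\<Sum>n. coeff_energy (\<lambda>l. inner2 f (shift l (v n))))
      = ennreal ((norm2 f)\<^sup>2)"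
    using core_generators[OF assms] by blast
  let ?\<Psi> = "fourier_L2 \<psi>"
  define V where "V n = fourier_L2 (v n)" for n
  have \<psi>: "\<psi> \<in> L2 lebesgue" by (rule wavelet_basis(1)[OF w])
  have v2: "v n \<in> L2 lebesgue" for n using v[of n] by (simp add: core_space_iff[OF w])
  have vV: "is_fourier (v n) (V n)" for n unfolding V_def by (rule is_fourier_fourier_L2[OF v2])
  have "AE x in lebesgue. (\<Sum>n. power_density (V n) x) = (\<Sum>p. power_density ?\<Psi> (2 ^ Suc p * x))"
    by (rule spectral_identity[OF is_fourier_fourier_L2[OF \<psi>] vV core_frame_identity[OF w v frame]])
  then have spec: "AE x in lebesgue. \<forall>k::int. (\<Sum>n. power_density (V n) (x + 2 * pi * of_int k))
      = (\<Sum>p. power_density ?\<Psi> (2 ^ Suc p * (x + 2 * pi * of_int k)))"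
    unfolding AE_all_countable by (intro allI) (rule AE_lebesgue_translate)
  have "AE x in lebesgue. x \<in> {-pi..<pi} \<longrightarrow>
      (\<integral>\<^sup>+k. power_density (V n) (x + 2 * pi * of_int k) \<partial>count_space (UNIV :: int set)) = indicator (level_set m n) x" for n
    by (rule periodized_power_density[OF vV level_set_measurable[OF mm] _ gram]) (auto simp: level_set_def)
  then have per: "AE x in lebesgue. \<forall>n. x \<in> {-pi..<pi} \<longrightarrow>
      (\<integral>\<^sup>+k. power_density (V n) (x + 2 * pi * of_int k) \<partial>count_space (UNIV :: int set)) = indicator (level_set m n) x"
    unfolding AE_all_countable by blast
  have pi0: "AE x in lebesgue. x \<notin> {pi}"
    by (rule AE_not_in) (simp add: negligible_iff_null_sets[symmetric])
  from spec per wavelet_dimension_finite[OF \<psi>] pi0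
  have "AE \<xi> in lebesgue. \<xi> \<in> {-pi..pi} \<longrightarrow> m \<xi> \<noteq> \<infinity> \<and> ennreal_of_enat (m \<xi>) = wavelet_dimension \<psi> \<xi>"
  proof eventually_elim
    case (elim \<xi>)
    show ?case
    proof
      assume "\<xi> \<in> {-pi..pi}"
      with elim(4) have \<xi>: "\<xi> \<in> {-pi..<pi}" by auto
      have "wavelet_dimension \<psi> \<xi> = (\<integral>\<^sup>+k. (\<Sum>n. power_density (V n) (\<xi> + 2 * pi * of_int k)) \<partial>count_space (UNIV :: int set))"
        unfolding wavelet_dimension_eq' by (simp only: elim(1))
      also have "\<dots> = (\<Sum>n. \<integral>\<^sup>+k. power_density (V n) (\<xi> + 2 * pi * of_int k) \<partial>count_space (UNIV :: int set))"
        by (rule nn_integral_suminf) simp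
      also have "\<dots> = (\<Sum>n. indicator (level_set m n) \<xi>)"
        using elim(2) \<xi> by (simp only: simp_thms)
      also have "\<dots> = (\<Sum>n. if enat (Suc n) \<le> m \<xi> then 1 else 0)"
        using \<xi> by (simp add: level_set_def indicator_def of_bool_def)
      also have "\<dots> = ennreal_of_enat (m \<xi>)" by (rule count_levels)
      finally have eq: "wavelet_dimension \<psi> \<xi> = ennreal_of_enat (m \<xi>)" .
      moreover have "m \<xi> \<noteq> \<infinity>"
        using elim(3) \<xi> unfolding eq by (cases "m \<xi>") auto
      ultimately show "m \<xi> \<noteq> \<infinity> \<and> ennreal_of_enat (m \<xi>) = wavelet_dimension \<psi> \<xi>" by simp
    qed
  qed
  then show ?thesis
    by (intro AE_restrict_space_iff[THEN iffD2]) simp_all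
qed

end
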